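(* Let $G=([n],E)$ be a minimally 2-rigid graph with $n\ge3$, and let $\prec$ be a fixed total order on $E$. Then $$2c_2(G)\ \ge\ \#\{\text{realisation bases of }(M_G,\prec)\},$$ where $c_2(G)$ is the 2-realisation number and $M_G$ is the graphic matroid of $G$.
   Context: **Rigidity.** Graphs are finite, simple, undirected, with vertex set $[n]$ and edge set $E$. A framework $(G,p)$ with $p:[n]\to\mathbb{R}^d$ is rigid if every edge-length preserving continuous deformation of the vertices comes from isometries of $\mathbb{R}^d$. $G$ is $d$-rigid if $(G,p)$ is rigid for almost all $p$ (all $p$ in some non-empty Zariski open set), and minimally $d$-rigid if moreover $G-e$ is not $d$-rigid for every edge $e$. **Realisation number.** Let $f_{G,d}:\mathbb{C}^{n\cdot d}\to\mathbb{C}^{E}$, $p\mapsto \frac12\big(\sum_{k=1}^d (p_{i,k}-p_{j,k})^2\big)_{ij\in E}$. Write $p\sim q$ if there are $A\in O(d,\mathbb{C})$ (complex matrices with $A^TA=AA^T=I$) and $x\in\mathbb{C}^d$ with $p_i=Aq_i+x$ for all $i$. For a $d$-rigid graph with $n\ge d+1$, $f_{G,d}^{-1}(f_{G,d}(p))/\!\sim$ has the same finite cardinality for all generic $p\in\mathbb{C}^{n\cdot d}$; this is the $d$-realisation number $c_d(G)$. **Realisation bases.** The graphic matroid $M_G$ is the matroid on $E$ whose circuits are the cycles of $G$. For a matroid with a total order on its ground set, a broken circuit is a set $C\setminus\{\min C\}$ with $C$ a circuit; an nbc-basis is a basis containing no broken circuit. A realisation basis of $(M_G,\prec)$ is an nbc-basis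 $B$ such that $(E\setminus B)\cup\{\min(E)\}$ is also an nbc-basis of $(M_G,\prec)$. *)

theory Defs
  imports "HOL-Analysis.Analysis"
begin

section \<open>Graphs and configurations\<close>

text \<open>A graph with vertex set \<open>{1..n}\<close> is given by its edge set, an edge being a
  two-element set of vertices.\<close>

definition simple_graph :: "nat \<Rightarrow> nat set set \<Rightarrow> bool" where
  "simple_graph n E \<longleftrightarrow> (\<forall>e\<in>E. e \<subseteq> {1..n} \<and> card e = 2)"

text \<open>The affine space \<open>K^(n d)\<close> of maps from \<open>{1..n}\<close> to \<open>K^d\<close>. Configurations are
  extensional functions, so that they are determined by their values on \<open>{1..n}\<close>.\<close>

definition configurations :: "nat \<Rightarrow> (nat \<Rightarrow> 'a ^ 'd) set" where
  "configurations n = {1..n} \<rightarrow>\<^sub>E UNIV"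

inductive_set polynomial_functions :: "nat \<Rightarrow> ((nat \<Rightarrow> 'a::comm_ring_1 ^ 'd) \<Rightarrow> 'a) set"
  for n :: nat where
  const: "(\<lambda>p. c) \<in> polynomial_functions n"
| coordinate: "i \<in> {1..n} \<Longrightarrow> (\<lambda>p. p i $ k) \<in> polynomial_functions n"
| add: "f \<in> polynomial_functions n \<Longrightarrow> g \<in> polynomial_functions n
    \<Longrightarrow> (\<lambda>p. f p + g p) \<in> polynomial_functions n"
| mult: "f \<in> polynomial_functions n \<Longrightarrow> g \<in> polynomial_functions n
    \<Longrightarrow> (\<lambda>p. f p * g p) \<in> polynomial_functions n"

definition zariski_open :: "nat \<Rightarrow> (nat \<Rightarrow> 'a::comm_ring_1 ^ 'd) set \<Rightarrow> bool" where
  "zariski_open n U \<longleftrightarrow>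
     (\<exists>F \<subseteq> polynomial_functions n. U = {p \<in> configurations n. \<exists>f\<in>F. f p \<noteq> 0})"


section \<open>Rigidity\<close>

definition rigid_framework ::
    "nat \<Rightarrow> nat set set \<Rightarrow> (nat \<Rightarrow> real ^ 'd::finite) \<Rightarrow> bool" where
  "rigid_framework n E p \<longleftrightarrow>
     (\<forall>\<gamma> :: real \<Rightarrow> nat \<Rightarrow> real ^ 'd.
        (\<forall>i\<in>{1..n}. continuous_on {0..1} (\<lambda>t. \<gamma> t i)) \<and>
        (\<forall>i\<in>{1..n}. \<gamma> 0 i = p i) \<and>
        (\<forall>t\<in>{0..1}. \<forall>i j. {i, j} \<in> E \<longrightarrow> dist (\<gamma> t i) (\<gamma> t j) = dist (p i) (p j))
        \<longrightarrow> (\<forall>t\<in>{0..1}. \<exists>T :: real ^ 'd \<Rightarrow> real ^ 'd.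
              (\<forall>x y. dist (T x) (T y) = dist x y) \<and> (\<forall>i\<in>{1..n}. \<gamma> t i = T (p i))))"

text \<open>The dimension is passed as a type argument: \<open>d\<close>-rigidity is \<open>d_rigid TYPE('d)\<close> with
  \<open>d = CARD('d)\<close>.\<close>

definition d_rigid :: "'d::finite itself \<Rightarrow> nat \<Rightarrow> nat set set \<Rightarrow> bool" where
  "d_rigid d n E \<longleftrightarrow>
     (\<exists>U :: (nat \<Rightarrow> real ^ 'd) set.
        zariski_open n U \<and> U \<noteq> {} \<and> (\<forall>p\<in>U. rigid_framework n E p))"

definition minimally_d_rigid :: "'d::finite itself \<Rightarrow> nat \<Rightarrow> nat set set \<Rightarrow> bool" where
  "minimally_d_rigid d n E \<longleftrightarrow> d_rigid d n E \<and> (\<forall>e\<in>E. \<not> d_rigid d n (E - {e}))"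


section \<open>The realisation number\<close>

text \<open>\<open>Min e\<close> and \<open>Max e\<close> are the two endpoints of the edge \<open>e\<close>; the value does not depend on
  their order.\<close>

definition measurement_map ::
    "nat set set \<Rightarrow> (nat \<Rightarrow> complex ^ 'd::finite) \<Rightarrow> nat set \<Rightarrow> complex" where
  "measurement_map E p = (\<lambda>e\<in>E. 1/2 * (\<Sum>k\<in>UNIV. (p (Min e) $ k - p (Max e) $ k)\<^sup>2))"

definition fibre ::
    "nat \<Rightarrow> nat set set \<Rightarrow> (nat \<Rightarrow> complex ^ 'd::finite) \<Rightarrow> (nat \<Rightarrow> complex ^ 'd) set" where
  "fibre n E p = {q \<in> configurations n. measurement_map E q = measurement_map E p}"

text \<open>Over the complex numbers, \<^const>\<open>orthogonal_matrix\<close> uses the transpose without conjugation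
  and so describes the group \<open>O(d, \<complex>)\<close>, not the unitary group.\<close>

definition congruence :: "nat \<Rightarrow> ((nat \<Rightarrow> complex ^ 'd::finite) \<times> (nat \<Rightarrow> complex ^ 'd)) set" where
  "congruence n =
     {(p, q). p \<in> configurations n \<and> q \<in> configurations n \<and>
        (\<exists>(A :: complex ^ 'd ^ 'd) x.
           orthogonal_matrix A \<and> (\<forall>i\<in>{1..n}. p i = A *v q i + x))}"

text \<open>The common number of congruence classes in the fibres through generic points, that is,
  through all points of some non-empty Zariski open set. Two non-empty Zariski open sets
  intersect, so there is at most one such number; it exists if the graph is \<open>d\<close>-rigid and
  \<open>n \<ge> d + 1\<close>, and is unspecified if it does not exist.\<close>

definition realisation_number :: "'d::finite itself \<Rightarrow> nat \<Rightarrow> nat set set \<Rightarrow> nat" where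
  "realisation_number d n E =
     (THE c. \<exists>U :: (nat \<Rightarrow> complex ^ 'd) set.
        zariski_open n U \<and> U \<noteq> {} \<and>
        (\<forall>p\<in>U. finite (fibre n E p // congruence n) \<and>
               card (fibre n E p // congruence n) = c))"


section \<open>Matroids and realisation bases\<close>

text \<open>A matroid is represented by its ground set \<open>E\<close> and its set \<open>\<C>\<close> of circuits.\<close>

definition independent_in :: "'e set \<Rightarrow> 'e set set \<Rightarrow> 'e set \<Rightarrow> bool" where
  "independent_in E \<C> I \<longleftrightarrow> I \<subseteq> E \<and> (\<forall>C\<in>\<C>. \<not> C \<subseteq> I)"

definition basis_of :: "'e set \<Rightarrow> 'e set set \<Rightarrow> 'e set \<Rightarrow> bool" where
  "basis_of E \<C> B \<longleftrightarrow>
     independent_in E \<C> B \<and> (\<forall>I. independent_in E \<C> I \<and> B \<subseteq> I \<longrightarrow> I = B)"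

text \<open>A total order is a reflexive relation \<open>r\<close> as in \<^const>\<open>linear_order_on\<close>: a pair \<open>(x, y)\<close>
  in \<open>r\<close> means that \<open>x\<close> precedes or equals \<open>y\<close>.\<close>

definition min_wrt :: "('e \<times> 'e) set \<Rightarrow> 'e set \<Rightarrow> 'e" where
  "min_wrt r S = (THE m. m \<in> S \<and> (\<forall>x\<in>S. (m, x) \<in> r))"

definition broken_circuits :: "'e set set \<Rightarrow> ('e \<times> 'e) set \<Rightarrow> 'e set set" where
  "broken_circuits \<C> r = (\<lambda>C. C - {min_wrt r C}) ` \<C>"

definition nbc_basis :: "'e set \<Rightarrow> 'e set set \<Rightarrow> ('e \<times> 'e) set \<Rightarrow> 'e set \<Rightarrow> bool" where
  "nbc_basis E \<C> r B \<longleftrightarrow> basis_of E \<C> B \<and> (\<forall>D\<in>broken_circuits \<C> r. \<not> D \<subseteq> B)"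

definition realisation_basis :: "'e set \<Rightarrow> 'e set set \<Rightarrow> ('e \<times> 'e) set \<Rightarrow> 'e set \<Rightarrow> bool" where
  "realisation_basis E \<C> r B \<longleftrightarrow>
     nbc_basis E \<C> r B \<and> nbc_basis E \<C> r ((E - B) \<union> {min_wrt r E})"

text \<open>The edge sets of the cycles of a graph, which are the circuits of its graphic matroid; a
  cycle is given by its list of distinct vertices in cyclic order.\<close>

definition cycle_edges :: "nat list \<Rightarrow> nat set set" where
  "cycle_edges vs = {{vs ! i, vs ! (Suc i mod length vs)} | i. i < length vs}"

definition graph_cycles :: "nat set set \<Rightarrow> nat set set set" where
  "graph_cycles E =
     {cycle_edges vs | vs. distinct vs \<and> 3 \<le> length vs \<and> cycle_edges vs \<subseteq> E}"

end

theory Submission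
  imports Defs "HOL-Computational_Algebra.Fundamental_Theorem_Algebra"
begin

text \<open>
  In the isotropic coordinates \<open>x = p\<^sub>1 + \<i> p\<^sub>2\<close> and \<open>y = p\<^sub>1 - \<i> p\<^sub>2\<close>, the squared length of an edge is the
  product of the differences of \<open>x\<close> and \<open>y\<close> along it. A fibre of the measurement map is therefore the
  solution set of equations \<open>u\<^sub>e v\<^sub>e = l\<^sub>e\<close>, one for each edge, where \<open>u\<close> and \<open>v\<close> are vectors of
  differences along the edges. For a connected graph, congruence amounts to scaling \<open>u\<close> and \<open>v\<close> inversely
  to each other and to exchanging them.

  Let the values \<open>l\<^sub>e\<close> decrease very rapidly along the order of the edges. If \<open>B\<close> is a basis without broken
  circuits and \<open>e\<close> lies outside \<open>B\<close>, the fundamental circuit of \<open>e\<close> has its least element in \<open>B\<close>. So if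
  \<open>u\<close> decreases rapidly on \<open>B\<close>, the value \<open>u\<^sub>e\<close> is, up to sign and a small error, the value at an earlier
  edge of \<open>B\<close>. For a realisation basis \<open>B\<close>, use this for \<open>u\<close> on \<open>B\<close> and for \<open>v\<close> on the complementary basis
  \<open>B'\<close>. After normalising \<open>u\<close> at the least edge, the equations become a triangular system in the values of
  \<open>u\<close> on \<open>B\<close> and of \<open>v\<close> on \<open>B'\<close> with small error terms; a contraction argument (\<open>triangular_system\<close>)
  solves it, which gives \<open>solution_of_realisation_basis\<close>. The basis can be read off from the solution: it
  consists of the edges at which \<open>u\<close> is much smaller than at all earlier edges, and \<open>B'\<close> arises in the same
  way from \<open>v\<close>. Hence at most two realisation bases, \<open>B\<close> and \<open>B'\<close>, lead to the same congruence class
  (\<open>at_most_two_bases_per_class\<close>). The admissible \<open>l\<close> form a Euclidean open set, and non-empty Zariski open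
  sets are dense, so such an \<open>l\<close> also occurs over a generic configuration.

  It remains to show that a generic number of classes exists at all, since otherwise the realisation
  number would be unspecified. By quantifier elimination over the complex numbers
  (\<open>constructible_ex\<close>), having at least \<open>m\<close> classes in the fibre is a constructible condition on the
  configuration, hence generically true or generically false (\<open>constructible_generic\<close>). It is false for
  large \<open>m\<close>: a normalised solution is described by as many numbers as there are edges, the \<open>l\<^sub>e\<close> are
  polynomials in these numbers, and such a polynomial map has fibres of bounded size outside a hypersurface
  (\<open>generically_finite_fibres\<close>, by a count of monomials); the image of the map is not contained in that
  hypersurface because it contains a Euclidean open set. The generic number is the largest \<open>m\<close> for which the
  condition is generically true.

  If there is no realisation basis, the bound is trivial. Rigidity enters through connectedness: components
  of a disconnected framework can be translated independently.
\<close>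


section \<open>Polynomial functions and constructible predicates\<close>

text \<open>Polynomials are handled as functions on assignments \<open>'v \<Rightarrow> complex\<close>. The parameter \<open>I\<close> bounds the
  variables that occur, which is what dimension counts need.\<close>

inductive_set poly_funs :: "'v set \<Rightarrow> (('v \<Rightarrow> complex) \<Rightarrow> complex) set"
  for I :: "'v set" where
  const: "(\<lambda>v. c) \<in> poly_funs I"
| var: "i \<in> I \<Longrightarrow> (\<lambda>v. v i) \<in> poly_funs I"
| add: "f \<in> poly_funs I \<Longrightarrow> g \<in> poly_funs I \<Longrightarrow> (\<lambda>v. f v + g v) \<in> poly_funs I"
| mult: "f \<in> poly_funs I \<Longrightarrow> g \<in> poly_funs I \<Longrightarrow> (\<lambda>v. f v * g v) \<in> poly_funs I"

lemma poly_funs_uminus: "f \<in> poly_funs I \<Longrightarrow> (\<lambda>v. - f v) \<in> poly_funs I"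
  using poly_funs.mult[OF poly_funs.const[of "-1"], of f] by simp

lemma poly_funs_diff:
  "f \<in> poly_funs I \<Longrightarrow> g \<in> poly_funs I \<Longrightarrow> (\<lambda>v. f v - g v) \<in> poly_funs I"
  using poly_funs.add[OF _ poly_funs_uminus, of f I g] by simp

lemma poly_funs_sum:
  "(\<And>a. a \<in> A \<Longrightarrow> f a \<in> poly_funs I) \<Longrightarrow> (\<lambda>v. \<Sum>a\<in>A. f a v) \<in> poly_funs I"
  by (induction A rule: infinite_finite_induct) (auto intro: poly_funs.intros)

lemma poly_funs_prod:
  "(\<And>a. a \<in> A \<Longrightarrow> f a \<in> poly_funs I) \<Longrightarrow> (\<lambda>v. \<Prod>a\<in>A. f a v) \<in> poly_funs I"
  by (induction A rule: infinite_finite_induct) (auto intro: poly_funs.intros)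

lemma poly_funs_power: "f \<in> poly_funs I \<Longrightarrow> (\<lambda>v. f v ^ k) \<in> poly_funs I"
  by (induction k) (auto intro: poly_funs.intros)

lemmas poly_funs_intros =
  poly_funs.intros poly_funs_uminus poly_funs_diff poly_funs_sum poly_funs_prod poly_funs_power

lemma poly_funs_compose:
  assumes "f \<in> poly_funs I" and "\<And>i. i \<in> I \<Longrightarrow> h i \<in> poly_funs J"
  shows "(\<lambda>v. f (\<lambda>i. h i v)) \<in> poly_funs J"
  using assms by (induction) (auto intro: poly_funs.intros)

lemma poly_funs_cong:
  assumes "f \<in> poly_funs I" "\<And>i. i \<in> I \<Longrightarrow> v i = w i"
  shows "f v = f w"
  using assms by induction auto

text \<open>Restriction to a line turns questions about several variables into questions about the
  finitely many roots of a univariate polynomial.\<close>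

lemma poly_funs_on_line:
  assumes "f \<in> poly_funs I"
  shows "\<exists>q. \<forall>t. f (\<lambda>i. a i + t * (b i - a i)) = poly q t"
  using assms
proof induction
  case (const c)
  show ?case by (intro exI[of _ "[:c:]"]) simp
next
  case (var i)
  show ?case by (intro exI[of _ "[:a i, b i - a i:]"]) simp
next
  case (add f g)
  then obtain p q where "\<forall>t. f (\<lambda>i. a i + t * (b i - a i)) = poly p t"
    "\<forall>t. g (\<lambda>i. a i + t * (b i - a i)) = poly q t" by blast
  then show ?case by (intro exI[of _ "p + q"]) simp
next
  case (mult f g)
  then obtain p q where "\<forall>t. f (\<lambda>i. a i + t * (b i - a i)) = poly p t"
    "\<forall>t. g (\<lambda>i. a i + t * (b i - a i)) = poly q t" by blast
  then show ?case by (intro exI[of _ "p * q"]) simp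
qed

definition line_closed :: "('v \<Rightarrow> complex) set \<Rightarrow> bool" where
  "line_closed S \<longleftrightarrow> (\<forall>a\<in>S. \<forall>b\<in>S. \<forall>t. (\<lambda>i. a i + t * (b i - a i)) \<in> S)"

text \<open>Irreducibility of an affine subspace: on the line that joins a non-zero of \<open>f\<close> to a non-zero of
  \<open>g\<close>, both restrict to non-zero univariate polynomials, and so does their product.\<close>

lemma poly_funs_common_nonzero:
  assumes "f \<in> poly_funs I" "g \<in> poly_funs J" "line_closed S"
    and "a \<in> S" "f a \<noteq> 0" "b \<in> S" "g b \<noteq> 0"
  shows "\<exists>v\<in>S. f v * g v \<noteq> 0"
proof -
  obtain p q where p: "\<forall>t. f (\<lambda>i. a i + t * (b i - a i)) = poly p t"
    and q: "\<forall>t. g (\<lambda>i. a i + t * (b i - a i)) = poly q t"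
    using poly_funs_on_line[OF assms(1)] poly_funs_on_line[OF assms(2)] by meson
  have "poly p 0 \<noteq> 0" "poly q 1 \<noteq> 0"
    using p[rule_format, of 0] q[rule_format, of 1] assms by auto
  then have "p * q \<noteq> 0" by auto
  then obtain t where "poly (p * q) t \<noteq> 0"
    using poly_all_0_iff_0 by blast
  then have "f (\<lambda>i. a i + t * (b i - a i)) * g (\<lambda>i. a i + t * (b i - a i)) \<noteq> 0"
    using p q by simp
  moreover have "(\<lambda>i. a i + t * (b i - a i)) \<in> S"
    using assms unfolding line_closed_def by blast
  ultimately show ?thesis by (rule_tac bexI)
qed

text \<open>A non-empty Zariski open set is dense in the Euclidean topology: a polynomial that does not vanish
  on a line through \<open>b\<close> has only finitely many roots on it, so it is non-zero at points of the line
  arbitrarily close to \<open>b\<close>.\<close>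

lemma poly_funs_nonzero_near:
  assumes "f \<in> poly_funs I" "line_closed S"
    and "a \<in> S" "f a \<noteq> 0" "b \<in> S"
    and "eventually (\<lambda>t. Q (\<lambda>i. b i + t * (a i - b i))) (at (0::complex))"
  shows "\<exists>v\<in>S. f v \<noteq> 0 \<and> Q v"
proof -
  obtain p where p: "\<forall>t. f (\<lambda>i. b i + t * (a i - b i)) = poly p t"
    using poly_funs_on_line[OF assms(1)] by meson
  have "poly p 1 \<noteq> 0" using p[rule_format, of 1] assms by auto
  then have "p \<noteq> 0" by auto
  then have "finite {t. poly p t = 0}" by (rule poly_roots_finite)
  then have "eventually (\<lambda>t. t \<notin> {t. poly p t = 0}) (at 0)"
    using islimpt_finite islimpt_iff_eventually by blast
  then have "eventually (\<lambda>t. poly p t \<noteq> 0 \<and> Q (\<lambda>i. b i + t * (a i - b i))) (at 0)"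
    using assms(6) by eventually_elim auto
  then obtain t where "poly p t \<noteq> 0" "Q (\<lambda>i. b i + t * (a i - b i))"
    using eventually_happens trivial_limit_at by blast
  moreover have "(\<lambda>i. b i + t * (a i - b i)) \<in> S"
    using assms unfolding line_closed_def by blast
  ultimately show ?thesis using p by metis
qed

text \<open>These are the quantifier-free formulas in the language of fields, that is, the constructible
  sets.\<close>

inductive constructible :: "(('v \<Rightarrow> complex) \<Rightarrow> bool) \<Rightarrow> bool" where
  zero: "f \<in> poly_funs UNIV \<Longrightarrow> constructible (\<lambda>v. f v = 0)"
| neg: "constructible P \<Longrightarrow> constructible (\<lambda>v. \<not> P v)"
| conj: "constructible P \<Longrightarrow> constructible Q \<Longrightarrow> constructible (\<lambda>v. P v \<and> Q v)"

lemma constructible_disj: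
  "constructible P \<Longrightarrow> constructible Q \<Longrightarrow> constructible (\<lambda>v. P v \<or> Q v)"
  using constructible.neg[OF constructible.conj[OF constructible.neg constructible.neg], of P Q]
  by simp

lemma constructible_const: "constructible (\<lambda>v. b)"
  using constructible.zero[OF poly_funs.const[of "of_bool (\<not> b)" UNIV]] by simp

lemma constructible_ball:
  "finite A \<Longrightarrow> (\<And>a. a \<in> A \<Longrightarrow> constructible (P a)) \<Longrightarrow> constructible (\<lambda>v. \<forall>a\<in>A. P a v)"
  by (induction A rule: finite_induct) (auto intro: constructible.conj constructible_const)

lemma constructible_bex:
  "finite A \<Longrightarrow> (\<And>a. a \<in> A \<Longrightarrow> constructible (P a)) \<Longrightarrow> constructible (\<lambda>v. \<exists>a\<in>A. P a v)"
  by (induction A rule: finite_induct) (auto intro: constructible_disj constructible_const)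

lemma constructible_eq:
  "f \<in> poly_funs UNIV \<Longrightarrow> g \<in> poly_funs UNIV \<Longrightarrow> constructible (\<lambda>v. f v = g v)"
  using constructible.zero[OF poly_funs_diff, of f g] by simp

text \<open>Each atom \<open>f = 0\<close> is decided off the zero set of \<open>f\<close>, or everywhere if \<open>f\<close> vanishes on \<open>S\<close>, and
  irreducibility lets finitely many such decisions be made at once.\<close>

lemma constructible_generic:
  assumes "constructible P" "line_closed S" "S \<noteq> {}"
  shows "\<exists>g\<in>poly_funs UNIV. (\<exists>v\<in>S. g v \<noteq> 0) \<and>
           ((\<forall>v\<in>S. g v \<noteq> 0 \<longrightarrow> P v) \<or> (\<forall>v\<in>S. g v \<noteq> 0 \<longrightarrow> \<not> P v))"
  using assms(1)
proof induction
  case (zero f)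
  show ?case
  proof (cases "\<exists>v\<in>S. f v \<noteq> 0")
    case True
    then show ?thesis using zero by (intro bexI[of _ f]) auto
  next
    case False
    then show ?thesis using assms(3)
      by (intro bexI[of _ "\<lambda>_. 1"]) (auto intro: poly_funs.intros)
  qed
next
  case (neg P)
  then show ?case by blast
next
  case (conj P Q)
  from conj.IH(1) obtain g where g: "g \<in> poly_funs UNIV" "\<exists>v\<in>S. g v \<noteq> 0"
    "(\<forall>v\<in>S. g v \<noteq> 0 \<longrightarrow> P v) \<or> (\<forall>v\<in>S. g v \<noteq> 0 \<longrightarrow> \<not> P v)" by blast
  from conj.IH(2) obtain h where h: "h \<in> poly_funs UNIV" "\<exists>v\<in>S. h v \<noteq> 0"
    "(\<forall>v\<in>S. h v \<noteq> 0 \<longrightarrow> Q v) \<or> (\<forall>v\<in>S. h v \<noteq> 0 \<longrightarrow> \<not> Q v)" by blast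
  have "\<exists>v\<in>S. g v * h v \<noteq> 0"
    using poly_funs_common_nonzero[OF g(1) h(1) assms(2)] g(2) h(2) by blast
  then show ?case using g h
    by (intro bexI[of _ "\<lambda>v. g v * h v"]) (auto intro: poly_funs.intros)
qed

text \<open>A polynomial in one distinguished variable whose coefficients are polynomials in parameters \<open>v\<close>.
  The bound \<open>D\<close> is strict and uniform in \<open>v\<close>, and \<open>D = 0\<close> stands for the zero polynomial; the actual
  degree may drop at special parameters.\<close>

definition poly_families :: "nat \<Rightarrow> (('v \<Rightarrow> complex) \<Rightarrow> complex poly) set" where
  "poly_families D = {q. (\<forall>v. \<forall>i\<ge>D. coeff (q v) i = 0) \<and>
     (\<forall>i. (\<lambda>v. coeff (q v) i) \<in> poly_funs UNIV)}"

lemma poly_families_coeff: "q \<in> poly_families D \<Longrightarrow> (\<lambda>v. coeff (q v) i) \<in> poly_funs UNIV"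
  by (simp add: poly_families_def)

lemma poly_families_zero: "q \<in> poly_families D \<Longrightarrow> i \<ge> D \<Longrightarrow> coeff (q v) i = 0"
  by (simp add: poly_families_def)

lemma poly_families_const:
  assumes "f \<in> poly_funs UNIV"
  shows "(\<lambda>v. [:f v:]) \<in> poly_families 1"
proof -
  have "(\<lambda>v. coeff [:f v:] i) \<in> poly_funs UNIV" for i
    using assms by (cases i) (simp_all add: poly_funs.const)
  moreover have "coeff [:f v:] i = 0" if "i \<ge> 1" for v i
    using that by (cases i) auto
  ultimately show ?thesis unfolding poly_families_def by blast
qed

lemma poly_families_add:
  assumes "p \<in> poly_families D" "q \<in> poly_families D'"
  shows "(\<lambda>v. p v + q v) \<in> poly_families (max D D')"
  using assms unfolding poly_families_def by (auto intro: poly_funs.intros)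

lemma poly_families_mult:
  assumes "p \<in> poly_families D" "q \<in> poly_families D'"
  shows "(\<lambda>v. p v * q v) \<in> poly_families (D + D')"
proof -
  have "coeff (p v * q v) k = 0" if "k \<ge> D + D'" for v k
  proof -
    have "coeff (p v) i * coeff (q v) (k - i) = 0" if "i \<le> k" for i
      using that \<open>k \<ge> D + D'\<close> assms[THEN poly_families_zero] by (cases "i \<ge> D") auto
    then show ?thesis unfolding coeff_mult by (intro sum.neutral) auto
  qed
  moreover have "(\<lambda>v. coeff (p v * q v) k) \<in> poly_funs UNIV" for k
    unfolding coeff_mult
    by (intro poly_funs_intros poly_families_coeff[OF assms(1)] poly_families_coeff[OF assms(2)])
  ultimately show ?thesis unfolding poly_families_def by blast
qed

lemma poly_families_power:
  assumes "p \<in> poly_families D"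
  shows "\<exists>D'. (\<lambda>v. p v ^ k) \<in> poly_families D'"
proof (induction k)
  case 0
  show ?case using poly_families_const[OF poly_funs.const[of 1]] by (auto simp: one_pCons)
next
  case (Suc k)
  then show ?case using poly_families_mult[OF assms] by auto
qed

lemma poly_families_truncate:
  assumes "q \<in> poly_families (Suc d)"
  shows "(\<lambda>v. q v - monom (coeff (q v) d) d) \<in> poly_families d"
proof -
  have coeffs: "coeff (q v - monom (coeff (q v) d) d) i = (if i = d then 0 else coeff (q v) i)"
    for v i by simp
  have "(\<lambda>v. coeff (q v - monom (coeff (q v) d) d) i) \<in> poly_funs UNIV" for i
    unfolding coeffs using poly_families_coeff[OF assms, of i]
    by (cases "i = d") (simp_all add: poly_funs.const)
  moreover have "coeff (q v - monom (coeff (q v) d) d) i = 0" if "i \<ge> d" for v i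
    unfolding coeffs using poly_families_zero[OF assms, of i v] that le_neq_implies_less[of d i]
    by (metis Suc_leI)
  ultimately show ?thesis unfolding poly_families_def by blast
qed

text \<open>A step of pseudo-division: the factor in front of \<open>q\<close> avoids dividing by the leading coefficient of
  \<open>p\<close>, which depends on the parameters.\<close>

lemma poly_families_reduce:
  assumes "p \<in> poly_families (Suc d)" "q \<in> poly_families (Suc k)" "d \<le> k"
  shows "(\<lambda>v. smult (coeff (p v) d) (q v) - monom (coeff (q v) k) (k - d) * p v)
           \<in> poly_families k"
proof -
  let ?r = "\<lambda>v. smult (coeff (p v) d) (q v) - monom (coeff (q v) k) (k - d) * p v"
  have coeffs: "coeff (?r v) i = coeff (p v) d * coeff (q v) i -
      (if i < k - d then 0 else coeff (q v) k * coeff (p v) (i - (k - d)))" for v i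
    by (simp add: coeff_monom_mult)
  note pq = poly_families_coeff[OF assms(1)] poly_families_coeff[OF assms(2)]
  have "(\<lambda>v. coeff (?r v) i) \<in> poly_funs UNIV" for i
    unfolding coeffs by (cases "i < k - d") (auto intro!: poly_funs.const poly_funs.mult poly_funs_diff poly_funs_uminus pq)
  moreover have "coeff (?r v) i = 0" if "i \<ge> k" for v i
  proof (cases "i = k")
    case True
    then show ?thesis unfolding coeffs using assms(3) by simp
  next
    case False
    then show ?thesis
      unfolding coeffs using that assms(3) poly_families_zero[OF assms(1), of "i - (k - d)" v]
        poly_families_zero[OF assms(2), of i v] by simp
  qed
  ultimately show ?thesis unfolding poly_families_def by blast
qed

lemma poly_family_of_poly_fun:
  assumes "f \<in> poly_funs UNIV"
  shows "\<exists>D. \<exists>q\<in>poly_families D. \<forall>v x. f (v(a := x)) = poly (q v) x"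
  using assms
proof induction
  case (const c)
  show ?case
    using poly_families_const[OF poly_funs.const[of c]] by (intro exI bexI) auto
next
  case (var i)
  show ?case
  proof (cases "i = a")
    case True
    have "(\<lambda>v. [:0, 1:]) \<in> poly_families 2"
      unfolding poly_families_def
      by (auto simp: coeff_pCons numeral_2_eq_2 Suc_le_eq split: nat.split intro: poly_funs.const)
    then show ?thesis using True by (intro exI bexI[of _ "\<lambda>v. [:0, 1:]"]) auto
  next
    case False
    then show ?thesis
      using poly_families_const[OF poly_funs.var[of i]] by (intro exI bexI) auto
  qed
next
  case (add f g)
  then obtain D D' p q where "p \<in> poly_families D" "q \<in> poly_families D'"
    "\<forall>v x. f (v(a := x)) = poly (p v) x" "\<forall>v x. g (v(a := x)) = poly (q v) x" by blast
  then show ?case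
    by (intro exI bexI[of _ "\<lambda>v. p v + q v"]) (auto simp: fun_upd_def intro: poly_families_add)
next
  case (mult f g)
  then obtain D D' p q where "p \<in> poly_families D" "q \<in> poly_families D'"
    "\<forall>v x. f (v(a := x)) = poly (p v) x" "\<forall>v x. g (v(a := x)) = poly (q v) x" by blast
  then show ?case
    by (intro exI bexI[of _ "\<lambda>v. p v * q v"]) (auto simp: fun_upd_def intro: poly_families_mult)
qed

text \<open>Pseudo-division by \<open>p\<close> ends with a remainder of smaller degree, and \<open>p\<close> divides \<open>q\<close> exactly if all
  coefficients of this remainder vanish.\<close>

lemma constructible_dvd:
  assumes p: "p \<in> poly_families (Suc d)" and q: "q \<in> poly_families D"
  shows "\<exists>P. constructible P \<and> (\<forall>v. coeff (p v) d \<noteq> 0 \<longrightarrow> P v \<longleftrightarrow> p v dvd q v)"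
  using q
proof (induction D arbitrary: q)
  case 0
  then have "q v = 0" for v by (simp add: poly_families_def poly_eq_iff)
  then show ?case using constructible_const[of True] by auto
next
  case (Suc k)
  show ?case
  proof (cases "d \<le> k")
    case True
    let ?r = "\<lambda>v. smult (coeff (p v) d) (q v) - monom (coeff (q v) k) (k - d) * p v"
    obtain P where P: "constructible P" "\<forall>v. coeff (p v) d \<noteq> 0 \<longrightarrow> P v \<longleftrightarrow> p v dvd ?r v"
      using Suc.IH[OF poly_families_reduce[OF p Suc.prems True]] by blast
    have "p v dvd ?r v \<longleftrightarrow> p v dvd q v" if "coeff (p v) d \<noteq> 0" for v
    proof -
      have "p v dvd ?r v \<longleftrightarrow> p v dvd smult (coeff (p v) d) (q v)"
        by (metis diff_add_cancel dvd_add_left_iff dvd_triv_right)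
      then show ?thesis using that by (simp add: dvd_smult_iff)
    qed
    then show ?thesis using P by auto
  next
    case False
    have "p v dvd q v \<longleftrightarrow> (\<forall>i\<in>{..k}. coeff (q v) i = 0)" if c: "coeff (p v) d \<noteq> 0" for v
    proof
      assume dvd: "p v dvd q v"
      have "degree (q v) < Suc k \<or> q v = 0"
        using poly_families_zero[OF Suc.prems]
        by (metis leading_coeff_0_iff linorder_not_less)
      moreover have "d \<le> degree (p v)" using c by (rule le_degree)
      ultimately have "q v = 0" using dvd False by (meson dvd_imp_degree_le le_trans linorder_not_less not_less_eq_eq)
      then show "\<forall>i\<in>{..k}. coeff (q v) i = 0" by simp
    next
      assume "\<forall>i\<in>{..k}. coeff (q v) i = 0"
      then have "q v = 0" using poly_families_zero[OF Suc.prems]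
        by (metis atMost_iff leading_coeff_0_iff not_less_eq_eq)
      then show "p v dvd q v" by simp
    qed
    moreover have "constructible (\<lambda>v. \<forall>i\<in>{..k}. coeff (q v) i = 0)"
      by (intro constructible_ball constructible.zero poly_families_coeff[OF Suc.prems]) auto
    ultimately show ?thesis by blast
  qed
qed

text \<open>The core of quantifier elimination for the complex numbers. As long as there are two equations, the
  one of larger degree is reduced by the other. A leading coefficient that may vanish gives a case
  distinction, and when it does vanish the degree bound drops. For a single equation \<open>q = 0\<close>, the
  Nullstellensatz in one variable says that every root of \<open>q\<close> is a root of \<open>g\<close> exactly if \<open>q\<close> divides
  a power of \<open>g\<close>.\<close>

lemma constructible_ex_root_list:
  fixes g :: "('v \<Rightarrow> complex) \<Rightarrow> complex poly"
  assumes "g \<in> poly_families Dg" and "\<forall>(D, q)\<in>set qs. q \<in> poly_families D"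
  shows "constructible (\<lambda>v. \<exists>x. (\<forall>(D, q)\<in>set qs. poly (q v) x = 0) \<and> poly (g v) x \<noteq> 0)"
  using assms(2)
proof (induction "sum_list (map (\<lambda>(D, q). Suc D) qs)" arbitrary: qs rule: less_induct)
  case less
  show ?case
  proof (cases "\<exists>q. (0, q) \<in> set qs")
    case True
    then obtain q as bs where qs: "qs = as @ (0, q) # bs" by (meson split_list)
    have "q v = 0" for v using less.prems qs by (auto simp: poly_families_def poly_eq_iff)
    moreover have "constructible (\<lambda>v. \<exists>x. (\<forall>(D, q)\<in>set (as @ bs). poly (q v) x = 0)
        \<and> poly (g v) x \<noteq> 0)"
      using less.prems qs by (intro less.hyps) auto
    ultimately show ?thesis using qs by simp
  next
    case False
    consider (none) "qs = []" | (one) D q where "qs = [(D, q)]"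
      | (two) D q D' q' as where "qs = (D, q) # (D', q') # as"
      by (metis list.exhaust surj_pair)
    then show ?thesis
    proof cases
      case none
      have "(\<exists>x. poly (g v) x \<noteq> 0) \<longleftrightarrow> (\<exists>i\<in>{..<Dg}. coeff (g v) i \<noteq> 0)" for v
      proof -
        have "(\<exists>x. poly (g v) x \<noteq> 0) \<longleftrightarrow> g v \<noteq> 0"
          using poly_all_0_iff_0[of "g v"] by auto
        also have "\<dots> \<longleftrightarrow> (\<exists>i\<in>{..<Dg}. coeff (g v) i \<noteq> 0)"
          using poly_families_zero[OF assms(1)]
          by (metis coeff_0 leading_coeff_0_iff lessThan_iff linorder_not_less)
        finally show ?thesis .
      qed
      moreover have "constructible (\<lambda>v. \<exists>i\<in>{..<Dg}. coeff (g v) i \<noteq> 0)"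
        by (intro constructible_bex constructible.neg constructible.zero
            poly_families_coeff[OF assms(1)]) auto
      ultimately show ?thesis using none by simp
    next
      case (one D q)
      then obtain d where D: "D = Suc d" using False by (cases D) auto
      have q: "q \<in> poly_families (Suc d)" using less.prems one D by auto
      let ?c = "\<lambda>v. coeff (q v) d"
      let ?q = "\<lambda>v. q v - monom (?c v) d"
      have "constructible (\<lambda>v. \<exists>x. (\<forall>(D, q)\<in>set [(d, ?q)]. poly (q v) x = 0)
          \<and> poly (g v) x \<noteq> 0)"
        using one D poly_families_truncate[OF q] by (intro less.hyps) auto
      moreover obtain Dh where "(\<lambda>v. g v ^ d) \<in> poly_families Dh"
        using poly_families_power[OF assms(1)] by blast
      then obtain P where P: "constructible P"
        "\<forall>v. ?c v \<noteq> 0 \<longrightarrow> P v \<longleftrightarrow> q v dvd g v ^ d"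
        using constructible_dvd[OF q] by blast
      moreover have "constructible (\<lambda>v. ?c v = 0)"
        by (intro constructible.zero poly_families_coeff[OF q])
      ultimately have "constructible (\<lambda>v.
          ?c v = 0 \<and> (\<exists>x. (\<forall>(D, q)\<in>set [(d, ?q)]. poly (q v) x = 0) \<and> poly (g v) x \<noteq> 0)
          \<or> \<not> ?c v = 0 \<and> \<not> P v)"
        by (intro constructible_disj constructible.conj constructible.neg)
      moreover have "?c v = 0 \<and> (\<exists>x. (\<forall>(D, q)\<in>set [(d, ?q)]. poly (q v) x = 0) \<and> poly (g v) x \<noteq> 0)
          \<or> \<not> ?c v = 0 \<and> \<not> P v
          \<longleftrightarrow> (\<exists>x. (\<forall>(D, q)\<in>set qs. poly (q v) x = 0) \<and> poly (g v) x \<noteq> 0)" for v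
      proof (cases "?c v = 0")
        case True
        then show ?thesis using one by simp
      next
        case c: False
        have "degree (q v) = d"
        proof (rule antisym)
          show "degree (q v) \<le> d"
            using poly_families_zero[OF q] by (intro degree_le) auto
        qed (use c le_degree in blast)
        then have "(\<forall>x. poly (q v) x = 0 \<longrightarrow> poly (g v) x = 0) \<longleftrightarrow> q v dvd g v ^ d"
          using c nullstellensatz_univariate[of "q v" "g v"] by auto
        then show ?thesis using c one P(2) by auto
      qed
      ultimately show ?thesis by simp
    next
      case (two D1 q1 D1' q1' as)
      \<comment> \<open>Only the smaller degree bound can be subtracted from the larger one, so sort the two.\<close>
      obtain D q D' q' where qs: "set qs = {(D, q), (D', q')} \<union> set as"
        "sum_list (map (\<lambda>(D, q). Suc D) qs) =
           Suc D + Suc D' + sum_list (map (\<lambda>(D, q). Suc D) as)" and le: "D \<le> D'"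
      proof (cases "D1 \<le> D1'")
        case True
        then show ?thesis using that[of D1 q1 D1' q1'] two by auto
      next
        case False
        then show ?thesis using that[of D1' q1' D1 q1] two by auto
      qed
      obtain d d' where D: "D = Suc d" "D' = Suc d'"
        using False qs(1) by (metis UnCI insertCI not0_implies_Suc)
      have q: "q \<in> poly_families (Suc d)" "q' \<in> poly_families (Suc d')"
        and as: "\<forall>(D, q)\<in>set as. q \<in> poly_families D"
        using less.prems qs(1) D by auto
      let ?c = "\<lambda>v. coeff (q v) d"
      let ?q = "\<lambda>v. q v - monom (?c v) d"
      let ?r = "\<lambda>v. smult (?c v) (q' v) - monom (coeff (q' v) d') (d' - d) * q v"
      let ?P = "\<lambda>qs v. \<exists>x. (\<forall>(D, q)\<in>set qs. poly (q v) x = 0) \<and> poly (g v) x \<noteq> 0"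
      have "constructible (?P ((d, ?q) # (D', q') # as))"
        using as D qs(2) q poly_families_truncate[OF q(1)] by (intro less.hyps) auto
      moreover have "constructible (?P ((D, q) # (d', ?r) # as))"
        using as D qs(2) q poly_families_reduce[OF q] le by (intro less.hyps) auto
      moreover have "constructible (\<lambda>v. ?c v = 0)"
        by (intro constructible.zero poly_families_coeff[OF q(1)])
      ultimately have "constructible (\<lambda>v.
          ?c v = 0 \<and> ?P ((d, ?q) # (D', q') # as) v
          \<or> \<not> ?c v = 0 \<and> ?P ((D, q) # (d', ?r) # as) v)"
        by (intro constructible_disj constructible.conj constructible.neg)
      moreover have "?c v = 0 \<and> ?P ((d, ?q) # (D', q') # as) v
          \<or> \<not> ?c v = 0 \<and> ?P ((D, q) # (d', ?r) # as) v \<longleftrightarrow> ?P qs v" for v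
      proof (cases "?c v = 0")
        case True
        then show ?thesis using qs(1) by simp
      next
        case c: False
        have "poly (q v) x = 0 \<and> poly (?r v) x = 0 \<longleftrightarrow> poly (q v) x = 0 \<and> poly (q' v) x = 0"
          for x using c by auto
        then have "(\<forall>(D, q)\<in>set ((D, q) # (d', ?r) # as). poly (q v) x = 0) \<longleftrightarrow>
            (\<forall>(D, q)\<in>set qs. poly (q v) x = 0)" for x
          unfolding qs(1) by (simp del: poly_diff poly_smult poly_mult) blast
        then show ?thesis using c by (simp only: simp_thms)
      qed
      ultimately show ?thesis by simp
    qed
  qed
qed

text \<open>Truth depends only on which polynomials in \<open>A\<close> vanish. This replaces a disjunctive normal form.\<close>

definition determined_by_zeros ::
    "(('v \<Rightarrow> complex) \<Rightarrow> complex) set \<Rightarrow> (('v \<Rightarrow> complex) \<Rightarrow> bool) \<Rightarrow> bool" where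
  "determined_by_zeros A P \<longleftrightarrow> (\<forall>v w. {f\<in>A. f v = 0} = {f\<in>A. f w = 0} \<longrightarrow> P v = P w)"

lemma determined_by_zerosD:
  assumes "determined_by_zeros A P" "{f\<in>A. f v = 0} = {f\<in>A. f w = 0}"
  shows "P v = P w"
  using assms(1)[unfolded determined_by_zeros_def, THEN spec, THEN spec, THEN mp, OF assms(2)] .

lemma determined_by_zeros_mono:
  assumes "determined_by_zeros A P" "A \<subseteq> B"
  shows "determined_by_zeros B P"
  unfolding determined_by_zeros_def
proof (intro allI impI)
  fix v w assume "{f\<in>B. f v = 0} = {f\<in>B. f w = 0}"
  then have "{f\<in>A. f v = 0} = {f\<in>A. f w = 0}" using assms(2) by (auto simp: set_eq_iff)
  then show "P v = P w" by (rule determined_by_zerosD[OF assms(1)])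
qed

lemma constructible_determined_by_zeros:
  assumes "constructible P"
  shows "\<exists>A. finite A \<and> A \<subseteq> poly_funs UNIV \<and> determined_by_zeros A P"
  using assms
proof induction
  case (zero f)
  have "determined_by_zeros {f} (\<lambda>v. f v = 0)"
    unfolding determined_by_zeros_def by blast
  then show ?case using zero by blast
next
  case (neg P)
  have "determined_by_zeros A (\<lambda>v. \<not> P v)" if "determined_by_zeros A P" for A
    unfolding determined_by_zeros_def
  proof (intro allI impI)
    fix v w assume "{f\<in>A. f v = 0} = {f\<in>A. f w = 0}"
    from determined_by_zerosD[OF that this] show "(\<not> P v) = (\<not> P w)" by simp
  qed
  then show ?case using neg by blast
next
  case (conj P Q)
  then obtain A B where "finite A" "A \<subseteq> poly_funs UNIV" "determined_by_zeros A P"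
    "finite B" "B \<subseteq> poly_funs UNIV" "determined_by_zeros B Q" by blast
  moreover have "determined_by_zeros (A \<union> B) (\<lambda>v. P v \<and> Q v)"
    if AB: "determined_by_zeros A P" "determined_by_zeros B Q"
    unfolding determined_by_zeros_def
  proof (intro allI impI)
    fix v w assume *: "{f\<in>A \<union> B. f v = 0} = {f\<in>A \<union> B. f w = 0}"
    have "P v = P w"
      by (rule determined_by_zerosD[OF determined_by_zeros_mono[OF AB(1)] *]) simp
    moreover have "Q v = Q w"
      by (rule determined_by_zerosD[OF determined_by_zeros_mono[OF AB(2)] *]) simp
    ultimately show "(P v \<and> Q v) = (P w \<and> Q w)" by simp
  qed
  ultimately show ?case by (intro exI[of _ "A \<union> B"]) simp
qed

text \<open>Chevalley's theorem for the projection along one variable: by finiteness of \<open>A\<close>, only finitely many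
  patterns of vanishing make \<open>P\<close> true, and the existence of a value that realises a given pattern is a
  question about common roots.\<close>

lemma constructible_ex:
  fixes P :: "('v \<Rightarrow> complex) \<Rightarrow> bool"
  assumes "constructible P"
  shows "constructible (\<lambda>v. \<exists>x. P (v(a := x)))"
proof -
  obtain A where A: "finite A" "A \<subseteq> poly_funs UNIV" "determined_by_zeros A P"
    using constructible_determined_by_zeros[OF assms] by blast
  define rep where "rep f r \<longleftrightarrow> snd r \<in> poly_families (fst r) \<and>
    (\<forall>v x. f (v(a := x)) = poly (snd r v) x)" for f and r :: "nat \<times> (('v \<Rightarrow> complex) \<Rightarrow> complex poly)"
  have "\<exists>r. rep f r" if f: "f \<in> A" for f
  proof -
    have "f \<in> poly_funs UNIV" using f A(2) by blast
    from poly_family_of_poly_fun[OF this, of a] obtain D q where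
      "q \<in> poly_families D" "\<forall>v x. f (v(a := x)) = poly (q v) x" by (elim exE bexE)
    then have "rep f (D, q)" by (simp only: rep_def fst_conv snd_conv simp_thms)
    then show ?thesis ..
  qed
  then obtain r where r: "\<And>f. f \<in> A \<Longrightarrow> rep f (r f)" by metis
  define q where "q f = snd (r f)" for f
  define D where "D f = fst (r f)" for f
  have q: "q f \<in> poly_families (D f)" "\<And>v x. poly (q f v) x = f (v(a := x))" if "f \<in> A" for f
    using r[OF that] unfolding rep_def q_def D_def by (simp_all only: simp_thms)
  have basic: "constructible (\<lambda>v. \<exists>x. {f\<in>A. f (v(a := x)) = 0} = S)" if S: "S \<subseteq> A" for S
  proof -
    obtain fs where fs: "set fs = S" using S A(1) finite_list finite_subset by blast
    have prod: "\<exists>D. (\<lambda>v. \<Prod>f\<in>T. q f v) \<in> poly_families D" if "T \<subseteq> A" for T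
    proof -
      have "finite T" using that A(1) finite_subset by blast
      then show ?thesis using that
      proof (induction T)
        case empty
        show ?case using poly_families_const[OF poly_funs.const[of 1]] by (auto simp: one_pCons)
      next
        case (insert f T)
        then show ?case using poly_families_mult[OF q(1)[of f]] by auto
      qed
    qed
    obtain Dg where "(\<lambda>v. \<Prod>f\<in>A - S. q f v) \<in> poly_families Dg" using prod[of "A - S"] by blast
    then have "constructible (\<lambda>v. \<exists>x. (\<forall>(D, q)\<in>set (map (\<lambda>f. (D f, q f)) fs). poly (q v) x = 0)
        \<and> poly (\<Prod>f\<in>A - S. q f v) x \<noteq> 0)"
      using q(1) fs S by (intro constructible_ex_root_list) auto
    moreover have "(\<forall>(D, q)\<in>set (map (\<lambda>f. (D f, q f)) fs). poly (q v) x = 0)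
        \<and> poly (\<Prod>f\<in>A - S. q f v) x \<noteq> 0 \<longleftrightarrow> {f\<in>A. f (v(a := x)) = 0} = S" for v x
    proof -
      have "(\<forall>(D, q)\<in>set (map (\<lambda>f. (D f, q f)) fs). poly (q v) x = 0) \<longleftrightarrow>
          (\<forall>f\<in>S. f (v(a := x)) = 0)"
      proof -
        have "(\<forall>(D, q)\<in>set (map (\<lambda>f. (D f, q f)) fs). poly (q v) x = 0) \<longleftrightarrow>
            (\<forall>f\<in>S. poly (q f v) x = 0)" using fs by simp
        also have "\<dots> \<longleftrightarrow> (\<forall>f\<in>S. f (v(a := x)) = 0)"
          using S by (intro ball_cong refl) (simp add: q(2) subset_iff)
        finally show ?thesis .
      qed
      moreover have "poly (\<Prod>f\<in>A - S. q f v) x \<noteq> 0 \<longleftrightarrow> (\<forall>f\<in>A - S. f (v(a := x)) \<noteq> 0)"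
      proof -
        have "poly (\<Prod>f\<in>A - S. q f v) x \<noteq> 0 \<longleftrightarrow> (\<forall>f\<in>A - S. poly (q f v) x \<noteq> 0)"
          using A(1) by (simp add: poly_prod)
        also have "\<dots> \<longleftrightarrow> (\<forall>f\<in>A - S. f (v(a := x)) \<noteq> 0)"
          by (intro ball_cong refl) (simp add: q(2))
        finally show ?thesis .
      qed
      ultimately show ?thesis using S by blast
    qed
    ultimately show ?thesis by simp
  qed
  define \<S> where "\<S> = {S. S \<subseteq> A \<and> (\<exists>u. P u \<and> {f\<in>A. f u = 0} = S)}"
  have "(\<exists>x. P (v(a := x))) \<longleftrightarrow> (\<exists>S\<in>\<S>. \<exists>x. {f\<in>A. f (v(a := x)) = 0} = S)" for v
  proof
    assume "\<exists>x. P (v(a := x))"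
    then obtain x where "P (v(a := x))" ..
    then have "{f\<in>A. f (v(a := x)) = 0} \<in> \<S>" unfolding \<S>_def by blast
    then show "\<exists>S\<in>\<S>. \<exists>x. {f\<in>A. f (v(a := x)) = 0} = S" by blast
  next
    assume "\<exists>S\<in>\<S>. \<exists>x. {f\<in>A. f (v(a := x)) = 0} = S"
    then obtain x u where "P u" "{f\<in>A. f u = 0} = {f\<in>A. f (v(a := x)) = 0}"
      unfolding \<S>_def by blast
    then show "\<exists>x. P (v(a := x))" using determined_by_zerosD[OF A(3)] by blast
  qed
  moreover have "constructible (\<lambda>v. \<exists>S\<in>\<S>. \<exists>x. {f\<in>A. f (v(a := x)) = 0} = S)"
  proof (rule constructible_bex)
    have "\<S> \<subseteq> Pow A" unfolding \<S>_def by blast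
    then show "finite \<S>" using A(1) by (simp add: finite_subset)
    show "constructible (\<lambda>v. \<exists>x. {f\<in>A. f (v(a := x)) = 0} = S)" if "S \<in> \<S>" for S
      using basic that unfolding \<S>_def by blast
  qed
  ultimately show ?thesis by (simp only:)
qed

lemma constructible_ex_finite:
  assumes "finite A" "constructible P"
  shows "constructible (\<lambda>v. \<exists>w. (\<forall>a. a \<notin> A \<longrightarrow> w a = v a) \<and> P w)"
  using assms
proof (induction A)
  case empty
  have "(\<exists>w. (\<forall>a. a \<notin> {} \<longrightarrow> w a = v a) \<and> P w) = P v" for v
    by (metis empty_iff ext)
  then show ?case using empty by simp
next
  case (insert a A)
  have "(\<exists>w. (\<forall>b. b \<notin> insert a A \<longrightarrow> w b = v b) \<and> P w) \<longleftrightarrow>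
      (\<exists>x. \<exists>w. (\<forall>b. b \<notin> A \<longrightarrow> w b = (v(a := x)) b) \<and> P w)" (is "?L \<longleftrightarrow> ?R") for v
  proof
    assume ?L
    then obtain w where w: "\<forall>b. b \<notin> insert a A \<longrightarrow> w b = v b" "P w" by blast
    then show ?R by (intro exI[of _ "w a"] exI[of _ w]) auto
  next
    assume ?R
    then obtain x w where "\<forall>b. b \<notin> A \<longrightarrow> w b = (v(a := x)) b" "P w" by blast
    then show ?L by (intro exI[of _ w]) (metis fun_upd_other insertCI)
  qed
  then show ?case
    using constructible_ex[OF insert.IH[OF insert.prems], of a] by simp
qed

section \<open>Algebraic dependence and finite generic fibres\<close>

text \<open>Gaussian elimination: more unknowns than equations leave a non-zero solution.\<close>

lemma homogeneous_system_nontrivial_solution: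
  fixes M :: "'a \<Rightarrow> 'b \<Rightarrow> 'f::field"
  assumes "finite B" "finite A" "card B < card A"
  shows "\<exists>c. (\<exists>a\<in>A. c a \<noteq> 0) \<and> (\<forall>b\<in>B. (\<Sum>a\<in>A. c a * M a b) = 0)"
  using assms
proof (induction B arbitrary: A M)
  case empty
  then have "A \<noteq> {}" by auto
  then show ?case by (intro exI[of _ "\<lambda>_. 1"]) auto
next
  case (insert b B)
  show ?case
  proof (cases "\<forall>a\<in>A. M a b = 0")
    case True
    obtain c where "\<exists>a\<in>A. c a \<noteq> 0" "\<forall>b\<in>B. (\<Sum>a\<in>A. c a * M a b) = 0"
      using insert.IH[of A M] insert.prems insert.hyps by auto
    then show ?thesis using True by (intro exI[of _ c]) auto
  next
    case False
    then obtain a0 where a0: "a0 \<in> A" "M a0 b \<noteq> 0" by blast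
    define M' where "M' a b' = M a b' - M a b / M a0 b * M a0 b'" for a b'
    have "card B < card (A - {a0})" using insert a0 by simp
    then obtain c where c: "\<exists>a\<in>A - {a0}. c a \<noteq> 0"
      "\<And>b'. b' \<in> B \<Longrightarrow> (\<Sum>a\<in>A - {a0}. c a * M' a b') = 0"
      using insert.IH[of "A - {a0}" M'] insert.prems by auto
    define c' where "c' = c(a0 := - (\<Sum>a\<in>A - {a0}. c a * (M a b / M a0 b)))"
    have sum: "(\<Sum>a\<in>A. c' a * M a b') = (\<Sum>a\<in>A - {a0}. c a * M' a b')" for b'
    proof -
      have "(\<Sum>a\<in>A. c' a * M a b') = c' a0 * M a0 b' + (\<Sum>a\<in>A - {a0}. c' a * M a b')"
        using insert.prems(1) a0(1) by (rule sum.remove)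
      also have "(\<Sum>a\<in>A - {a0}. c' a * M a b') = (\<Sum>a\<in>A - {a0}. c a * M a b')"
        by (intro sum.cong) (auto simp: c'_def)
      finally show ?thesis
        by (simp add: c'_def M'_def sum_distrib_right sum_subtractf right_diff_distrib mult.assoc)
    qed
    have "(\<Sum>a\<in>A - {a0}. c a * M' a b) = 0" using a0(2) by (simp add: M'_def)
    then have "\<forall>b'\<in>insert b B. (\<Sum>a\<in>A. c' a * M a b') = 0" using c(2) by (simp add: sum)
    moreover have "\<exists>a\<in>A. c' a \<noteq> 0" using c(1) by (auto simp: c'_def)
    ultimately show ?thesis by blast
  qed
qed

definition monomial :: "'v set \<Rightarrow> ('v \<Rightarrow> nat) \<Rightarrow> ('v \<Rightarrow> complex) \<Rightarrow> complex" where
  "monomial I m v = (\<Prod>i\<in>I. v i ^ m i)"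

text \<open>Polynomials of degree at most \<open>D\<close> in each variable. Lists of terms, which may repeat exponents, make
  products easy to form; coefficients indexed by exponents are extracted only at the end.\<close>

definition monomial_span :: "'v set \<Rightarrow> nat \<Rightarrow> (('v \<Rightarrow> complex) \<Rightarrow> complex) set" where
  "monomial_span I D = {f. \<exists>xs. (\<forall>(c, m)\<in>set xs. \<forall>i\<in>I. m i \<le> D) \<and>
     (\<forall>v. f v = (\<Sum>(c, m)\<leftarrow>xs. c * monomial I m v))}"

lemma monomial_spanI:
  assumes "\<And>c m i. (c, m) \<in> set xs \<Longrightarrow> i \<in> I \<Longrightarrow> m i \<le> D"
    and "\<And>v. f v = (\<Sum>(c, m)\<leftarrow>xs. c * monomial I m v)"
  shows "f \<in> monomial_span I D"
  using assms unfolding monomial_span_def by blast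

lemma monomial_spanE:
  assumes "f \<in> monomial_span I D"
  obtains xs where "\<forall>c m i. (c, m) \<in> set xs \<longrightarrow> i \<in> I \<longrightarrow> m i \<le> D"
    and "f = (\<lambda>v. \<Sum>(c, m)\<leftarrow>xs. c * monomial I m v)"
  using assms unfolding monomial_span_def by fast

lemma monomial_span_mono: "f \<in> monomial_span I D \<Longrightarrow> D \<le> D' \<Longrightarrow> f \<in> monomial_span I D'"
  by (elim monomial_spanE, rule monomial_spanI) (auto intro: order_trans)

lemma monomial_span_const: "(\<lambda>v. c) \<in> monomial_span I 0"
  by (rule monomial_spanI[of "[(c, \<lambda>_. 0)]"]) (auto simp: monomial_def)

lemma monomial_span_var:
  assumes "finite I" "i \<in> I"
  shows "(\<lambda>v. v i) \<in> monomial_span I 1"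
proof -
  have "(\<Prod>j\<in>I. v j ^ of_bool (j = i)) = v i" for v :: "'a \<Rightarrow> complex"
    using assms by (subst prod.remove[of I i]) (auto intro!: prod.neutral)
  then show ?thesis
    by (intro monomial_spanI[of "[(1, \<lambda>j. of_bool (j = i))]"]) (auto simp: monomial_def)
qed

lemma monomial_span_add:
  assumes "f \<in> monomial_span I D" "g \<in> monomial_span I D"
  shows "(\<lambda>v. f v + g v) \<in> monomial_span I D"
proof -
  obtain xs where xs: "\<forall>c m i. (c, m) \<in> set xs \<longrightarrow> i \<in> I \<longrightarrow> m i \<le> D"
    "f = (\<lambda>v. \<Sum>(c, m)\<leftarrow>xs. c * monomial I m v)" using assms(1) by (rule monomial_spanE)
  obtain ys where ys: "\<forall>c m i. (c, m) \<in> set ys \<longrightarrow> i \<in> I \<longrightarrow> m i \<le> D"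
    "g = (\<lambda>v. \<Sum>(c, m)\<leftarrow>ys. c * monomial I m v)" using assms(2) by (rule monomial_spanE)
  show ?thesis using xs(1) ys(1) by (intro monomial_spanI[of "xs @ ys"]) (auto simp: xs ys)
qed

lemma monomial_span_mult:
  assumes "f \<in> monomial_span I D" "g \<in> monomial_span I D'"
  shows "(\<lambda>v. f v * g v) \<in> monomial_span I (D + D')"
proof -
  obtain xs where xs: "\<forall>c m i. (c, m) \<in> set xs \<longrightarrow> i \<in> I \<longrightarrow> m i \<le> D"
    "f = (\<lambda>v. \<Sum>(c, m)\<leftarrow>xs. c * monomial I m v)" using assms(1) by (rule monomial_spanE)
  obtain ys where ys: "\<forall>c m i. (c, m) \<in> set ys \<longrightarrow> i \<in> I \<longrightarrow> m i \<le> D'"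
    "g = (\<lambda>v. \<Sum>(c, m)\<leftarrow>ys. c * monomial I m v)" using assms(2) by (rule monomial_spanE)
  have single: "(\<lambda>v. (a * monomial I k v) * g v) \<in> monomial_span I (D + D')"
    if "\<forall>i\<in>I. k i \<le> D" for a k
  proof (rule monomial_spanI)
    fix c m i assume "(c, m) \<in> set (map (\<lambda>(c, m). (a * c, \<lambda>i. k i + m i)) ys)" "i \<in> I"
    then show "m i \<le> D + D'" using that ys(1) by (auto intro: add_mono)
  next
    fix v
    show "(a * monomial I k v) * g v = (\<Sum>(c, m)\<leftarrow>map (\<lambda>(c, m). (a * c, \<lambda>i. k i + m i)) ys.
        c * monomial I m v)"
      unfolding ys(2)
      by (induction ys)
        (auto simp: monomial_def power_add prod.distrib algebra_simps)
  qed
  have "(\<lambda>v. (\<Sum>(c, m)\<leftarrow>xs'. c * monomial I m v) * g v) \<in> monomial_span I (D + D')"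
    if "set xs' \<subseteq> set xs" for xs'
    using that
  proof (induction xs')
    case Nil
    then show ?case using monomial_span_mono[OF monomial_span_const[of 0]] by simp
  next
    case (Cons x xs')
    obtain c m where x: "x = (c, m)" by (cases x)
    have "\<forall>i\<in>I. m i \<le> D" using xs(1) Cons.prems x by auto
    then show ?case using monomial_span_add[OF single Cons.IH] Cons.prems
      by (simp add: x distrib_right)
  qed
  from this[of xs] show ?thesis by (simp add: xs(2))
qed

lemma monomial_span_power:
  "f \<in> monomial_span I D \<Longrightarrow> (\<lambda>v. f v ^ k) \<in> monomial_span I (k * D)"
proof (induction k)
  case 0
  then show ?case using monomial_span_const[of 1] by simp
next
  case (Suc k)
  then show ?case using monomial_span_mult[of f I D] by simp
qed

lemma monomial_span_prod:
  assumes "finite J" "\<And>j. j \<in> J \<Longrightarrow> f j \<in> monomial_span I D"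
  shows "(\<lambda>v. \<Prod>j\<in>J. f j v) \<in> monomial_span I (card J * D)"
  using assms
proof (induction J)
  case empty
  then show ?case using monomial_span_const[of 1] by simp
next
  case (insert j J)
  then show ?case using monomial_span_mult[of "f j" I D] by simp
qed

lemma poly_funs_in_monomial_span:
  assumes "finite I" "f \<in> poly_funs I"
  shows "\<exists>D. f \<in> monomial_span I D"
  using assms(2)
proof induction
  case (const c)
  show ?case using monomial_span_const by blast
next
  case (var i)
  then show ?case using monomial_span_var[OF assms(1)] by blast
next
  case (add f g)
  then obtain D D' where "f \<in> monomial_span I D" "g \<in> monomial_span I D'" by blast
  then have "f \<in> monomial_span I (max D D')" "g \<in> monomial_span I (max D D')"
    by (auto elim: monomial_span_mono)
  then show ?case using monomial_span_add by blast
next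
  case (mult f g)
  then show ?case using monomial_span_mult by blast
qed

lemma monomial_span_coefficients:
  assumes "finite I" "f \<in> monomial_span I D"
  shows "\<exists>c. \<forall>v. f v = (\<Sum>m\<in>I \<rightarrow>\<^sub>E {..D}. c m * monomial I m v)"
proof -
  obtain xs where xs: "\<forall>c m i. (c, m) \<in> set xs \<longrightarrow> i \<in> I \<longrightarrow> m i \<le> D"
    "f = (\<lambda>v. \<Sum>(c, m)\<leftarrow>xs. c * monomial I m v)" using assms(2) by (rule monomial_spanE)
  have fin: "finite (I \<rightarrow>\<^sub>E {..D})" using assms(1) by (intro finite_PiE) auto
  have "\<exists>c. \<forall>v. (\<Sum>(c, m)\<leftarrow>xs. c * monomial I m v) = (\<Sum>m\<in>I \<rightarrow>\<^sub>E {..D}. c m * monomial I m v)"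
    using xs(1)
  proof (induction xs)
    case Nil
    show ?case by (intro exI[of _ "\<lambda>_. 0"]) simp
  next
    case (Cons x xs)
    obtain a k where x: "x = (a, k)" by (cases x)
    obtain c where c: "\<forall>v. (\<Sum>(c, m)\<leftarrow>xs. c * monomial I m v) =
        (\<Sum>m\<in>I \<rightarrow>\<^sub>E {..D}. c m * monomial I m v)" using Cons.IH Cons.prems by auto
    let ?k = "restrict k I"
    have k: "?k \<in> I \<rightarrow>\<^sub>E {..D}" using Cons.prems x by auto
    have mono: "monomial I ?k v = monomial I k v" for v
      unfolding monomial_def by (intro prod.cong) auto
    have "(\<Sum>(c, m)\<leftarrow>x # xs. c * monomial I m v) =
        (\<Sum>m\<in>I \<rightarrow>\<^sub>E {..D}. (c m + (if m = ?k then a else 0)) * monomial I m v)" for v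
    proof -
      have "(\<Sum>m\<in>I \<rightarrow>\<^sub>E {..D}. (c m + (if m = ?k then a else 0)) * monomial I m v) =
          (\<Sum>m\<in>I \<rightarrow>\<^sub>E {..D}. c m * monomial I m v) +
          (\<Sum>m\<in>I \<rightarrow>\<^sub>E {..D}. if m = ?k then a * monomial I m v else 0)"
        by (subst sum.distrib[symmetric], intro sum.cong) (auto simp: distrib_right)
      also have "\<dots> = (\<Sum>m\<in>I \<rightarrow>\<^sub>E {..D}. c m * monomial I m v) + a * monomial I ?k v"
        using fin k by (simp add: sum.delta)
      finally show ?thesis using c by (simp add: x mono)
    qed
    then show ?case by (intro exI allI)
  qed
  then show ?thesis by (simp add: xs(2))
qed

text \<open>More polynomials than variables are algebraically dependent. The number of monomials of degree at
  most \<open>N\<close> in the \<open>h j\<close> grows like the power \<open>card J\<close> of \<open>N\<close>, while these monomials lie in a space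
  whose dimension grows only like the power \<open>card I\<close> of \<open>N\<close>.\<close>

theorem algebraic_dependence:
  assumes "finite I" "finite J" "card I < card J" and h: "\<And>j. j \<in> J \<Longrightarrow> h j \<in> poly_funs I"
  shows "\<exists>N c. (\<exists>a\<in>J \<rightarrow>\<^sub>E {..N}. c a \<noteq> 0) \<and>
           (\<forall>v. (\<Sum>a\<in>J \<rightarrow>\<^sub>E {..N}. c a * monomial J a (\<lambda>j. h j v)) = 0)"
proof -
  have "\<forall>j\<in>J. \<exists>D. h j \<in> monomial_span I D"
    using poly_funs_in_monomial_span[OF assms(1)] h by blast
  then obtain D' where D': "\<And>j. j \<in> J \<Longrightarrow> h j \<in> monomial_span I (D' j)" by metis
  define D where "D = Max (D' ` J)"
  have D: "h j \<in> monomial_span I D" if "j \<in> J" for j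
    using D'[OF that] by (rule monomial_span_mono) (simp add: D_def assms(2) that)
  \<comment> \<open>With this \<open>N\<close> the dimension below is at most \<open>N * (N + 1) ^ card I\<close>, which is less than the number
    \<open>(N + 1) ^ card J\<close> of monomials.\<close>
  define N where "N = (card J * D + 1) ^ card I"
  let ?K = "card J * (N * D)"
  let ?A = "J \<rightarrow>\<^sub>E {..N}" and ?B = "I \<rightarrow>\<^sub>E {..?K}"
  have fin: "finite ?A" "finite ?B" using assms by (auto intro: finite_PiE)
  have "(\<lambda>v. monomial J a (\<lambda>j. h j v)) \<in> monomial_span I ?K" if a: "a \<in> ?A" for a
    unfolding monomial_def
  proof (rule monomial_span_prod[OF assms(2)])
    fix j assume j: "j \<in> J"
    have "a j \<le> N" using a j by (auto simp: PiE_iff)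
    then show "(\<lambda>v. h j v ^ a j) \<in> monomial_span I (N * D)"
      by (intro monomial_span_mono[OF monomial_span_power[OF D[OF j]]]) simp
  qed
  then have "\<forall>a\<in>?A. \<exists>M. \<forall>v. monomial J a (\<lambda>j. h j v) = (\<Sum>b\<in>?B. M b * monomial I b v)"
    using monomial_span_coefficients[OF assms(1)] by blast
  then obtain M where M: "\<And>a v. a \<in> ?A \<Longrightarrow>
      monomial J a (\<lambda>j. h j v) = (\<Sum>b\<in>?B. M a b * monomial I b v)"
    by (auto simp: bchoice_iff)
  have "card ?B < card ?A"
  proof -
    have "card ?B = (?K + 1) ^ card I" using assms(1) by (simp add: card_PiE)
    also have "\<dots> \<le> ((card J * D + 1) * (N + 1)) ^ card I"
      by (intro power_mono) (simp_all add: algebra_simps)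
    also have "\<dots> = N * (N + 1) ^ card I" by (simp only: N_def power_mult_distrib)
    also have "\<dots> < (N + 1) * (N + 1) ^ card I" by simp
    also have "\<dots> = (N + 1) ^ Suc (card I)" by simp
    also have "\<dots> \<le> (N + 1) ^ card J" using assms(3) by (intro power_increasing) auto
    also have "\<dots> = card ?A" using assms(2) by (simp add: card_PiE)
    finally show ?thesis .
  qed
  then obtain c where c: "\<exists>a\<in>?A. c a \<noteq> 0" "\<And>b. b \<in> ?B \<Longrightarrow> (\<Sum>a\<in>?A. c a * M a b) = 0"
    using homogeneous_system_nontrivial_solution[OF fin(2,1), of M] by blast
  have "(\<Sum>a\<in>?A. c a * monomial J a (\<lambda>j. h j v)) = 0" for v
  proof -
    have "(\<Sum>a\<in>?A. c a * monomial J a (\<lambda>j. h j v)) =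
        (\<Sum>a\<in>?A. \<Sum>b\<in>?B. (c a * M a b) * monomial I b v)"
      by (intro sum.cong) (auto simp: M sum_distrib_left mult.assoc)
    also have "\<dots> = (\<Sum>b\<in>?B. (\<Sum>a\<in>?A. c a * M a b) * monomial I b v)"
      by (subst sum.swap) (simp add: sum_distrib_right)
    also have "\<dots> = 0" using c(2) by (simp add: sum.neutral)
    finally show ?thesis .
  qed
  then show ?thesis using c(1) by blast
qed

text \<open>A polynomial with a non-zero coefficient is a non-zero function over an infinite field.\<close>

lemma monomials_independent:
  assumes "finite J" "\<exists>a\<in>J \<rightarrow>\<^sub>E {..N}. c a \<noteq> (0::complex)"
  shows "\<exists>w. (\<Sum>a\<in>J \<rightarrow>\<^sub>E {..N}. c a * monomial J a w) \<noteq> 0"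
  using assms
proof (induction J arbitrary: c)
  case empty
  then show ?case by (simp add: monomial_def)
next
  case (insert j J)
  let ?A = "J \<rightarrow>\<^sub>E {..N}"
  have ins: "insert j J \<rightarrow>\<^sub>E {..N} = (\<lambda>(k, a). a(j := k)) ` ({..N} \<times> ?A)"
    by (rule PiE_insert_eq)
  have inj: "inj_on (\<lambda>(k, a). a(j := k)) ({..N} \<times> ?A)"
    using insert.hyps(2) by (rule inj_combinator)
  obtain k a where ka: "k \<le> N" "a \<in> ?A" "c (a(j := k)) \<noteq> 0"
    using insert.prems unfolding ins by auto
  then obtain w where w: "(\<Sum>a\<in>?A. c (a(j := k)) * monomial J a w) \<noteq> 0"
    using insert.IH[of "\<lambda>a. c (a(j := k))"] by blast
  define p where "p = (\<Sum>k\<le>N. monom (\<Sum>a\<in>?A. c (a(j := k)) * monomial J a w) k)"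
  have "coeff p k \<noteq> 0" using w ka(1) by (simp add: p_def coeff_sum)
  then have "p \<noteq> 0" by auto
  then obtain t where t: "poly p t \<noteq> 0" using poly_all_0_iff_0 by blast
  have mono: "monomial (insert j J) (a(j := k)) (w(j := t)) = t ^ k * monomial J a w" for a k
  proof -
    have "(\<Prod>i\<in>J. (w(j := t)) i ^ (a(j := k)) i) = monomial J a w"
      unfolding monomial_def using insert.hyps(2) by (intro prod.cong) auto
    then show ?thesis using insert.hyps by (simp add: monomial_def)
  qed
  have "(\<Sum>a\<in>insert j J \<rightarrow>\<^sub>E {..N}. c a * monomial (insert j J) a (w(j := t))) =
      (\<Sum>(k, a)\<in>{..N} \<times> ?A. c (a(j := k)) * (t ^ k * monomial J a w))"
    unfolding ins sum.reindex[OF inj] by (intro sum.cong) (auto simp: mono simp del: fun_upd_apply)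
  also have "\<dots> = (\<Sum>k\<le>N. \<Sum>a\<in>?A. c (a(j := k)) * (t ^ k * monomial J a w))"
    using insert.hyps(1) by (simp add: sum.cartesian_product)
  also have "\<dots> = poly p t"
    by (simp add: p_def poly_sum poly_monom sum_distrib_left sum_distrib_right mult_ac)
  finally show ?case using t by metis
qed

lemma poly_funs_prod_nonzero:
  assumes "finite A" "\<And>a. a \<in> A \<Longrightarrow> f a \<in> poly_funs I" "\<And>a. a \<in> A \<Longrightarrow> \<exists>v. f a v \<noteq> 0"
  shows "\<exists>v. (\<Prod>a\<in>A. f a v) \<noteq> 0"
  using assms
proof (induction A)
  case empty
  show ?case by simp
next
  case (insert a A)
  have "\<exists>v. f a v \<noteq> 0" "\<exists>w. (\<Prod>a\<in>A. f a w) \<noteq> 0" using insert by simp_all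
  then obtain v w where "f a v \<noteq> 0" "(\<Prod>a\<in>A. f a w) \<noteq> 0" by blast
  moreover have "line_closed (UNIV :: ('a \<Rightarrow> complex) set)" by (simp add: line_closed_def)
  ultimately show ?case
    using poly_funs_common_nonzero[of "f a" I "\<lambda>v. \<Prod>a\<in>A. f a v" I UNIV v w] insert
      poly_funs_prod[of A f I] by (auto simp: line_closed_def)
qed

text \<open>An algebraic relation between \<open>g\<close> and the \<open>h j\<close> becomes, once the values \<open>l\<close> of the \<open>h j\<close> are fixed, a
  univariate equation for the value of \<open>g\<close>. The polynomial \<open>G\<close> is the relation with the argument for
  \<open>g\<close> frozen at a suitable number, so that the equation is non-trivial wherever \<open>G\<close> does not vanish.\<close>

lemma generically_finitely_many_values:
  fixes h :: "'j \<Rightarrow> ('v \<Rightarrow> complex) \<Rightarrow> complex"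
  assumes "finite I" "finite J" "card I \<le> card J"
    and h: "\<And>j. j \<in> J \<Longrightarrow> h j \<in> poly_funs I" and g: "g \<in> poly_funs I"
  shows "\<exists>G\<in>poly_funs J. \<exists>N. (\<exists>l. G l \<noteq> 0) \<and>
    (\<forall>l. G l \<noteq> 0 \<longrightarrow> finite {g v | v. \<forall>j\<in>J. h j v = l j} \<and> card {g v | v. \<forall>j\<in>J. h j v = l j} \<le> N)"
proof -
  \<comment> \<open>\<open>None\<close> is the index of \<open>g\<close>.\<close>
  define J' where "J' = insert None (Some ` J)"
  define h' where "h' = case_option g h"
  have J': "finite J'" "card I < card J'"
    using assms by (auto simp: J'_def card_image)
  have "h' j \<in> poly_funs I" if "j \<in> J'" for j
    using that h g by (auto simp: J'_def h'_def)
  from algebraic_dependence[where h = h', OF assms(1) J' this] obtain N where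
    "\<exists>c. (\<exists>a\<in>J' \<rightarrow>\<^sub>E {..N}. c a \<noteq> 0) \<and>
      (\<forall>v. (\<Sum>a\<in>J' \<rightarrow>\<^sub>E {..N}. c a * monomial J' a (\<lambda>j. h' j v)) = 0)" ..
  then obtain c where
    c: "(\<exists>a\<in>J' \<rightarrow>\<^sub>E {..N}. c a \<noteq> 0) \<and>
      (\<forall>v. (\<Sum>a\<in>J' \<rightarrow>\<^sub>E {..N}. c a * monomial J' a (\<lambda>j. h' j v)) = 0)" ..
  let ?A = "J' \<rightarrow>\<^sub>E {..N}"
  define Q where "Q l t = (\<Sum>a\<in>?A. c a * (t ^ a None * (\<Prod>j\<in>J. l j ^ a (Some j))))"
    for l :: "'j \<Rightarrow> complex" and t
  have mono: "monomial J' a w = w None ^ a None * (\<Prod>j\<in>J. w (Some j) ^ a (Some j))" for a w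
    using assms(2) by (simp add: monomial_def J'_def prod.reindex)
  obtain w where w: "(\<Sum>a\<in>?A. c a * monomial J' a w) \<noteq> 0"
    using monomials_independent[OF J'(1) conjunct1[OF c]] ..
  define G where "G l = Q l (w None)" for l
  have "G \<in> poly_funs J"
    unfolding G_def Q_def by (intro poly_funs_intros)
  moreover have "G (\<lambda>j. w (Some j)) \<noteq> 0" using w by (simp add: G_def Q_def mono)
  moreover have "finite {g v | v. \<forall>j\<in>J. h j v = l j} \<and> card {g v | v. \<forall>j\<in>J. h j v = l j} \<le> N"
    if Gl: "G l \<noteq> 0" for l
  proof -
    define p where "p = (\<Sum>a\<in>?A. monom (c a * (\<Prod>j\<in>J. l j ^ a (Some j))) (a None))"
    have p: "poly p t = Q l t" for t
      by (simp add: p_def Q_def poly_sum poly_monom algebra_simps)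
    then have "p \<noteq> 0" using Gl by (auto simp: G_def)
    have "degree p \<le> N"
      unfolding p_def
    proof (rule degree_sum_le)
      show "finite ?A" using J'(1) by (intro finite_PiE) auto
      fix a assume "a \<in> ?A"
      then have "a None \<le> N" by (auto simp: PiE_iff J'_def)
      then show "degree (monom (c a * (\<Prod>j\<in>J. l j ^ a (Some j))) (a None)) \<le> N"
        using degree_monom_le order_trans by blast
    qed
    then have roots: "finite {t. poly p t = 0}" "card {t. poly p t = 0} \<le> N"
      using poly_roots_finite[OF \<open>p \<noteq> 0\<close>] card_poly_roots_bound[OF \<open>p \<noteq> 0\<close>] by auto
    have "poly p (g v) = 0" if "\<forall>j\<in>J. h j v = l j" for v
    proof -
      have "poly p (g v) = (\<Sum>a\<in>?A. c a * monomial J' a (\<lambda>j. h' j v))"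
        unfolding p Q_def mono using that by (simp add: h'_def)
      then show ?thesis using conjunct2[OF c] by (simp only:)
    qed
    then have "{g v | v. \<forall>j\<in>J. h j v = l j} \<subseteq> {t. poly p t = 0}" by blast
    then show ?thesis using roots by (meson card_mono finite_subset le_trans)
  qed
  ultimately show ?thesis by blast
qed

text \<open>A polynomial map to a space of at least the same dimension has fibres of bounded size outside a
  hypersurface of the target: apply the previous lemma to every coordinate function.\<close>

theorem generically_finite_fibres:
  fixes h :: "'j \<Rightarrow> ('v \<Rightarrow> complex) \<Rightarrow> complex"
  assumes "finite I" "finite J" "card I \<le> card J"
    and h: "\<And>j. j \<in> J \<Longrightarrow> h j \<in> poly_funs I"
  shows "\<exists>G\<in>poly_funs J. \<exists>N. (\<exists>l. G l \<noteq> 0) \<and>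
    (\<forall>l. G l \<noteq> 0 \<longrightarrow> finite {restrict v I | v. \<forall>j\<in>J. h j v = l j} \<and>
       card {restrict v I | v. \<forall>j\<in>J. h j v = l j} \<le> N)"
proof -
  let ?V = "\<lambda>i l. {v i | v. \<forall>j\<in>J. h j v = l j}"
  define good where "good i G N \<longleftrightarrow> G \<in> poly_funs J \<and> (\<exists>l. G l \<noteq> 0) \<and>
      (\<forall>l. G l \<noteq> 0 \<longrightarrow> finite (?V i l) \<and> card (?V i l) \<le> N)" for i G and N :: nat
  have "\<exists>G N. good i G N" if "i \<in> I" for i
  proof -
    from generically_finitely_many_values[where h = h and g = "\<lambda>v. v i",
        OF assms poly_funs.var[OF that]]
    obtain G where G: "G \<in> poly_funs J" and "\<exists>N. (\<exists>l. G l \<noteq> 0) \<and>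
      (\<forall>l. G l \<noteq> 0 \<longrightarrow> finite (?V i l) \<and> card (?V i l) \<le> N)" by (rule bexE)
    then obtain N where "(\<exists>l. G l \<noteq> 0) \<and>
      (\<forall>l. G l \<noteq> 0 \<longrightarrow> finite (?V i l) \<and> card (?V i l) \<le> N)" by (elim exE)
    with G have "good i G N" unfolding good_def by (rule conjI)
    then show ?thesis by (intro exI)
  qed
  then obtain G N where GN: "\<And>i. i \<in> I \<Longrightarrow> good i (G i) (N i)" by metis
  have PF: "(\<lambda>l. \<Prod>i\<in>I. G i l) \<in> poly_funs J"
    using GN by (intro poly_funs_prod) (auto simp: good_def)
  have nz: "\<exists>l. (\<Prod>i\<in>I. G i l) \<noteq> 0"
    using GN by (intro poly_funs_prod_nonzero[OF assms(1), of G J]) (auto simp: good_def)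
  have bound: "\<forall>l. (\<Prod>i\<in>I. G i l) \<noteq> 0 \<longrightarrow> finite {restrict v I | v. \<forall>j\<in>J. h j v = l j} \<and>
       card {restrict v I | v. \<forall>j\<in>J. h j v = l j} \<le> (\<Prod>i\<in>I. N i)"
  proof (intro allI impI)
    fix l assume l: "(\<Prod>i\<in>I. G i l) \<noteq> 0"
    have V: "finite (?V i l)" "card (?V i l) \<le> N i" if "i \<in> I" for i
      using GN[OF that] l that assms(1) by (auto simp: good_def)
    have sub: "{restrict v I | v. \<forall>j\<in>J. h j v = l j} \<subseteq> Pi\<^sub>E I (\<lambda>i. ?V i l)" by auto
    have fin: "finite (Pi\<^sub>E I (\<lambda>i. ?V i l))" using assms(1) V(1) by (intro finite_PiE)
    have "card (Pi\<^sub>E I (\<lambda>i. ?V i l)) = (\<Prod>i\<in>I. card (?V i l))" using assms(1) by (rule card_PiE)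
    also have "\<dots> \<le> (\<Prod>i\<in>I. N i)" using V(2) by (intro prod_mono) auto
    finally show "finite {restrict v I | v. \<forall>j\<in>J. h j v = l j} \<and>
       card {restrict v I | v. \<forall>j\<in>J. h j v = l j} \<le> (\<Prod>i\<in>I. N i)"
      using sub fin by (meson card_mono finite_subset le_trans)
  qed
  show ?thesis
    by (rule bexI[where x = "\<lambda>l. \<Prod>i\<in>I. G i l"], rule exI[where x = "\<Prod>i\<in>I. N i"],
        rule conjI[OF nz bound], rule PF)
qed

section \<open>Systems that are triangular up to small terms\<close>

lemma norm_inverse_one_plus_bound:
  fixes x :: complex
  assumes "norm (x - 1) \<le> t" "t \<le> 1/2"
  shows "norm (inverse x - 1) \<le> 2 * t"
proof -
  have "1 \<le> norm x + norm (x - 1)"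
    using norm_triangle_ineq[of x "1 - x"] by (simp add: norm_minus_commute)
  then have x: "norm x \<ge> 1/2" using assms by simp
  then have "x \<noteq> 0" by auto
  then have "inverse x - 1 = - (x - 1) / x" by (simp add: field_simps)
  then have "norm (inverse x - 1) = norm (x - 1) / norm x" by (simp add: norm_divide norm_minus_commute)
  also have "\<dots> \<le> t / (1/2)"
    using x assms norm_ge_zero[of "x-1"] by (intro frac_le) linarith+
  finally show ?thesis by simp
qed

lemma norm_inverse_diff_bound:
  fixes x y :: complex
  assumes "norm (x - 1) \<le> 1/8" "norm (y - 1) \<le> 1/8"
  shows "norm (inverse x - inverse y) \<le> 4/3 * norm (x - y)"
proof -
  have "norm z \<ge> 7/8" if "norm (z - 1) \<le> 1/8" for z :: complex
    using norm_triangle_ineq[of z "1 - z"] that by (simp add: norm_minus_commute)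
  then have xy: "norm x \<ge> 7/8" "norm y \<ge> 7/8" using assms by auto
  then have "x \<noteq> 0" "y \<noteq> 0" by auto
  then have "inverse x - inverse y = (y - x) / (x * y)" by (simp add: field_simps)
  then have "norm (inverse x - inverse y) = norm (x - y) / (norm x * norm y)"
    by (simp add: divide_simps norm_minus_commute norm_divide norm_mult)
  also have "\<dots> \<le> norm (x - y) / (7/8 * (7/8))"
    using xy \<open>x \<noteq> 0\<close> \<open>y \<noteq> 0\<close> by (intro divide_left_mono mult_mono) (auto intro!: mult_pos_pos)
  also have "\<dots> \<le> 4/3 * norm (x - y)" by simp
  finally show ?thesis .
qed

text \<open>With \<open>a = 0\<close> the system is solved by \<open>w = 1\<close>. In general, rewrite it as the fixed point equation
  \<open>w i = 1 / (w (\<beta> i) + \<dots>)\<close>. The main term of coordinate \<open>i\<close> only involves a coordinate of smaller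
  rank, so the right-hand side contracts a small box around \<open>1\<close> in the maximum norm in which the
  coordinate \<open>i\<close> is weighted by \<open>1 / 4 ^ rk i\<close>; \<open>\<delta>\<close> is small enough for the remaining terms not to
  spoil this. Iterating the map from \<open>1\<close> gives a convergent sequence.\<close>

lemma perturbed_triangular_system:
  fixes a :: "'i \<Rightarrow> 'i \<Rightarrow> complex" and rk :: "'i \<Rightarrow> nat"
  assumes I: "finite I" "o' \<in> I" and rk_less: "\<And>i. i \<in> I \<Longrightarrow> rk i \<le> M"
    and \<beta>: "\<And>i. i \<in> I - {o'} \<Longrightarrow> \<beta> i \<in> I \<and> rk (\<beta> i) < rk i"
    and a: "\<And>i b. i \<in> I - {o'} \<Longrightarrow> b \<in> I \<Longrightarrow> norm (a i b) \<le> \<delta>"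
    and \<delta>: "2 * real (card I) * \<delta> \<le> 1 / 4 ^ (M + 1)"
  shows "\<exists>w. w o' = 1 \<and> (\<forall>i\<in>I - {o'}. w i * (w (\<beta> i) + (\<Sum>b\<in>I. a i b * w b)) = 1) \<and>
           (\<forall>i\<in>I. norm (w i - 1) \<le> 1/4)"
proof -
  define c :: real where "c = 1 / 4 ^ (M + 1)"
  have c: "c > 0" "c * 4 ^ M = 1/4" by (auto simp: c_def)
  have c_rk: "c * 4 ^ rk i \<le> 1/4" if "i \<in> I" for i
  proof -
    have "c * 4 ^ rk i \<le> c * 4 ^ M"
      using c(1) rk_less[OF that] by (intro mult_left_mono power_increasing) auto
    then show ?thesis using c(2) by simp
  qed
  define A where "A w i = w (\<beta> i) + (\<Sum>b\<in>I. a i b * w b)" for w :: "'i \<Rightarrow> complex" and i :: 'i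
  define T where "T w i = (if i = o' then 1 else inverse (A w i))" for w :: "'i \<Rightarrow> complex" and i
  \<comment> \<open>The box on which \<open>T\<close> is a contraction. Its radii grow by the factor \<open>4\<close> with each rank, up to
    \<open>1/4\<close>.\<close>
  define D where "D = {w :: 'i \<Rightarrow> complex. \<forall>i\<in>I. norm (w i - 1) \<le> c * 4 ^ rk i}"
  have step: "4 * 4 ^ rk (\<beta> i) \<le> (4 ^ rk i :: real)" if "i \<in> I - {o'}" for i
  proof -
    have "(4::real) ^ Suc (rk (\<beta> i)) \<le> 4 ^ rk i"
      using \<beta>[OF that] by (intro power_increasing) auto
    then show ?thesis by simp
  qed
  have sum_a: "norm (\<Sum>b\<in>I. a i b * x b) \<le> c / 2 * K"
    if i: "i \<in> I - {o'}" and x: "\<And>b. b \<in> I \<Longrightarrow> norm (x b) \<le> K" for i x K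
  proof -
    have K: "K \<ge> 0" using x[OF I(2)] norm_ge_zero order_trans by blast
    have "norm (\<Sum>b\<in>I. a i b * x b) \<le> (\<Sum>b\<in>I. \<delta> * K)"
      using a[OF i] x order_trans[OF norm_ge_zero a[OF i I(2)]]
      by (intro sum_norm_le) (auto simp: norm_mult intro!: mult_mono)
    also have "\<dots> = (2 * real (card I) * \<delta>) / 2 * K" by simp
    also have "\<dots> \<le> c / 2 * K"
      using K \<delta> by (intro mult_right_mono divide_right_mono) (auto simp: c_def)
    finally show ?thesis .
  qed
  have A_near: "norm (A w i - 1) \<le> 2 * (c * 4 ^ rk (\<beta> i))" if "w \<in> D" "i \<in> I - {o'}" for w i
  proof -
    have "norm (w b) \<le> 2" if "b \<in> I" for b
      using \<open>w \<in> D\<close> that c_rk[OF that] norm_triangle_ineq[of "w b - 1" 1] by (force simp: D_def)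
    then have "norm (\<Sum>b\<in>I. a i b * w b) \<le> c / 2 * 2" using that by (intro sum_a) auto
    moreover have "norm (w (\<beta> i) - 1) \<le> c * 4 ^ rk (\<beta> i)" using that \<beta> by (auto simp: D_def)
    moreover have "c \<le> c * 4 ^ rk (\<beta> i)" using c(1) by simp
    ultimately show ?thesis
      using norm_triangle_ineq[of "w (\<beta> i) - 1" "\<Sum>b\<in>I. a i b * w b"]
      by (simp add: A_def algebra_simps)
  qed
  have A_eighth: "norm (A w i - 1) \<le> 1/8" if "w \<in> D" "i \<in> I - {o'}" for w i
  proof -
    have "2 * (c * 4 ^ rk (\<beta> i)) \<le> c * 4 ^ rk i / 2"
      using step[OF that(2)] c(1) by (simp add: field_simps)
    also have "\<dots> \<le> 1/8" using c_rk[of i] that by simp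
    finally show ?thesis using A_near[OF that] by simp
  qed
  have T_D: "T w \<in> D" if "w \<in> D" for w
  proof -
    have "norm (T w i - 1) \<le> c * 4 ^ rk i" if i: "i \<in> I" for i
    proof (cases "i = o'")
      case True
      then show ?thesis using c(1) by (simp add: T_def)
    next
      case False
      then have i': "i \<in> I - {o'}" using i by simp
      have half: "2 * (c * 4 ^ rk (\<beta> i)) \<le> 1/2"
        using c_rk[of "\<beta> i"] \<beta>[OF i'] by simp
      have "norm (inverse (A w i) - 1) \<le> 2 * (2 * (c * 4 ^ rk (\<beta> i)))"
        by (rule norm_inverse_one_plus_bound[OF A_near[OF \<open>w \<in> D\<close> i'] half])
      also have "\<dots> \<le> c * 4 ^ rk i" using step[OF i'] c(1) by (simp add: algebra_simps)
      finally show ?thesis using False by (simp add: T_def)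
    qed
    then show ?thesis by (simp add: D_def)
  qed
  have contract: "norm (T w i - T w' i) \<le> K / 2 * 4 ^ rk i"
    if w: "w \<in> D" "w' \<in> D" and i: "i \<in> I"
      and K: "\<And>b. b \<in> I \<Longrightarrow> norm (w b - w' b) \<le> K * 4 ^ rk b" for w w' i K
  proof -
    have "0 \<le> K * 4 ^ rk o'" using K[OF I(2)] norm_ge_zero order_trans by blast
    then have K0: "K \<ge> 0" using zero_le_mult_iff[of K "4 ^ rk o'"] zero_less_power[of "4::real" "rk o'"] by linarith
    show ?thesis
    proof (cases "i = o'")
      case True
      then show ?thesis using K0 by (simp add: T_def)
    next
      case False
      then have i': "i \<in> I - {o'}" using i by simp
      have "norm (w b - w' b) \<le> K * 4 ^ M" if "b \<in> I" for b
        using K[OF that] rk_less[OF that] K0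
        by (meson dual_order.trans mult_left_mono one_le_numeral power_increasing)
      then have "norm (\<Sum>b\<in>I. a i b * (w b - w' b)) \<le> c / 2 * (K * 4 ^ M)"
        by (intro sum_a i')
      also have "\<dots> = (c * 4 ^ M) * K / 2" by simp
      also have "\<dots> \<le> K / 8 * 4 ^ rk (\<beta> i)"
        using K0 mult_left_mono[of 1 "4 ^ rk (\<beta> i)" "K / 8"] unfolding c(2) by simp
      finally have "norm (\<Sum>b\<in>I. a i b * (w b - w' b)) \<le> K / 8 * 4 ^ rk (\<beta> i)" .
      moreover have "A w i - A w' i = (w (\<beta> i) - w' (\<beta> i)) + (\<Sum>b\<in>I. a i b * (w b - w' b))"
        by (simp add: A_def sum_subtractf algebra_simps)
      moreover have "norm (w (\<beta> i) - w' (\<beta> i)) \<le> K * 4 ^ rk (\<beta> i)" using K \<beta>[OF i'] by simp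
      ultimately have "norm (A w i - A w' i) \<le> 3/2 * (K * 4 ^ rk (\<beta> i))"
        using norm_triangle_ineq[of "w (\<beta> i) - w' (\<beta> i)" "\<Sum>b\<in>I. a i b * (w b - w' b)"]
          mult_nonneg_nonneg[OF K0, of "4 ^ rk (\<beta> i)"] by (simp del: times_divide_eq_left)
      moreover have "norm (inverse (A w i) - inverse (A w' i)) \<le> 4/3 * norm (A w i - A w' i)"
        by (intro norm_inverse_diff_bound A_eighth w i')
      ultimately have "norm (inverse (A w i) - inverse (A w' i)) \<le> 2 * K * 4 ^ rk (\<beta> i)"
        by simp
      also have "\<dots> \<le> K / 2 * 4 ^ rk i"
        using mult_left_mono[OF step[OF i'], of "K / 2"] K0 by simp
      finally show ?thesis using False by (simp add: T_def)
    qed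
  qed
  define w where "w k = (T ^^ k) (\<lambda>_. 1)" for k
  have w_Suc: "w (Suc k) = T (w k)" for k by (simp add: w_def)
  have w_D: "w k \<in> D" for k
  proof (induction k)
    case 0
    show ?case using c(1) by (simp add: w_def D_def)
  next
    case (Suc k)
    then show ?case by (simp add: w_Suc T_D)
  qed
  have diff: "norm (w (Suc k) i - w k i) \<le> c * (1/2) ^ k * 4 ^ rk i" if "i \<in> I" for k i
    using that
  proof (induction k arbitrary: i)
    case 0
    then show ?case using w_D[of 1] by (simp add: D_def w_def)
  next
    case (Suc k)
    then show ?case using contract[OF w_D[of "Suc k"] w_D[of k] _ Suc.IH] by (simp add: w_Suc)
  qed
  have conv: "convergent (\<lambda>k. w k i)" if i: "i \<in> I" for i
  proof -
    have "summable (\<lambda>k. w (Suc k) i - w k i)"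
    proof (rule summable_comparison_test')
      show "summable (\<lambda>k. c * (1/2) ^ k * 4 ^ rk i)"
        by (intro summable_mult summable_mult2 summable_geometric) auto
      show "norm (w (Suc k) i - w k i) \<le> c * (1/2) ^ k * 4 ^ rk i" if "k \<ge> 0" for k
        by (rule diff[OF i])
    qed
    then have "convergent (\<lambda>k. \<Sum>j<k. w (Suc j) i - w j i)"
      by (simp add: summable_iff_convergent)
    then have "convergent (\<lambda>k. (\<Sum>j<k. w (Suc j) i - w j i) + w 0 i)"
      by (intro convergent_add convergent_const)
    moreover have "(\<Sum>j<k. w (Suc j) i - w j i) + w 0 i = w k i" for k
      by (subst sum_lessThan_telescope) simp
    ultimately show ?thesis by simp
  qed
  define l where "l i = lim (\<lambda>k. w k i)" for i
  have lim: "(\<lambda>k. w k i) \<longlonglongrightarrow> l i" if "i \<in> I" for i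
    using conv[OF that] by (simp add: l_def convergent_LIMSEQ_iff)
  have l_D: "l \<in> D"
    using lim w_D unfolding D_def
    by (auto intro!: tendsto_upperbound[OF tendsto_norm[OF tendsto_diff[OF lim tendsto_const]]])
  have "l o' = 1"
  proof -
    have "w k o' = 1" for k by (cases k) (auto simp: w_def T_def)
    then show ?thesis by (simp add: l_def)
  qed
  moreover have "l i * A l i = 1" if i: "i \<in> I - {o'}" for i
  proof -
    have nz: "A l i \<noteq> 0" using A_eighth[OF l_D i] by auto
    have "(\<lambda>k. A (w k) i) \<longlonglongrightarrow> A l i"
      unfolding A_def using \<beta>[OF i] by (intro tendsto_intros lim) auto
    then have "(\<lambda>k. T (w k) i) \<longlonglongrightarrow> inverse (A l i)"
      using i nz by (auto simp: T_def intro!: tendsto_inverse)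
    moreover have "(\<lambda>k. T (w k) i) \<longlonglongrightarrow> l i"
      using LIMSEQ_Suc[OF lim[of i]] i by (simp add: w_Suc)
    ultimately have "l i = inverse (A l i)" using LIMSEQ_unique by blast
    then show ?thesis using nz by simp
  qed
  moreover have "norm (l i - 1) \<le> 1/4" if "i \<in> I" for i
    using l_D c_rk[OF that] that by (force simp: D_def)
  ultimately show ?thesis unfolding A_def by blast
qed

text \<open>If each linear form is replaced by its term at \<open>\<beta> i\<close>, the equations determine the \<open>z i\<close> recursively
  as monomials in the \<open>\<mu>\<close>. Because the \<open>\<mu>\<close> drop faster than quadratically, the moduli \<open>Z i\<close> of these
  monomials drop by \<open>\<delta>\<close> from each rank to any larger one. Hence the term at \<open>\<beta> i\<close> dominates its linear
  form, and in units of the approximate solution the system is a small perturbation of a triangular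
  one.\<close>

lemma triangular_system:
  fixes s :: "'i \<Rightarrow> 'i \<Rightarrow> complex" and rk :: "'i \<Rightarrow> nat"
  assumes I: "finite I" "o' \<in> I" and rk_le: "\<And>i. i \<in> I \<Longrightarrow> rk i \<le> M" and inj: "inj_on rk I"
    and \<beta>: "\<And>i. i \<in> I - {o'} \<Longrightarrow> \<beta> i \<in> I \<and> rk (\<beta> i) < rk i \<and> norm (s i (\<beta> i)) = 1"
    and s: "\<And>i b. i \<in> I - {o'} \<Longrightarrow> b \<in> I \<Longrightarrow> b \<noteq> \<beta> i \<Longrightarrow> s i b \<noteq> 0 \<Longrightarrow>
              norm (s i b) \<le> 1 \<and> rk (\<beta> i) < rk b"
    and \<delta>: "0 < \<delta>" "\<delta> \<le> 1" "2 * real (card I) * \<delta> \<le> 1 / 4 ^ (M + 1)"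
    and \<mu>: "\<And>i. i \<in> I \<Longrightarrow> \<mu> i \<noteq> 0" "\<mu> o' = 1"
      "\<And>i j. i \<in> I \<Longrightarrow> j \<in> I \<Longrightarrow> rk j < rk i \<Longrightarrow> norm (\<mu> i) \<le> \<delta> * norm (\<mu> j) ^ 2"
  shows "\<exists>z Z. z o' = 1 \<and> (\<forall>i\<in>I - {o'}. z i * (\<Sum>b\<in>I. s i b * z b) = \<mu> i) \<and>
     (\<forall>i\<in>I. Z i > 0 \<and> 3/4 * Z i \<le> norm (z i) \<and> norm (z i) \<le> 5/4 * Z i) \<and>
     (\<forall>i\<in>I. \<forall>j\<in>I. rk j < rk i \<longrightarrow> Z i \<le> \<delta> * Z j) \<and>
     (\<forall>i\<in>I - {o'}. norm (\<mu> i) = Z i * Z (\<beta> i))"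
proof -
  define F where "F f i = (if i = o' then 1 else \<mu> i / (s i (\<beta> i) * f (\<beta> i)))" for f i
  define z0 where "z0 = wfrec (Wellfounded.measure rk) F"
  have z0_o: "z0 o' = 1"
    unfolding z0_def by (subst wfrec) (auto simp: F_def)
  have z0: "z0 i = \<mu> i / (s i (\<beta> i) * z0 (\<beta> i))" if "i \<in> I - {o'}" for i
    unfolding z0_def using \<beta>[OF that] that
    by (subst wfrec) (auto simp: F_def cut_apply)
  define Z where "Z i = norm (z0 i)" for i
  have Z_o: "Z o' = 1" by (simp add: Z_def z0_o)
  have Z: "Z i = norm (\<mu> i) / Z (\<beta> i)" if "i \<in> I - {o'}" for i
    using z0[OF that] \<beta>[OF that] by (simp add: Z_def norm_mult norm_divide)
  have \<mu>_le: "norm (\<mu> i) \<le> \<delta>" if "i \<in> I" "rk o' < rk i" for i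
    using \<mu>(3)[of i o'] that I(2) \<mu>(2) by simp
  \<comment> \<open>Dividing by a number \<open>Z (\<beta> i) \<le> 1\<close> can only enlarge \<open>norm (\<mu> i)\<close>, and the drop of \<open>\<mu>\<close> from
    \<open>\<beta> i\<close> to \<open>i\<close> keeps the quotient below \<open>1\<close>.\<close>
  have bounds: "norm (\<mu> i) \<le> Z i \<and> Z i \<le> 1" if "i \<in> I" for i
    using that
  proof (induction "rk i" arbitrary: i rule: less_induct)
    case less
    show ?case
    proof (cases "i = o'")
      case True
      then show ?thesis using Z_o \<mu>(2) by simp
    next
      case False
      then have i: "i \<in> I - {o'}" using less.prems by simp
      let ?b = "\<beta> i"
      have b: "?b \<in> I" "rk ?b < rk i" using \<beta>[OF i] by auto
      have IH: "norm (\<mu> ?b) \<le> Z ?b" "Z ?b \<le> 1" using less.hyps[OF b(2,1)] by auto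
      have pos: "norm (\<mu> ?b) > 0" using \<mu>(1) b by simp
      then have pos': "Z ?b > 0" using IH by (rule_tac less_le_trans)
      have "norm (\<mu> i) \<le> \<delta> * norm (\<mu> ?b) ^ 2" using \<mu>(3)[of i ?b] b less.prems by simp
      also have "\<dots> \<le> 1 * norm (\<mu> ?b) ^ 2" using \<delta> by (intro mult_right_mono) auto
      also have "\<dots> \<le> norm (\<mu> ?b)"
        using IH pos by (simp add: power2_eq_square mult_left_le)
      finally have "norm (\<mu> i) \<le> Z ?b" using IH by simp
      then show ?thesis
        using pos' IH \<mu>(1)[OF less.prems] unfolding Z[OF i] by (auto simp: field_simps mult_left_le)
    qed
  qed
  have Z_pos: "Z i > 0" if "i \<in> I" for i
    using bounds[OF that] \<mu>(1)[OF that] by (meson less_le_trans zero_less_norm_iff)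
  have Z_decreasing: "Z i \<le> \<delta> * Z j" if ij: "i \<in> I" "j \<in> I" "rk j < rk i" for i j
    using ij
  proof (induction "rk i" arbitrary: i j rule: less_induct)
    case less
    show ?case
    proof (cases "i = o'")
      case True
      \<comment> \<open>An index before \<open>o'\<close> is compatible with the drop of \<open>\<mu>\<close> only if \<open>\<delta> = 1\<close>.\<close>
      have "1 \<le> \<delta> * norm (\<mu> j) ^ 2" using \<mu>(2) \<mu>(3)[of i j] less.prems True by simp
      also have "norm (\<mu> j) ^ 2 \<le> norm (\<mu> j) * 1"
        unfolding power2_eq_square
        using order_trans[OF bounds[of j, THEN conjunct1] bounds[of j, THEN conjunct2]] less.prems
        by (intro mult_left_mono) auto
      finally have "1 \<le> \<delta> * Z j" using bounds[of j] less.prems \<delta>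
        by (smt (verit) mult_left_mono)
      then show ?thesis using True Z_o by simp
    next
      case False
      then have i: "i \<in> I - {o'}" using less.prems by simp
      let ?b = "\<beta> i"
      have b: "?b \<in> I" "rk ?b < rk i" using \<beta>[OF i] by auto
      define m where "m = (if rk ?b < rk j then j else ?b)"
      have m: "m \<in> I" "rk m < rk i" using b less.prems by (auto simp: m_def)
      have "norm (\<mu> m) \<le> Z ?b \<and> norm (\<mu> m) \<le> Z j"
      proof (cases "rk ?b < rk j")
        case True
        have "Z j \<le> \<delta> * Z ?b" using less.hyps[of j ?b] True b less.prems by simp
        also have "\<dots> \<le> Z ?b" using \<delta> Z_pos[OF b(1)] by (simp add: mult_left_le_one_le)
        finally show ?thesis using bounds[of j] less.prems True by (auto simp: m_def)
      next
        case False
        show ?thesis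
        proof (cases "rk j < rk ?b")
          case True
          have "Z ?b \<le> \<delta> * Z j" using less.hyps[of ?b j] True b less.prems by simp
          also have "\<dots> \<le> Z j" using \<delta> Z_pos[of j] less.prems by (simp add: mult_left_le_one_le)
          finally show ?thesis using bounds[OF b(1)] False by (auto simp: m_def)
        next
          case same: False
          then have "?b = j" using False inj b less.prems by (metis inj_onD linorder_neqE_nat)
          then show ?thesis using bounds[OF b(1)] by (simp add: m_def)
        qed
      qed
      then have "norm (\<mu> m) ^ 2 \<le> Z ?b * Z j"
        unfolding power2_eq_square using Z_pos[OF b(1)] by (intro mult_mono) auto
      then have "norm (\<mu> i) \<le> \<delta> * (Z ?b * Z j)"
        using \<mu>(3)[of i m] m less.prems \<delta> by (meson less_eq_real_def mult_left_mono order_trans)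
      then have "norm (\<mu> i) / Z ?b \<le> \<delta> * (Z ?b * Z j) / Z ?b"
        using Z_pos[OF b(1)] by (intro divide_right_mono) auto
      then show ?thesis using Z[OF i] Z_pos[OF b(1)] by simp
    qed
  qed
  define a where "a i b = (if b = \<beta> i then 0 else s i b * z0 b / (s i (\<beta> i) * z0 (\<beta> i)))" for i b
  have a: "norm (a i b) \<le> \<delta>" if i: "i \<in> I - {o'}" and b: "b \<in> I" for i b
  proof (cases "b = \<beta> i \<or> s i b = 0")
    case True
    then show ?thesis using \<delta> by (auto simp: a_def)
  next
    case False
    then have sb: "norm (s i b) \<le> 1" "rk (\<beta> i) < rk b" using s[OF i b] by auto
    have "norm (a i b) = norm (s i b) * Z b / Z (\<beta> i)"
      using False \<beta>[OF i] by (simp add: a_def norm_mult norm_divide Z_def)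
    also have "\<dots> \<le> 1 * Z b / Z (\<beta> i)"
      using sb by (intro divide_right_mono mult_right_mono) (auto simp: Z_def)
    also have "\<dots> \<le> \<delta>"
      using Z_decreasing[OF b _ sb(2)] Z_pos[of "\<beta> i"] \<beta>[OF i] by (simp add: field_simps)
    finally show ?thesis .
  qed
  obtain w where w: "w o' = 1" "\<And>i. i \<in> I - {o'} \<Longrightarrow> w i * (w (\<beta> i) + (\<Sum>b\<in>I. a i b * w b)) = 1"
    "\<And>i. i \<in> I \<Longrightarrow> norm (w i - 1) \<le> 1/4"
    using perturbed_triangular_system[where rk = rk and a = a and \<beta> = \<beta> and M = M and \<delta> = \<delta>,
        OF I rk_le _ a \<delta>(3)] \<beta> by blast
  define z where "z i = z0 i * w i" for i
  have "z i * (\<Sum>b\<in>I. s i b * z b) = \<mu> i" if i: "i \<in> I - {o'}" for i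
  proof -
    have \<beta>I: "\<beta> i \<in> I" using \<beta>[OF i] by simp
    have nz: "z0 (\<beta> i) \<noteq> 0" "s i (\<beta> i) \<noteq> 0"
      using Z_pos[OF \<beta>I] \<beta>[OF i] by (auto simp: Z_def)
    let ?k = "s i (\<beta> i) * z0 (\<beta> i)"
    have "(\<Sum>b\<in>I. s i b * z b) = s i (\<beta> i) * z (\<beta> i) + (\<Sum>b\<in>I - {\<beta> i}. s i b * z b)"
      using I(1) \<beta>I by (rule sum.remove)
    also have "(\<Sum>b\<in>I - {\<beta> i}. s i b * z b) = (\<Sum>b\<in>I - {\<beta> i}. ?k * (a i b * w b))"
      using nz by (intro sum.cong) (auto simp: a_def z_def)
    also have "\<dots> = ?k * (\<Sum>b\<in>I. a i b * w b)"
      using I(1) \<beta>I by (simp add: sum_distrib_left sum.remove[of I "\<beta> i"] a_def)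
    also have "s i (\<beta> i) * z (\<beta> i) = ?k * w (\<beta> i)" by (simp add: z_def)
    finally have "(\<Sum>b\<in>I. s i b * z b) = ?k * (w (\<beta> i) + (\<Sum>b\<in>I. a i b * w b))"
      by (simp add: algebra_simps)
    then have "z i * (\<Sum>b\<in>I. s i b * z b) =
        z0 i * ?k * (w i * (w (\<beta> i) + (\<Sum>b\<in>I. a i b * w b)))" by (simp add: z_def)
    also have "\<dots> = z0 i * ?k" using w(2)[OF i] by simp
    also have "\<dots> = \<mu> i" using z0[OF i] nz by simp
    finally show ?thesis .
  qed
  moreover have "3/4 * Z i \<le> norm (z i) \<and> norm (z i) \<le> 5/4 * Z i" if "i \<in> I" for i
  proof -
    have "3/4 \<le> norm (w i)" "norm (w i) \<le> 5/4"
      using norm_triangle_ineq2[of 1 "w i"] norm_triangle_ineq2[of "w i" 1] w(3)[OF that]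
      by (auto simp: norm_minus_commute)
    then show ?thesis
      using Z_pos[OF that] by (simp add: z_def norm_mult Z_def)
  qed
  moreover have "z o' = 1" by (simp add: z_def w(1) z0_o)
  moreover have "norm (\<mu> i) = Z i * Z (\<beta> i)" if "i \<in> I - {o'}" for i
    using Z[OF that] Z_pos[of "\<beta> i"] \<beta>[OF that] by simp
  ultimately show ?thesis using Z_pos Z_decreasing by blast
qed

section \<open>Cycles, forests and bases without broken circuits\<close>

definition edge_diff :: "(nat \<Rightarrow> complex) \<Rightarrow> nat set \<Rightarrow> complex" where
  "edge_diff x e = x (Max e) - x (Min e)"

lemma edge_diff_doubleton:
  "edge_diff x {i, j} = (if i < j then x j - x i else x i - x j)"
  by (auto simp: edge_diff_def max_def min_def)

lemma edge_diff_scaled: "edge_diff (\<lambda>i. c * x i) e = c * edge_diff x e"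
  by (simp add: edge_diff_def right_diff_distrib)

lemma cycle_edges_conv:
  "cycle_edges vs = (\<lambda>k. {vs ! k, vs ! (Suc k mod length vs)}) ` {..<length vs}"
  by (auto simp: cycle_edges_def)

lemma inj_on_cycle_edge:
  assumes "distinct vs" "3 \<le> length vs"
  shows "inj_on (\<lambda>k. {vs ! k, vs ! (Suc k mod length vs)}) {..<length vs}"
proof (rule inj_onI)
  let ?l = "length vs"
  fix i j assume i: "i \<in> {..<?l}" and j: "j \<in> {..<?l}"
    and eq: "{vs ! i, vs ! (Suc i mod ?l)} = {vs ! j, vs ! (Suc j mod ?l)}"
  have less: "Suc i mod ?l < ?l" "Suc j mod ?l < ?l" using assms(2) by (auto intro: mod_less_divisor)
  have "i = j \<or> (i = Suc j mod ?l \<and> j = Suc i mod ?l)"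
    using eq i j less nth_eq_iff_index_eq[OF assms(1)] by (auto simp: doubleton_eq_iff)
  moreover have "Suc i mod ?l = (if Suc i = ?l then 0 else Suc i)"
    "Suc j mod ?l = (if Suc j = ?l then 0 else Suc j)" using i j by auto
  ultimately show "i = j" using assms(2) i j by (auto split: if_splits)
qed

text \<open>The differences of \<open>x\<close> along a closed walk add up to zero. Signs compare the direction of the walk
  with the direction from \<open>Min f\<close> to \<open>Max f\<close>; at least three vertices are needed for the edges of the
  walk to be distinct.\<close>

lemma cycle_edges_relation:
  assumes "distinct vs" "3 \<le> length vs"
  shows "\<exists>s. (\<forall>f\<in>cycle_edges vs. s f = 1 \<or> s f = -1) \<and>
           (\<forall>x. (\<Sum>f\<in>cycle_edges vs. s f * edge_diff x f) = 0)"
proof -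
  let ?l = "length vs"
  let ?e = "\<lambda>k. {vs ! k, vs ! (Suc k mod ?l)}"
  note inj = inj_on_cycle_edge[OF assms]
  define sgn where "sgn k = (if vs ! k < vs ! (Suc k mod ?l) then 1 else - 1 :: complex)" for k
  define s where "s f = sgn (inv_into {..<?l} ?e f)" for f
  have s: "s (?e k) = sgn k" if "k < ?l" for k
    unfolding s_def using inv_into_f_f[OF inj, of k] that by simp
  have "(\<Sum>f\<in>cycle_edges vs. s f * edge_diff x f) = 0" for x
  proof -
    have "(\<Sum>f\<in>cycle_edges vs. s f * edge_diff x f) = (\<Sum>k<?l. s (?e k) * edge_diff x (?e k))"
      unfolding cycle_edges_conv by (subst sum.reindex[OF inj]) simp
    also have "\<dots> = (\<Sum>k<?l. x (vs ! (Suc k mod ?l)) - x (vs ! k))"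
      by (intro sum.cong refl) (simp add: s sgn_def edge_diff_doubleton)
    also have "\<dots> = (\<Sum>k<?l. x (vs ! (Suc k mod ?l))) - (\<Sum>k<?l. x (vs ! k))"
      by (rule sum_subtractf)
    also have "(\<Sum>k<?l. x (vs ! (Suc k mod ?l))) = (\<Sum>k<?l. x (vs ! k))"
    proof -
      obtain m where m: "?l = Suc m" using assms(2) by (cases ?l) auto
      have "(\<Sum>k<Suc m. x (vs ! (Suc k mod Suc m))) = (\<Sum>k<m. x (vs ! Suc k)) + x (vs ! 0)"
        by simp
      also have "\<dots> = (\<Sum>k<Suc m. x (vs ! k))" by (subst sum.lessThan_Suc_shift) simp
      finally show ?thesis by (simp add: m)
    qed
    finally show ?thesis by simp
  qed
  moreover have "\<forall>f\<in>cycle_edges vs. s f = 1 \<or> s f = -1" by (simp add: s_def sgn_def)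
  ultimately show ?thesis by blast
qed

definition adjacency :: "nat set set \<Rightarrow> (nat \<times> nat) set" where
  "adjacency B = {(i, j). {i, j} \<in> B}"

lemma simple_path_of_connected:
  assumes "(i, j) \<in> (adjacency B)\<^sup>*"
  shows "\<exists>vs. distinct vs \<and> vs \<noteq> [] \<and> hd vs = i \<and> last vs = j \<and>
           (\<forall>k. Suc k < length vs \<longrightarrow> {vs ! k, vs ! Suc k} \<in> B)"
  using assms
proof (induction rule: rtrancl_induct)
  case base
  show ?case by (intro exI[of _ "[i]"]) auto
next
  case (step y z)
  then obtain vs where vs: "distinct vs" "vs \<noteq> []" "hd vs = i" "last vs = y"
    "\<And>k. Suc k < length vs \<Longrightarrow> {vs ! k, vs ! Suc k} \<in> B" by blast
  show ?case
  proof (cases "z \<in> set vs")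
    case True
    then obtain k where k: "k < length vs" "vs ! k = z" by (auto simp: in_set_conv_nth)
    have "last (take (Suc k) vs) = z" using k by (simp add: take_Suc_conv_app_nth)
    then show ?thesis using vs k by (intro exI[of _ "take (Suc k) vs"]) auto
  next
    case False
    have "{y, z} \<in> B" using step.hyps by (simp add: adjacency_def)
    then have "{(vs @ [z]) ! k, (vs @ [z]) ! Suc k} \<in> B" if "Suc k < length (vs @ [z])" for k
    proof (cases "Suc k = length vs")
      case True
      then have "vs ! k = y" using vs(2,4) by (metis diff_Suc_1 last_conv_nth)
      then show ?thesis using True \<open>{y, z} \<in> B\<close> by (simp add: nth_append)
    next
      case False
      then show ?thesis using that vs(5)[of k] by (simp add: nth_append)
    qed
    then show ?thesis using vs(1-4) False by (intro exI[of _ "vs @ [z]"]) auto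
  qed
qed

lemma graph_cycles_mono: "B \<subseteq> B' \<Longrightarrow> graph_cycles B \<subseteq> graph_cycles B'"
  by (auto simp: graph_cycles_def)

text \<open>A simple path from \<open>i\<close> to \<open>j\<close> that avoids the edge between them has at least three vertices, so this
  edge closes it to a cycle.\<close>

lemma cycle_through_new_edge:
  assumes "(i, j) \<in> (adjacency B)\<^sup>*" "i \<noteq> j" "{i, j} \<notin> B"
  shows "graph_cycles (insert {i, j} B) \<noteq> {}"
proof -
  obtain vs where vs: "distinct vs" "vs \<noteq> []" "hd vs = i" "last vs = j"
    "\<And>k. Suc k < length vs \<Longrightarrow> {vs ! k, vs ! Suc k} \<in> B"
    using simple_path_of_connected[OF assms(1)] by blast
  have ends: "vs ! 0 = i" "vs ! (length vs - 1) = j"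
    using vs(2-4) by (auto simp: hd_conv_nth last_conv_nth)
  have "length vs \<noteq> 0" "length vs \<noteq> 1" using ends assms(2) vs(2) by auto
  moreover have "length vs \<noteq> 2" using ends assms(3) vs(5)[of 0] by auto
  ultimately have len: "3 \<le> length vs" by linarith
  have "cycle_edges vs \<subseteq> insert {i, j} B"
    unfolding cycle_edges_conv
  proof (rule image_subsetI)
    fix k assume "k \<in> {..<length vs}"
    then consider "Suc k < length vs" | "Suc k = length vs" by fastforce
    then show "{vs ! k, vs ! (Suc k mod length vs)} \<in> insert {i, j} B"
    proof cases
      case 1
      then show ?thesis using vs(5)[of k] by simp
    next
      case 2
      then have "k = length vs - 1" by simp
      then show ?thesis using 2 ends by (simp add: insert_commute)
    qed
  qed
  then show ?thesis using vs(1) len by (auto simp: graph_cycles_def)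
qed

lemma forest_edge_diff_surjective:
  assumes "finite B" "\<And>e. e \<in> B \<Longrightarrow> card e = 2" "graph_cycles B = {}"
  shows "\<exists>x. \<forall>b\<in>B. edge_diff x b = \<zeta> b"
  using assms
proof (induction B)
  case empty
  show ?case by simp
next
  case (insert b B)
  have "graph_cycles B = {}" using insert.prems(2) graph_cycles_mono[of B "insert b B"] by auto
  then obtain x where x: "\<forall>b\<in>B. edge_diff x b = \<zeta> b" using insert by auto
  obtain i j where b: "b = {i, j}" "i < j"
    using insert.prems(1)[of b] by (metis card_2_iff insertI1 insert_commute linorder_neqE_nat)
  define R where "R = {k. (j, k) \<in> (adjacency B)\<^sup>*}"
  have "(j, i) \<notin> (adjacency B)\<^sup>*"
    using cycle_through_new_edge[of j i B] insert b by (auto simp: insert_commute)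
  then have iR: "i \<notin> R" and jR: "j \<in> R" by (auto simp: R_def)
  \<comment> \<open>Removing \<open>b\<close> separates its endpoints. A constant added on the side of \<open>j\<close> changes the
    difference along \<open>b\<close> and along no other edge.\<close>
  define x' where "x' k = (if k \<in> R then x k + (\<zeta> b - edge_diff x b) else x k)" for k
  have "edge_diff x' b = \<zeta> b" using iR jR b by (simp add: x'_def edge_diff_doubleton)
  moreover have "edge_diff x' f = \<zeta> f" if f: "f \<in> B" for f
  proof -
    obtain k l where kl: "f = {k, l}" using insert.prems(1)[of f] f by (metis card_2_iff insertI2)
    have "(k, l) \<in> adjacency B" "(l, k) \<in> adjacency B"
      using f kl by (auto simp: adjacency_def insert_commute)
    then have "k \<in> R \<longleftrightarrow> l \<in> R" by (auto simp: R_def intro: rtrancl.rtrancl_into_rtrancl)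
    then have "edge_diff x' f = edge_diff x f" by (auto simp: kl edge_diff_doubleton x'_def)
    then show ?thesis using x f by simp
  qed
  ultimately show ?case by (intro exI[of _ x']) auto
qed

lemma min_wrt_is_least:
  assumes r: "linear_order_on E r" and "finite S" "S \<noteq> {}" "S \<subseteq> E"
  shows "min_wrt r S \<in> S \<and> (\<forall>x\<in>S. (min_wrt r S, x) \<in> r)"
proof -
  have r': "refl_on E r" "trans r" "antisym r" "total_on E r"
    using r by (auto simp: linear_order_on_def partial_order_on_def preorder_on_def)
  have refl: "(x, x) \<in> r" if "x \<in> E" for x using r'(1) that by (rule refl_onD)
  have "\<exists>m\<in>S. \<forall>x\<in>S. (m, x) \<in> r"
    using assms(2-4)
  proof (induction S rule: finite_ne_induct)
    case (singleton x)
    then show ?case using refl by simp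
  next
    case (insert y S)
    then obtain m where m: "m \<in> S" "\<forall>x\<in>S. (m, x) \<in> r" by auto
    have ym: "y \<in> E" "m \<in> E" using insert.prems m(1) by auto
    show ?case
    proof (cases "(m, y) \<in> r")
      case True
      then show ?thesis using m by blast
    next
      case False
      then have "(y, m) \<in> r" using r'(4) ym refl unfolding total_on_def by metis
      then have "\<forall>x\<in>insert y S. (y, x) \<in> r" using m(2) r'(2) refl[OF ym(1)] by (auto dest: transD)
      then show ?thesis by blast
    qed
  qed
  then obtain m where m: "m \<in> S" "\<forall>x\<in>S. (m, x) \<in> r" by blast
  have "min_wrt r S = m"
    unfolding min_wrt_def using m r'(3) by (intro the_equality) (auto dest: antisymD)
  then show ?thesis using m by simp
qed

text \<open>For \<open>e\<close> outside a basis there is a circuit through \<open>e\<close> in the basis together with \<open>e\<close>. If its least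
  element were \<open>e\<close>, the basis would contain a broken circuit; so its least element lies in the
  basis.\<close>

lemma nbc_basis_fundamental_circuit:
  assumes r: "linear_order_on E r" and E: "finite E"
    and B: "nbc_basis E (graph_cycles E) r B" and e: "e \<in> E - B"
  obtains C m where "C \<in> graph_cycles E" "e \<in> C" "C \<subseteq> insert e B"
    "m \<in> C" "m \<in> B" "\<And>f. f \<in> C \<Longrightarrow> (m, f) \<in> r"
proof -
  have basis: "B \<subseteq> E" "\<And>C. C \<in> graph_cycles E \<Longrightarrow> \<not> C \<subseteq> B"
    "\<And>I. independent_in E (graph_cycles E) I \<Longrightarrow> B \<subseteq> I \<Longrightarrow> I = B"
    and nbc: "\<And>C. C \<in> graph_cycles E \<Longrightarrow> \<not> C - {min_wrt r C} \<subseteq> B"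
    using B by (auto simp: nbc_basis_def basis_of_def independent_in_def broken_circuits_def)
  have "\<not> independent_in E (graph_cycles E) (insert e B)" using basis(3)[of "insert e B"] e by blast
  then obtain C where C: "C \<in> graph_cycles E" "C \<subseteq> insert e B"
    using basis(1) e by (auto simp: independent_in_def)
  have "e \<in> C" using basis(2)[OF C(1)] C(2) by blast
  have "C \<subseteq> E" using C(1) by (auto simp: graph_cycles_def)
  then have m: "min_wrt r C \<in> C" "\<And>f. f \<in> C \<Longrightarrow> (min_wrt r C, f) \<in> r"
    using min_wrt_is_least[OF r, of C] \<open>e \<in> C\<close> E finite_subset by blast+
  moreover have "min_wrt r C \<noteq> e" using nbc[OF C(1)] C(2) by blast
  ultimately show ?thesis using that[of C "min_wrt r C"] C \<open>e \<in> C\<close> by blast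
qed

lemma nbc_basis_contains_min:
  assumes r: "linear_order_on E r" and E: "finite E" "E \<noteq> {}"
    and B: "nbc_basis E (graph_cycles E) r B"
  shows "min_wrt r E \<in> B"
proof (rule ccontr)
  assume not: "min_wrt r E \<notin> B"
  have min: "min_wrt r E \<in> E" "\<And>x. x \<in> E \<Longrightarrow> (min_wrt r E, x) \<in> r"
    using min_wrt_is_least[OF r E] by auto
  obtain C m where "min_wrt r E \<in> C" "m \<in> B" "(m, min_wrt r E) \<in> r"
    using nbc_basis_fundamental_circuit[OF r E(1) B, of "min_wrt r E"] not min(1) by (metis DiffI)
  moreover have "m \<in> E" using B \<open>m \<in> B\<close> by (auto simp: nbc_basis_def basis_of_def independent_in_def)
  ultimately have "m = min_wrt r E"
    using r min(2)[of m] by (auto simp: linear_order_on_def partial_order_on_def dest: antisymD)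
  then show False using not \<open>m \<in> B\<close> by simp
qed

text \<open>Along every edge, differences are linear combinations of the freely prescribable differences along
  \<open>B\<close>. For \<open>e\<close> outside \<open>B\<close>, \<open>\<beta> e\<close> is the least edge of its fundamental circuit: it precedes \<open>e\<close> and all
  other basis edges that occur in the expansion of \<open>e\<close>.\<close>

definition nbc_expansion ::
    "(nat set \<times> nat set) set \<Rightarrow> nat set set \<Rightarrow> nat set set \<Rightarrow>
     (nat set \<Rightarrow> nat set \<Rightarrow> complex) \<Rightarrow> (nat set \<Rightarrow> nat set) \<Rightarrow> bool" where
  "nbc_expansion r E B S \<beta> \<longleftrightarrow>
     (\<forall>e\<in>B. \<forall>b\<in>B. S e b = of_bool (e = b)) \<and>
     (\<forall>e\<in>E - B. \<beta> e \<in> B \<and> (\<beta> e, e) \<in> r \<and> norm (S e (\<beta> e)) = 1 \<and>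
        (\<forall>b\<in>B. S e b \<noteq> 0 \<longrightarrow> norm (S e b) \<le> 1 \<and> (\<beta> e, b) \<in> r)) \<and>
     (\<forall>x. \<forall>e\<in>E. edge_diff x e = (\<Sum>b\<in>B. S e b * edge_diff x b)) \<and>
     (\<forall>\<zeta>. \<exists>x. \<forall>b\<in>B. edge_diff x b = \<zeta> b)"

lemma nbc_basis_expansion:
  assumes r: "linear_order_on E r" and E: "finite E" "\<And>e. e \<in> E \<Longrightarrow> card e = 2"
    and B: "nbc_basis E (graph_cycles E) r B"
  shows "\<exists>S \<beta>. nbc_expansion r E B S \<beta>"
proof -
  have BE: "B \<subseteq> E" and ind: "\<And>C. C \<in> graph_cycles E \<Longrightarrow> \<not> C \<subseteq> B"
    using B by (auto simp: nbc_basis_def basis_of_def independent_in_def)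
  have finB: "finite B" using BE E(1) finite_subset by blast
  define good where "good e s m \<longleftrightarrow> m \<in> B \<and> (m, e) \<in> r \<and> norm (s m) = 1 \<and>
     (\<forall>b\<in>B. s b \<noteq> 0 \<longrightarrow> norm (s b) \<le> 1 \<and> (m, b) \<in> r) \<and>
     (\<forall>x. edge_diff x e = (\<Sum>b\<in>B. s b * edge_diff x b))"
    for e m and s :: "nat set \<Rightarrow> complex"
  have "\<exists>s m. good e s m" if e: "e \<in> E - B" for e
  proof -
    obtain C m where C: "C \<in> graph_cycles E" "e \<in> C" "C \<subseteq> insert e B"
      and m: "m \<in> C" "m \<in> B" "\<And>f. f \<in> C \<Longrightarrow> (m, f) \<in> r"
      using nbc_basis_fundamental_circuit[OF r E(1) B e] by metis
    obtain vs where "distinct vs" "3 \<le> length vs" "C = cycle_edges vs"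
      using C(1) by (auto simp: graph_cycles_def)
    then obtain s where s: "\<And>f. f \<in> C \<Longrightarrow> s f = 1 \<or> s f = - 1"
      "\<And>x. (\<Sum>f\<in>C. s f * edge_diff x f) = 0"
      using cycle_edges_relation[of vs] by auto
    define s' where "s' b = (if b \<in> C then - s e * s b else 0)" for b
    have norm1: "norm (s f) = 1" if "f \<in> C" for f using s(1)[OF that] by auto
    have "edge_diff x e = (\<Sum>b\<in>B. s' b * edge_diff x b)" for x
    proof -
      have eB: "e \<notin> B" and finC: "finite C" using e C(3) finB finite_subset by auto
      have "(\<Sum>f\<in>C. s f * edge_diff x f) =
          s e * edge_diff x e + (\<Sum>f\<in>C - {e}. s f * edge_diff x f)"
        using finC C(2) by (rule sum.remove)
      then have "edge_diff x e = - s e * (\<Sum>f\<in>C - {e}. s f * edge_diff x f)"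
        using s(1)[OF C(2)] s(2)[of x] by (auto simp: add_eq_0_iff)
      also have "\<dots> = (\<Sum>b\<in>C - {e}. s' b * edge_diff x b)"
        by (simp add: s'_def sum_distrib_left mult.assoc)
      also have "\<dots> = (\<Sum>b\<in>B. s' b * edge_diff x b)"
        using finB C(3) eB by (intro sum.mono_neutral_left) (auto simp: s'_def)
      finally show ?thesis .
    qed
    then have "good e s' m"
      using m C(2) norm1 by (auto simp: good_def s'_def norm_mult)
    then show ?thesis by blast
  qed
  then obtain s \<beta> where good: "\<And>e. e \<in> E - B \<Longrightarrow> good e (s e) (\<beta> e)" by metis
  define S where "S e b = (if e \<in> B then of_bool (e = b) else s e b)" for e b
  have S: "S e = s e" if "e \<in> E - B" for e using that by (auto simp: S_def)
  have "edge_diff x e = (\<Sum>b\<in>B. S e b * edge_diff x b)" if "e \<in> E" for x e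
  proof (cases "e \<in> B")
    case True
    then show ?thesis using finB by (simp add: S_def)
  next
    case False
    then show ?thesis using good[of e] that S[of e] by (simp add: good_def)
  qed
  moreover have "graph_cycles B = {}"
  proof -
    have "C \<subseteq> B" if "C \<in> graph_cycles B" for C using that by (auto simp: graph_cycles_def)
    then show ?thesis using ind graph_cycles_mono[OF BE] by blast
  qed
  then have "\<exists>x. \<forall>b\<in>B. edge_diff x b = \<zeta> b" for \<zeta>
    using forest_edge_diff_surjective[of B \<zeta>] finB BE E(2) by blast
  moreover have "\<beta> e \<in> B \<and> (\<beta> e, e) \<in> r \<and> norm (S e (\<beta> e)) = 1 \<and>
        (\<forall>b\<in>B. S e b \<noteq> 0 \<longrightarrow> norm (S e b) \<le> 1 \<and> (\<beta> e, b) \<in> r)" if "e \<in> E - B" for e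
    using good[OF that] unfolding S[OF that] good_def by blast
  ultimately have "nbc_expansion r E B S \<beta>" unfolding nbc_expansion_def by (simp add: S_def)
  then show ?thesis by blast
qed

section \<open>The solution attached to a realisation basis\<close>

text \<open>The position in the order, which lets weights and recursions be indexed by natural numbers.\<close>

definition edge_rank :: "('e \<times> 'e) set \<Rightarrow> 'e set \<Rightarrow> 'e \<Rightarrow> nat" where
  "edge_rank r E e = card {f\<in>E. (f, e) \<in> r \<and> f \<noteq> e}"

lemma edge_rank_less_iff:
  assumes r: "linear_order_on E r" and "finite E" "e \<in> E" "f \<in> E"
  shows "edge_rank r E f < edge_rank r E e \<longleftrightarrow> (f, e) \<in> r \<and> f \<noteq> e"
proof -
  have r': "trans r" "antisym r" "total_on E r"
    using r by (auto simp: linear_order_on_def partial_order_on_def preorder_on_def)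
  have less: "edge_rank r E a < edge_rank r E b" if "(a, b) \<in> r" "a \<noteq> b" "a \<in> E" for a b
    unfolding edge_rank_def
  proof (rule psubset_card_mono)
    show "finite {f\<in>E. (f, b) \<in> r \<and> f \<noteq> b}" using assms(2) by simp
    have "{f\<in>E. (f, a) \<in> r \<and> f \<noteq> a} \<subseteq> {f\<in>E. (f, b) \<in> r \<and> f \<noteq> b}"
    proof safe
      fix x assume "(x, a) \<in> r" then show "(x, b) \<in> r" using that(1) r'(1) by (meson transD)
    next
      assume "(b, a) \<in> r" then show False using that(1,2) r'(2) by (meson antisymD)
    qed
    moreover have "a \<in> {f\<in>E. (f, b) \<in> r \<and> f \<noteq> b}" using that by simp
    ultimately show "{f\<in>E. (f, a) \<in> r \<and> f \<noteq> a} \<subset> {f\<in>E. (f, b) \<in> r \<and> f \<noteq> b}" by blast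
  qed
  show ?thesis
  proof
    assume lt: "edge_rank r E f < edge_rank r E e"
    then have "f \<noteq> e" by auto
    moreover have "(e, f) \<notin> r" using less[of e f] lt assms(3) \<open>f \<noteq> e\<close> by auto
    ultimately show "(f, e) \<in> r \<and> f \<noteq> e" using r'(3) assms(3,4) unfolding total_on_def by metis
  qed (use less assms in blast)
qed

lemma inj_on_edge_rank:
  assumes r: "linear_order_on E r" and "finite E"
  shows "inj_on (edge_rank r E) E"
proof (rule inj_onI, rule ccontr)
  fix e f assume ef: "e \<in> E" "f \<in> E" "edge_rank r E e = edge_rank r E f" "e \<noteq> f"
  then have "(e, f) \<in> r \<or> (f, e) \<in> r"
    using r by (auto simp: linear_order_on_def total_on_def)
  then show False
    using edge_rank_less_iff[OF assms ef(1,2)] edge_rank_less_iff[OF assms ef(2,1)] ef(3,4) by auto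
qed

text \<open>The edges at which \<open>d\<close> is much smaller than at all preceding edges. For the
  \<open>x\<close>-differences of the solutions constructed below this set is the realisation basis that they come
  from, so a solution remembers its basis.\<close>

definition sharp_drops :: "('e \<times> 'e) set \<Rightarrow> 'e set \<Rightarrow> ('e \<Rightarrow> complex) \<Rightarrow> 'e set" where
  "sharp_drops r E d =
     {e\<in>E. \<forall>f\<in>E. (f, e) \<in> r \<and> f \<noteq> e \<longrightarrow> 2 * norm (d e) < norm (d f)}"

lemma sharp_drops_cong:
  "(\<And>e. e \<in> E \<Longrightarrow> d e = d' e) \<Longrightarrow> sharp_drops r E d = sharp_drops r E d'"
  unfolding sharp_drops_def by auto

lemma sharp_drops_scale:
  assumes "c \<noteq> 0"
  shows "sharp_drops r E (\<lambda>e. c * d e) = sharp_drops r E d"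
proof -
  have "2 * norm (c * a) < norm (c * b) \<longleftrightarrow> 2 * norm a < norm b" for a b
  proof -
    have "2 * norm (c * a) < norm (c * b) \<longleftrightarrow> norm c * (2 * norm a) < norm c * norm b"
      by (simp add: norm_mult mult.left_commute)
    also have "\<dots> \<longleftrightarrow> 2 * norm a < norm b" using assms by (intro mult_less_cancel_left_pos) simp
    finally show ?thesis .
  qed
  then show ?thesis unfolding sharp_drops_def by simp
qed

text \<open>On the basis \<open>d\<close> decreases rapidly, and off the basis the value at \<open>e\<close> is of the same size as the
  value at the earlier basis edge \<open>\<beta> e\<close>, which prevents a drop at \<open>e\<close>.\<close>

lemma sharp_drops_eq_basis:
  assumes r: "linear_order_on E r" and BE: "B \<subseteq> E"
    and \<beta>: "\<And>e. e \<in> E - B \<Longrightarrow> \<beta> e \<in> B \<and> (\<beta> e, e) \<in> r"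
    and d: "\<And>e. e \<in> B \<Longrightarrow> 3/4 * Z e \<le> norm (d e) \<and> norm (d e) \<le> 5/4 * Z e"
      "\<And>e. e \<in> E - B \<Longrightarrow> 4/5 * Z (\<beta> e) \<le> norm (d e)"
    and Z: "\<And>e. e \<in> E \<Longrightarrow> (0::real) < Z e"
      "\<And>e f. e \<in> E \<Longrightarrow> f \<in> E \<Longrightarrow> (f, e) \<in> r \<Longrightarrow> f \<noteq> e \<Longrightarrow> Z e \<le> 1/4 * Z f"
  shows "sharp_drops r E d = B"
proof -
  have r': "trans r" "antisym r"
    using r by (auto simp: linear_order_on_def partial_order_on_def preorder_on_def)
  have "2 * norm (d e) < norm (d f)" if e: "e \<in> B" and f: "f \<in> E" "(f, e) \<in> r" "f \<noteq> e" for e f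
  proof -
    define b where "b = (if f \<in> B then f else \<beta> f)"
    have b: "b \<in> B" "(b, f) \<in> r \<or> b = f" using \<beta>[of f] f(1) by (auto simp: b_def)
    have "(b, e) \<in> r" using b(2) f(2) r'(1) by (meson transD)
    moreover have "b \<noteq> e" using b(2) f(2,3) r'(2) by (meson antisymD)
    ultimately have "Z e \<le> 1/4 * Z b" using Z(2) b(1) e BE by blast
    moreover have "3/4 * Z b \<le> norm (d f)"
      using d(1)[of f] d(2)[of f] Z(1)[of b] b(1) BE f(1) by (cases "f \<in> B") (auto simp: b_def)
    moreover have "0 < Z b" using Z(1) b(1) BE by auto
    ultimately show ?thesis using d(1)[OF e] by linarith
  qed
  moreover have "e \<notin> sharp_drops r E d" if e: "e \<in> E - B" for e
  proof -
    have "norm (d (\<beta> e)) \<le> 5/4 * Z (\<beta> e)" "4/5 * Z (\<beta> e) \<le> norm (d e)" "0 < Z (\<beta> e)"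
      using d \<beta>[OF e] e Z(1) BE by auto
    then have "\<not> 2 * norm (d e) < norm (d (\<beta> e))" by linarith
    moreover have "\<beta> e \<in> E" "\<beta> e \<noteq> e" "(\<beta> e, e) \<in> r" using \<beta>[OF e] e BE by auto
    ultimately show ?thesis unfolding sharp_drops_def by blast
  qed
  ultimately show ?thesis using BE unfolding sharp_drops_def by blast
qed

text \<open>The condition is open and does not mention a basis, so that one choice of \<open>l\<close> serves all realisation
  bases simultaneously.\<close>

definition rapidly_decreasing ::
    "('e \<times> 'e) set \<Rightarrow> 'e set \<Rightarrow> real \<Rightarrow> ('e \<Rightarrow> complex) \<Rightarrow> bool" where
  "rapidly_decreasing r E \<delta> l \<longleftrightarrow> (\<forall>e\<in>E. l e \<noteq> 0 \<and> (\<forall>f\<in>E. (f, e) \<in> r \<and> f \<noteq> e \<longrightarrow>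
      norm (l e / l (min_wrt r E)) < \<delta> * (norm (l f / l (min_wrt r E)))\<^sup>2))"

lemma realisation_basis_partition:
  assumes "linear_order_on E r" "finite E" "realisation_basis E (graph_cycles E) r B"
  defines "e0 \<equiv> min_wrt r E" and "B' \<equiv> (E - B) \<union> {min_wrt r E}"
  shows "E \<noteq> {}" "e0 \<in> B" "e0 \<in> E" "B \<subseteq> E" "B' \<subseteq> E" "B \<inter> B' = {e0}" "B \<union> B' = E"
    "nbc_basis E (graph_cycles E) r B" "nbc_basis E (graph_cycles E) r B'"
proof -
  show nbc: "nbc_basis E (graph_cycles E) r B" "nbc_basis E (graph_cycles E) r B'"
    using assms(3) by (auto simp: realisation_basis_def B'_def)
  then show BE: "B \<subseteq> E" "B' \<subseteq> E"
    by (auto simp: nbc_basis_def basis_of_def independent_in_def)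
  then show "E \<noteq> {}" by (auto simp: B'_def)
  then show e0: "e0 \<in> B" using nbc_basis_contains_min[OF assms(1,2) _ nbc(1)] by (simp add: e0_def)
  then show "e0 \<in> E" "B \<inter> B' = {e0}" "B \<union> B' = E" using BE by (auto simp: B'_def e0_def)
qed

text \<open>The unknowns are the differences of \<open>x\<close> along \<open>B\<close> and those of \<open>y\<close> along the complementary basis \<open>B'\<close>;
  with the difference of \<open>x\<close> along the least edge normalised to \<open>1\<close> there is one unknown and one equation
  for each other edge. An edge of \<open>B\<close> other than the least one is not in \<open>B'\<close>, so its \<open>y\<close>-difference is
  a combination of unknowns with leading term at an earlier edge, and symmetrically for the edges of
  \<open>B'\<close>. This is a triangular system in the sense above. By homogeneity in \<open>y\<close>, it is solved for the
  right-hand sides divided by the value at the least edge.\<close>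

theorem solution_of_realisation_basis:
  assumes r: "linear_order_on E r" and E: "finite E" "\<And>e. e \<in> E \<Longrightarrow> card e = 2"
    and B: "realisation_basis E (graph_cycles E) r B"
    and \<delta>: "0 < \<delta>" "\<delta> \<le> 1/4" "2 * real (card E) * \<delta> \<le> 1 / 4 ^ (card E + 1)"
    and l: "rapidly_decreasing r E \<delta> l"
  shows "\<exists>x y. edge_diff x (min_wrt r E) = 1 \<and> (\<forall>e\<in>E. edge_diff x e * edge_diff y e = l e) \<and>
     sharp_drops r E (edge_diff x) = B \<and>
     sharp_drops r E (edge_diff y) = (E - B) \<union> {min_wrt r E}"
proof -
  define e0 where "e0 = min_wrt r E"
  define B' where "B' = (E - B) \<union> {min_wrt r E}"
  note part = realisation_basis_partition[OF r E(1) B, folded B'_def e0_def]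
  obtain S \<beta> where "nbc_expansion r E B S \<beta>"
    using nbc_basis_expansion[OF r E part(8)] by blast
  note S = this[unfolded nbc_expansion_def]
  obtain S' \<beta>' where "nbc_expansion r E B' S' \<beta>'"
    using nbc_basis_expansion[OF r E part(9)] by blast
  note S' = this[unfolded nbc_expansion_def]
  define \<gamma> where "\<gamma> e = (if e \<in> B then \<beta>' e else \<beta> e)" for e
  define s where "s e b = (if e \<in> B then (if b \<in> B' then S' e b else 0)
    else (if b \<in> B then S e b else 0))" for e b
  define \<mu> where "\<mu> e = l e / l e0" for e
  have l_nz: "l e \<noteq> 0" if "e \<in> E" for e using l that by (simp add: rapidly_decreasing_def)
  have swap: "e \<in> E - B'" if "e \<in> E - {e0}" "e \<in> B" for e using that part by blast
  note rank = edge_rank_less_iff[OF r E(1)]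
  have expand: "\<gamma> e \<in> E \<and> \<gamma> e \<in> (if e \<in> B then B' else B) \<and> (\<gamma> e, e) \<in> r \<and> \<gamma> e \<noteq> e \<and> norm (s e (\<gamma> e)) = 1 \<and>
      (\<forall>b\<in>E. s e b \<noteq> 0 \<longrightarrow> norm (s e b) \<le> 1 \<and> (\<gamma> e, b) \<in> r)" if e: "e \<in> E - {e0}" for e
  proof (cases "e \<in> B")
    case True
    then have "\<beta>' e \<in> B' \<and> (\<beta>' e, e) \<in> r \<and> norm (S' e (\<beta>' e)) = 1 \<and>
        (\<forall>b\<in>B'. S' e b \<noteq> 0 \<longrightarrow> norm (S' e b) \<le> 1 \<and> (\<beta>' e, b) \<in> r)"
      using S' swap[OF e] by blast
    then show ?thesis using True swap[OF e] part(5) by (auto simp: \<gamma>_def s_def)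
  next
    case False
    then have "\<beta> e \<in> B \<and> (\<beta> e, e) \<in> r \<and> norm (S e (\<beta> e)) = 1 \<and>
        (\<forall>b\<in>B. S e b \<noteq> 0 \<longrightarrow> norm (S e b) \<le> 1 \<and> (\<beta> e, b) \<in> r)"
      using S e by blast
    then show ?thesis using False part(4) by (auto simp: \<gamma>_def s_def)
  qed
  have "\<exists>z Z. z e0 = 1 \<and> (\<forall>e\<in>E - {e0}. z e * (\<Sum>b\<in>E. s e b * z b) = \<mu> e) \<and>
     (\<forall>e\<in>E. Z e > 0 \<and> 3/4 * Z e \<le> norm (z e) \<and> norm (z e) \<le> 5/4 * Z e) \<and>
     (\<forall>e\<in>E. \<forall>f\<in>E. edge_rank r E f < edge_rank r E e \<longrightarrow> Z e \<le> \<delta> * Z f) \<and>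
     (\<forall>e\<in>E - {e0}. norm (\<mu> e) = Z e * Z (\<gamma> e))" (is "\<exists>z Z. ?P z Z")
  proof (rule triangular_system[where M = "card E"])
    show "finite E" "e0 \<in> E" "inj_on (edge_rank r E) E"
      using E(1) part(3) inj_on_edge_rank[OF r E(1)] by auto
    show "edge_rank r E e \<le> card E" for e
      unfolding edge_rank_def using E(1) by (intro card_mono) auto
    show "\<gamma> e \<in> E \<and> edge_rank r E (\<gamma> e) < edge_rank r E e \<and> norm (s e (\<gamma> e)) = 1" if "e \<in> E - {e0}" for e
      using expand[OF that] rank that by auto
    show "norm (s e b) \<le> 1 \<and> edge_rank r E (\<gamma> e) < edge_rank r E b"
      if "e \<in> E - {e0}" "b \<in> E" "b \<noteq> \<gamma> e" "s e b \<noteq> 0" for e b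
      using expand[OF that(1)] rank that by auto
    show "0 < \<delta>" "\<delta> \<le> 1" "2 * real (card E) * \<delta> \<le> 1 / 4 ^ (card E + 1)" using \<delta> by auto
    show "\<mu> e \<noteq> 0" if "e \<in> E" for e using l_nz that part(3) by (simp add: \<mu>_def)
    show "\<mu> e0 = 1" using l_nz part(3) by (simp add: \<mu>_def)
    show "norm (\<mu> e) \<le> \<delta> * (norm (\<mu> f))\<^sup>2"
      if "e \<in> E" "f \<in> E" "edge_rank r E f < edge_rank r E e" for e f
      using l that rank[OF that(1,2)] unfolding rapidly_decreasing_def \<mu>_def e0_def
      by (blast intro: less_imp_le)
  qed
  then obtain z where "\<exists>Z. ?P z Z" ..
  then obtain Z where zZ: "?P z Z" ..
  have z: "z e0 = 1" "\<And>e. e \<in> E - {e0} \<Longrightarrow> z e * (\<Sum>b\<in>E. s e b * z b) = \<mu> e"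
    using zZ[THEN conjunct1] bspec[OF zZ[THEN conjunct2, THEN conjunct1]] .
  have Z: "\<And>e. e \<in> E \<Longrightarrow> Z e > 0 \<and> 3/4 * Z e \<le> norm (z e) \<and> norm (z e) \<le> 5/4 * Z e"
      "\<And>e f. e \<in> E \<Longrightarrow> f \<in> E \<Longrightarrow> edge_rank r E f < edge_rank r E e \<Longrightarrow> Z e \<le> \<delta> * Z f"
      "\<And>e. e \<in> E - {e0} \<Longrightarrow> norm (\<mu> e) = Z e * Z (\<gamma> e)"
    using zZ[THEN conjunct2, THEN conjunct2] by simp_all
  obtain x where x: "\<And>b. b \<in> B \<Longrightarrow> edge_diff x b = z b" using S by blast
  have "\<exists>y. \<forall>b\<in>B'. edge_diff y b = l e0 * z b" using S'[THEN conjunct2, THEN conjunct2, THEN conjunct2]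
    by (rule spec)
  then obtain y where y: "\<And>b. b \<in> B' \<Longrightarrow> edge_diff y b = l e0 * z b" by blast
  have x_dep: "edge_diff x e = (\<Sum>b\<in>E. s e b * z b)" if e: "e \<in> E - B" for e
  proof -
    have "edge_diff x e = (\<Sum>b\<in>B. S e b * edge_diff x b)" using S e by blast
    also have "\<dots> = (\<Sum>b\<in>E. s e b * z b)"
      using part(4) E(1) e by (intro sum.mono_neutral_cong_left) (auto simp: s_def x)
    finally show ?thesis .
  qed
  have y_dep: "edge_diff y e = l e0 * (\<Sum>b\<in>E. s e b * z b)" if e: "e \<in> B - {e0}" for e
  proof -
    have "e \<in> E" using e part(4) by blast
    then have "edge_diff y e = (\<Sum>b\<in>B'. S' e b * edge_diff y b)" using S' by blast
    also have "\<dots> = (\<Sum>b\<in>B'. l e0 * (s e b * z b))"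
      using e by (intro sum.cong) (auto simp: s_def y)
    also have "\<dots> = (\<Sum>b\<in>E. l e0 * (s e b * z b))"
      using part(5) E(1) e by (intro sum.mono_neutral_left) (auto simp: s_def)
    finally show ?thesis by (simp add: sum_distrib_left)
  qed
  have prod: "edge_diff x e * edge_diff y e = l e" if e: "e \<in> E" for e
  proof -
    consider "e = e0" | "e \<in> B - {e0}" | "e \<in> E - B" using e by blast
    then show ?thesis
    proof cases
      case 1
      then show ?thesis using x[of e] y[of e] part(2,6) z(1) by auto
    next
      case 2
      then have "e \<in> E - {e0}" using part(4) by blast
      then have "l e0 * (z e * (\<Sum>b\<in>E. s e b * z b)) = l e"
        using z(2) l_nz[OF part(3)] by (simp add: \<mu>_def)
      then show ?thesis using 2 x[of e] y_dep[OF 2] by (simp add: mult.left_commute)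
    next
      case 3
      then have e': "e \<in> E - {e0}" "e \<in> B'" using part(2,7) by auto
      then have "l e0 * (z e * (\<Sum>b\<in>E. s e b * z b)) = l e"
        using z(2) l_nz[OF part(3)] by (simp add: \<mu>_def)
      then show ?thesis using y[OF e'(2)] x_dep[OF 3] by (simp add: mult_ac)
    qed
  qed
  have lower: "4/5 * Z (\<gamma> e) \<le> norm (\<Sum>b\<in>E. s e b * z b)" if e: "e \<in> E - {e0}" for e
  proof -
    have pos: "0 < Z e" "0 < Z (\<gamma> e)" "norm (z e) \<le> 5/4 * Z e" using Z(1) e expand[OF e] by auto
    have "Z e * Z (\<gamma> e) = norm (z e) * norm (\<Sum>b\<in>E. s e b * z b)"
      using Z(3)[OF e] z(2)[OF e] by (simp flip: norm_mult)
    also have "\<dots> \<le> 5/4 * Z e * norm (\<Sum>b\<in>E. s e b * z b)"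
      using pos by (intro mult_right_mono) auto
    finally have "Z e * Z (\<gamma> e) \<le> Z e * (5/4 * norm (\<Sum>b\<in>E. s e b * z b))" by simp
    then have "Z (\<gamma> e) \<le> 5/4 * norm (\<Sum>b\<in>E. s e b * z b)"
      using pos(1) by (simp only: mult_le_cancel_left_pos)
    then show ?thesis by simp
  qed
  have Z_drop: "Z e \<le> 1/4 * Z f" if "e \<in> E" "f \<in> E" "(f, e) \<in> r" "f \<noteq> e" for e f
  proof -
    have "Z e \<le> \<delta> * Z f" using Z(2) rank that by auto
    also have "\<dots> \<le> 1/4 * Z f" using \<delta> Z(1) that by (intro mult_right_mono) (auto intro: less_imp_le)
    finally show ?thesis .
  qed
  have "sharp_drops r E (edge_diff x) = B"
  proof (rule sharp_drops_eq_basis[OF r part(4), where \<beta> = \<gamma> and Z = Z])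
    fix e assume e: "e \<in> E - B"
    then have e': "e \<in> E - {e0}" using part(2) by blast
    show "\<gamma> e \<in> B \<and> (\<gamma> e, e) \<in> r" using expand[OF e'] e by auto
    show "4/5 * Z (\<gamma> e) \<le> norm (edge_diff x e)" using lower[OF e'] x_dep[OF e] by simp
  next
    show "3/4 * Z e \<le> norm (edge_diff x e) \<and> norm (edge_diff x e) \<le> 5/4 * Z e" if "e \<in> B" for e
      using Z(1)[of e] x[OF that] that part(4) by auto
  qed (use Z(1) Z_drop in auto)
  moreover have cancel: "inverse (l e0) * (l e0 * c) = c" for c
    using l_nz[OF part(3)] by (simp flip: mult.assoc)
  have "sharp_drops r E (\<lambda>e. inverse (l e0) * edge_diff y e) = B'"
  proof (rule sharp_drops_eq_basis[OF r part(5), where \<beta> = \<gamma> and Z = Z])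
    fix e assume e: "e \<in> E - B'"
    then have e': "e \<in> E - {e0}" "e \<in> B" "e \<in> B - {e0}" using part by blast+
    show "\<gamma> e \<in> B' \<and> (\<gamma> e, e) \<in> r" using expand[OF e'(1)] e' by auto
    show "4/5 * Z (\<gamma> e) \<le> norm (inverse (l e0) * edge_diff y e)"
      using lower[OF e'(1)] by (simp add: y_dep[OF e'(3)] cancel)
  next
    show "3/4 * Z e \<le> norm (inverse (l e0) * edge_diff y e) \<and>
        norm (inverse (l e0) * edge_diff y e) \<le> 5/4 * Z e" if "e \<in> B'" for e
      using Z(1)[of e] that part(5) by (auto simp: y cancel)
  qed (use Z(1) Z_drop in auto)
  then have "sharp_drops r E (edge_diff y) = B'"
    using sharp_drops_scale[of "inverse (l e0)" r E "edge_diff y"] l_nz[OF part(3)] by simp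
  moreover have "edge_diff x e0 = 1" using x part(2) z(1) by simp
  ultimately show ?thesis using prod unfolding B'_def e0_def by blast
qed

text \<open>The exponents \<open>3 ^ k - 1\<close> start at \<open>0\<close> and more than double from one rank to the next.\<close>

lemma rapidly_decreasing_exists:
  assumes r: "linear_order_on E r" and E: "finite E" "E \<noteq> {}" and \<delta>: "0 < \<delta>" "\<delta> < 1"
  shows "\<exists>l. rapidly_decreasing r E \<delta> l"
proof -
  define h :: "'a \<Rightarrow> nat" where "h e = 3 ^ edge_rank r E e - 1" for e
  define l where "l e = complex_of_real (\<delta> ^ h e)" for e
  have e0: "min_wrt r E \<in> E" "\<And>x. x \<in> E \<Longrightarrow> (min_wrt r E, x) \<in> r"
    using min_wrt_is_least[OF r E] by auto
  have "{f\<in>E. (f, min_wrt r E) \<in> r \<and> f \<noteq> min_wrt r E} = {}"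
    using e0 r by (auto simp: linear_order_on_def partial_order_on_def dest: antisymD)
  then have "edge_rank r E (min_wrt r E) = 0" unfolding edge_rank_def by (simp only: card.empty)
  then have "l (min_wrt r E) = 1" by (simp add: l_def h_def)
  moreover have "norm (l e) < \<delta> * (norm (l f))\<^sup>2"
    if "e \<in> E" "f \<in> E" "(f, e) \<in> r" "f \<noteq> e" for e f
  proof -
    have "edge_rank r E f < edge_rank r E e" using edge_rank_less_iff[OF r E(1)] that by blast
    then have "(3::nat) ^ Suc (edge_rank r E f) \<le> 3 ^ edge_rank r E e"
      by (intro power_increasing) auto
    moreover have "(3::nat) ^ edge_rank r E f \<ge> 1" by simp
    ultimately have "1 + 2 * h f < h e" unfolding h_def power_Suc by linarith
    then have "\<delta> ^ h e < \<delta> ^ (1 + 2 * h f)" using \<delta> by (intro power_strict_decreasing)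
    also have "\<dots> = \<delta> * (\<delta> ^ h f)\<^sup>2" by (simp add: power_mult mult.commute flip: power_mult)
    finally show ?thesis using \<delta> by (simp add: l_def norm_power)
  qed
  moreover have "l e \<noteq> 0" for e using \<delta> by (simp add: l_def)
  ultimately have "rapidly_decreasing r E \<delta> l" unfolding rapidly_decreasing_def by simp
  then show ?thesis by (rule exI[of _ l])
qed

section \<open>Congruence in isotropic coordinates\<close>

text \<open>Otherwise one connected component can be translated while the others stay fixed; distances between
  components cannot stay constant along the whole translation.\<close>

lemma rigid_framework_connected:
  fixes p :: "nat \<Rightarrow> real ^ 'd::finite"
  assumes rigid: "rigid_framework n E p" and i: "i \<in> {1..n}" and j: "j \<in> {1..n}"
  shows "(i, j) \<in> (adjacency E)\<^sup>*"
proof (rule ccontr)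
  assume not: "(i, j) \<notin> (adjacency E)\<^sup>*"
  define R where "R = {k. (i, k) \<in> (adjacency E)\<^sup>*}"
  have R: "i \<in> R" "j \<notin> R" using not by (auto simp: R_def)
  have R_edge: "k \<in> R \<longleftrightarrow> l \<in> R" if "{k, l} \<in> E" for k l
  proof -
    have "(k, l) \<in> adjacency E" "(l, k) \<in> adjacency E"
      using that by (auto simp: adjacency_def insert_commute)
    then show ?thesis unfolding R_def by (auto intro: rtrancl.rtrancl_into_rtrancl)
  qed
  define v :: "real ^ 'd" where "v = (\<chi> k. 1)"
  have "v \<noteq> 0" by (simp add: v_def vec_eq_iff)
  define \<gamma> where "\<gamma> t k = (if k \<in> R then p k + t *\<^sub>R v else p k)" for t k
  have "\<forall>k\<in>{1..n}. continuous_on {0..1} (\<lambda>t. \<gamma> t k)"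
  proof
    fix k
    show "continuous_on {0..1} (\<lambda>t. \<gamma> t k)"
      by (cases "k \<in> R") (auto simp: \<gamma>_def intro!: continuous_intros)
  qed
  moreover have "\<forall>k\<in>{1..n}. \<gamma> 0 k = p k" by (simp add: \<gamma>_def)
  moreover have "\<forall>t\<in>{0..1}. \<forall>k l. {k, l} \<in> E \<longrightarrow> dist (\<gamma> t k) (\<gamma> t l) = dist (p k) (p l)"
  proof (intro ballI allI impI)
    fix t k l assume "{k, l} \<in> E"
    then show "dist (\<gamma> t k) (\<gamma> t l) = dist (p k) (p l)"
      using R_edge[of k l] by (cases "k \<in> R") (auto simp: \<gamma>_def dist_norm)
  qed
  ultimately have "\<forall>t\<in>{0..1}. \<exists>T :: real ^ 'd \<Rightarrow> real ^ 'd.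
      (\<forall>x y. dist (T x) (T y) = dist x y) \<and> (\<forall>k\<in>{1..n}. \<gamma> t k = T (p k))"
    using rigid unfolding rigid_framework_def by (elim allE[of _ \<gamma>]) blast
  then have same: "dist (\<gamma> t i) (\<gamma> t j) = dist (p i) (p j)" if "t \<in> {0..1}" for t
    using that i j by metis
  define w where "w = p i - p j"
  have "norm (w + t *\<^sub>R v) = norm w" if "t \<in> {0..1}" for t
    using same[OF that] R by (simp add: \<gamma>_def dist_norm w_def algebra_simps)
  then have "(w + t *\<^sub>R v) \<bullet> (w + t *\<^sub>R v) = w \<bullet> w" if "t \<in> {0..1}" for t
    using that by (simp add: dot_square_norm)
  then have "2 * t * (w \<bullet> v) + t * t * (v \<bullet> v) = 0" if "t \<in> {0..1}" for t
    using that by (auto simp: inner_add_left inner_add_right inner_commute algebra_simps)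
  from this[of 1] this[of "1/2"] have "2 * (w \<bullet> v) + v \<bullet> v = 0" "w \<bullet> v + v \<bullet> v / 4 = 0"
    by simp_all
  then have "v \<bullet> v = 0" by linarith
  then show False using \<open>v \<noteq> 0\<close> by simp
qed

lemma equiv_congruence: "equiv (configurations n) (congruence n :: ((nat \<Rightarrow> complex ^ 'd::finite) \<times> _) set)"
proof (rule equivI)
  show "congruence n \<subseteq> configurations n \<times> (configurations n :: (nat \<Rightarrow> complex ^ 'd) set)"
    by (auto simp: congruence_def)
  show "refl_on (configurations n) (congruence n :: ((nat \<Rightarrow> complex ^ 'd) \<times> _) set)"
  proof (rule refl_onI)
    fix p :: "nat \<Rightarrow> complex ^ 'd" assume "p \<in> configurations n"
    moreover have "orthogonal_matrix (mat 1 :: complex ^ 'd ^ 'd)"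
      by (simp add: orthogonal_matrix_def transpose_mat)
    moreover have "p i = mat 1 *v p i + 0" for i by simp
    ultimately show "(p, p) \<in> congruence n" unfolding congruence_def by blast
  qed
  show "sym (congruence n :: ((nat \<Rightarrow> complex ^ 'd) \<times> _) set)"
  proof (rule symI)
    fix p q :: "nat \<Rightarrow> complex ^ 'd" assume "(p, q) \<in> congruence n"
    then obtain A x where A: "p \<in> configurations n" "q \<in> configurations n" "orthogonal_matrix A"
      "\<forall>i\<in>{1..n}. p i = A *v q i + x" by (auto simp: congruence_def)
    have "q i = transpose A *v p i + - (transpose A *v x)" if "i \<in> {1..n}" for i
      using A(3,4) that
      by (simp add: matrix_vector_right_distrib matrix_vector_mul_assoc orthogonal_matrix_def)
    moreover have "orthogonal_matrix (transpose A)"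
      using A(3) by (simp add: orthogonal_matrix_def)
    ultimately show "(q, p) \<in> congruence n" using A(1,2) unfolding congruence_def by blast
  qed
  show "trans (congruence n :: ((nat \<Rightarrow> complex ^ 'd) \<times> _) set)"
  proof (rule transI)
    fix p q s :: "nat \<Rightarrow> complex ^ 'd" assume "(p, q) \<in> congruence n" "(q, s) \<in> congruence n"
    then obtain A x where Ax: "p \<in> configurations n" "orthogonal_matrix A"
      "\<forall>i\<in>{1..n}. p i = A *v q i + x" unfolding congruence_def by blast
    obtain B y where By: "s \<in> configurations n" "orthogonal_matrix B"
      "\<forall>i\<in>{1..n}. q i = B *v s i + y"
      using \<open>(q, s) \<in> congruence n\<close> unfolding congruence_def by blast
    note A = Ax(1) By(1) Ax(2,3) By(2,3)
    have "p i = (A ** B) *v s i + (A *v y + x)" if "i \<in> {1..n}" for i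
      using A(4,6) that by (simp add: matrix_vector_right_distrib matrix_vector_mul_assoc)
    moreover have "orthogonal_matrix (A ** B)"
    proof -
      have "transpose (A ** B) ** (A ** B) = transpose B ** (transpose A ** A) ** B"
        "(A ** B) ** transpose (A ** B) = A ** (B ** transpose B) ** transpose A"
        by (simp_all add: matrix_transpose_mul matrix_mul_assoc)
      then show ?thesis using A(3,5) by (simp add: orthogonal_matrix_def)
    qed
    ultimately show "(p, s) \<in> congruence n" using A(1,2) unfolding congruence_def by blast
  qed
qed

text \<open>In the coordinates \<open>p\<^sub>1 \<plusminus> \<i> p\<^sub>2\<close> the quadratic form becomes a product, and the complex orthogonal group
  acts by scaling the two coordinates inversely to each other and by exchanging them.\<close>

definition xco :: "(nat \<Rightarrow> complex ^ 2) \<Rightarrow> nat \<Rightarrow> complex" where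
  "xco p i = p i $ 1 + \<i> * p i $ 2"

definition yco :: "(nat \<Rightarrow> complex ^ 2) \<Rightarrow> nat \<Rightarrow> complex" where
  "yco p i = p i $ 1 - \<i> * p i $ 2"

definition squared_length :: "(nat \<Rightarrow> complex ^ 2) \<Rightarrow> nat set \<Rightarrow> complex" where
  "squared_length p e = edge_diff (xco p) e * edge_diff (yco p) e"

lemma measurement_map_eq: "measurement_map E p = (\<lambda>e\<in>E. squared_length p e / 2)"
  unfolding measurement_map_def
proof (rule restrict_ext)
  fix e assume "e \<in> E"
  have "(a + \<i> * b - (c + \<i> * d)) * (a - \<i> * b - (c - \<i> * d)) = (c - a)\<^sup>2 + (d - b)\<^sup>2"
    for a b c d :: complex
    by (simp add: power2_eq_square algebra_simps)
  then show "1/2 * (\<Sum>k\<in>UNIV. (p (Min e) $ k - p (Max e) $ k)\<^sup>2) = squared_length p e / 2"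
    by (simp add: sum_2 squared_length_def edge_diff_def xco_def yco_def)
qed

lemma fibre_iff:
  "q \<in> fibre n E p \<longleftrightarrow> q \<in> configurations n \<and> (\<forall>e\<in>E. squared_length q e = squared_length p e)"
proof -
  have "measurement_map E q = measurement_map E p \<longleftrightarrow> (\<forall>e\<in>E. squared_length q e = squared_length p e)"
    unfolding measurement_map_eq restrict_def fun_eq_iff by auto
  then show ?thesis by (simp add: fibre_def)
qed

definition from_isotropic :: "nat \<Rightarrow> (nat \<Rightarrow> complex) \<Rightarrow> (nat \<Rightarrow> complex) \<Rightarrow> nat \<Rightarrow> complex ^ 2" where
  "from_isotropic n x y = (\<lambda>i\<in>{1..n}. vector [(x i + y i) / 2, (x i - y i) / (2 * \<i>)])"

lemma from_isotropic_configurations: "from_isotropic n x y \<in> configurations n"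
  by (simp add: from_isotropic_def configurations_def)

lemma coordinates_from_isotropic:
  assumes "i \<in> {1..n}"
  shows "xco (from_isotropic n x y) i = x i" "yco (from_isotropic n x y) i = y i"
  using assms by (auto simp: xco_def yco_def from_isotropic_def field_simps)

lemma edge_endpoints:
  fixes e :: "nat set"
  assumes "e \<subseteq> {1..n}" "card e = 2"
  shows "Min e \<in> {1..n}" "Max e \<in> {1..n}" "e = {Min e, Max e}"
proof -
  have e: "finite e" "e \<noteq> {}" using assms(2) card.infinite by fastforce+
  then show "Min e \<in> {1..n}" "Max e \<in> {1..n}" using assms(1) Min_in Max_in by blast+
  obtain a b where "e = {a, b}" using assms(2) by (auto simp: card_2_iff)
  then show "e = {Min e, Max e}" by (auto simp: min_def max_def)
qed

lemma edge_diff_from_isotropic: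
  assumes "e \<subseteq> {1..n}" "card e = 2"
  shows "edge_diff (xco (from_isotropic n x y)) e = edge_diff x e"
    "edge_diff (yco (from_isotropic n x y)) e = edge_diff y e"
  using edge_endpoints[OF assms] by (simp_all add: edge_diff_def coordinates_from_isotropic)

lemma orthogonal_matrix_2_cases:
  fixes A :: "complex ^ 2 ^ 2"
  assumes "orthogonal_matrix A"
  obtains "A $ 2 $ 1 = - A $ 1 $ 2" "A $ 2 $ 2 = A $ 1 $ 1" "(A $ 1 $ 1)\<^sup>2 + (A $ 1 $ 2)\<^sup>2 = 1"
  | "A $ 2 $ 1 = A $ 1 $ 2" "A $ 2 $ 2 = - A $ 1 $ 1" "(A $ 1 $ 1)\<^sup>2 + (A $ 1 $ 2)\<^sup>2 = 1"
proof -
  define a b c d where abcd: "a = A $ 1 $ 1" "b = A $ 1 $ 2" "c = A $ 2 $ 1" "d = A $ 2 $ 2"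
  have eqs: "a\<^sup>2 + c\<^sup>2 = 1" "b\<^sup>2 + d\<^sup>2 = 1" "a * b + c * d = 0" "a\<^sup>2 + b\<^sup>2 = 1"
    using assms unfolding orthogonal_matrix_def abcd
    by (auto simp: vec_eq_iff forall_2 matrix_matrix_mult_def transpose_def mat_def sum_2
        power2_eq_square)
  have "c\<^sup>2 = b\<^sup>2" using eqs(1,4) by (metis add_left_cancel)
  moreover have "d\<^sup>2 = a\<^sup>2" using eqs(2,4) by (metis add.commute add_left_cancel)
  ultimately have cd: "c = b \<or> c = - b" "d = a \<or> d = - a" by (simp_all add: power2_eq_iff)
  have "(c = - b \<and> d = a) \<or> (c = b \<and> d = - a)"
  proof (cases "c = b \<and> d = a \<or> c = - b \<and> d = - a")
    case True
    then have "2 * (a * b) = 0" using eqs(3) by auto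
    then have "a = 0 \<or> b = 0" by simp
    then show ?thesis using cd True by auto
  qed (use cd in auto)
  then show thesis using that eqs(4) unfolding abcd by blast
qed

text \<open>The first alternative is the case of determinant \<open>1\<close>, the second that of determinant \<open>-1\<close>.\<close>

lemma congruence_isotropic:
  assumes "(p, q) \<in> congruence n"
  shows "\<exists>s t. s * t = 1 \<and>
    ((\<forall>e. e \<subseteq> {1..n} \<and> card e = 2 \<longrightarrow> edge_diff (xco p) e = s * edge_diff (xco q) e \<and>
        edge_diff (yco p) e = t * edge_diff (yco q) e) \<or>
     (\<forall>e. e \<subseteq> {1..n} \<and> card e = 2 \<longrightarrow> edge_diff (xco p) e = s * edge_diff (yco q) e \<and>
        edge_diff (yco p) e = t * edge_diff (xco q) e))"
proof -
  obtain A v where A: "orthogonal_matrix A" and pq: "\<And>i. i \<in> {1..n} \<Longrightarrow> p i = A *v q i + v"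
    using assms by (auto simp: congruence_def)
  let ?a = "A $ 1 $ 1" and ?b = "A $ 1 $ 2"
  have p12: "p i $ 1 = ?a * q i $ 1 + ?b * q i $ 2 + v $ 1"
    "p i $ 2 = A $ 2 $ 1 * q i $ 1 + A $ 2 $ 2 * q i $ 2 + v $ 2" if "i \<in> {1..n}" for i
    using pq[OF that] by (simp_all add: matrix_vector_mult_def sum_2)
  show ?thesis
    using A
  proof (cases rule: orthogonal_matrix_2_cases)
    case 1
    have x: "xco p i = (?a - \<i> * ?b) * xco q i + (v $ 1 + \<i> * v $ 2)"
      and y: "yco p i = (?a + \<i> * ?b) * yco q i + (v $ 1 - \<i> * v $ 2)" if "i \<in> {1..n}" for i
      unfolding xco_def yco_def p12[OF that] 1(1,2) by (simp_all add: algebra_simps)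
    have "(?a - \<i> * ?b) * (?a + \<i> * ?b) = 1"
      using 1(3) by (simp add: power2_eq_square algebra_simps)
    moreover have "edge_diff (xco p) e = (?a - \<i> * ?b) * edge_diff (xco q) e \<and>
        edge_diff (yco p) e = (?a + \<i> * ?b) * edge_diff (yco q) e" if "e \<subseteq> {1..n}" "card e = 2" for e
      using edge_endpoints[OF that] unfolding edge_diff_def by (simp add: x y algebra_simps)
    ultimately show ?thesis by blast
  next
    case 2
    have x: "xco p i = (?a + \<i> * ?b) * yco q i + (v $ 1 + \<i> * v $ 2)"
      and y: "yco p i = (?a - \<i> * ?b) * xco q i + (v $ 1 - \<i> * v $ 2)" if "i \<in> {1..n}" for i
      unfolding xco_def yco_def p12[OF that] 2(1,2) by (simp_all add: algebra_simps)
    have "(?a + \<i> * ?b) * (?a - \<i> * ?b) = 1"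
      using 2(3) by (simp add: power2_eq_square algebra_simps)
    moreover have "edge_diff (xco p) e = (?a + \<i> * ?b) * edge_diff (yco q) e \<and>
        edge_diff (yco p) e = (?a - \<i> * ?b) * edge_diff (xco q) e" if "e \<subseteq> {1..n}" "card e = 2" for e
      using edge_endpoints[OF that] unfolding edge_diff_def by (simp add: x y algebra_simps)
    ultimately show ?thesis by blast
  qed
qed

text \<open>On a connected graph, differences along the edges determine a function up to a constant.\<close>

lemma proportional_on_connected:
  assumes conn: "\<And>i j. i \<in> {1..n} \<Longrightarrow> j \<in> {1..n} \<Longrightarrow> (i, j) \<in> (adjacency E)\<^sup>*"
    and E: "\<And>e. e \<in> E \<Longrightarrow> e \<subseteq> {1..n} \<and> card e = 2"
    and diff: "\<And>e. e \<in> E \<Longrightarrow> edge_diff x e = s * edge_diff x' e"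
  shows "\<exists>\<alpha>. \<forall>i\<in>{1..n}. x i = s * x' i + \<alpha>"
proof (cases "n = 0")
  case False
  have "x i - s * x' i = x 1 - s * x' 1" if "(1, i) \<in> (adjacency E)\<^sup>*" for i
    using that
  proof induction
    case (step j k)
    then have e: "{j, k} \<in> E" by (simp add: adjacency_def)
    then have "j \<noteq> k" using E by force
    then have "x j - s * x' j = x k - s * x' k"
      using diff[OF e] by (auto simp: edge_diff_doubleton algebra_simps split: if_splits)
    then show ?case using step by simp
  qed simp
  then have "x i = s * x' i + (x 1 - s * x' 1)" if "i \<in> {1..n}" for i
    using conn[of 1 i] that False by (simp add: algebra_simps)
  then show ?thesis by blast
qed simp

lemma congruence_of_proportional:
  assumes pq: "p \<in> configurations n" "q \<in> configurations n"
    and conn: "\<And>i j. i \<in> {1..n} \<Longrightarrow> j \<in> {1..n} \<Longrightarrow> (i, j) \<in> (adjacency E)\<^sup>*"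
    and E: "\<And>e. e \<in> E \<Longrightarrow> e \<subseteq> {1..n} \<and> card e = 2" and st: "s * t = 1"
    and x: "\<And>e. e \<in> E \<Longrightarrow> edge_diff (xco p) e = s * edge_diff (xco q) e"
    and y: "\<And>e. e \<in> E \<Longrightarrow> edge_diff (yco p) e = t * edge_diff (yco q) e"
  shows "(p, q) \<in> congruence n"
proof -
  obtain \<alpha> where \<alpha>: "\<And>i. i \<in> {1..n} \<Longrightarrow> xco p i = s * xco q i + \<alpha>"
    using proportional_on_connected[OF conn E x] by blast
  obtain \<beta> where \<beta>: "\<And>i. i \<in> {1..n} \<Longrightarrow> yco p i = t * yco q i + \<beta>"
    using proportional_on_connected[OF conn E y] by blast
  define a b where "a = (s + t) / 2" and "b = \<i> * (s - t) / 2"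
  have ab: "a - \<i> * b = s" "a + \<i> * b = t" by (simp_all add: a_def b_def field_simps)
  have "a * a + b * b = (a - \<i> * b) * (a + \<i> * b)" by (simp add: algebra_simps)
  then have one: "a * a + b * b = 1" using ab st by simp
  define A :: "complex ^ 2 ^ 2" where "A = vector [vector [a, b], vector [- b, a]]"
  define v :: "complex ^ 2" where "v = vector [(\<alpha> + \<beta>) / 2, (\<alpha> - \<beta>) / (2 * \<i>)]"
  have "orthogonal_matrix A"
    unfolding orthogonal_matrix_def A_def using one
    by (simp add: vec_eq_iff forall_2 matrix_matrix_mult_def transpose_def mat_def sum_2 algebra_simps)
  moreover have "p i = A *v q i + v" if i: "i \<in> {1..n}" for i
  proof -
    have p: "p i $ 1 = (xco p i + yco p i) / 2" "p i $ 2 = (xco p i - yco p i) / (2 * \<i>)"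
      by (simp_all add: xco_def yco_def)
    have "p i $ 1 = a * q i $ 1 + b * q i $ 2 + (\<alpha> + \<beta>) / 2"
      unfolding p \<alpha>[OF i] \<beta>[OF i] unfolding ab[symmetric] by (simp add: xco_def yco_def field_simps)
    moreover have "p i $ 2 = - b * q i $ 1 + a * q i $ 2 + (\<alpha> - \<beta>) / (2 * \<i>)"
      unfolding p \<alpha>[OF i] \<beta>[OF i] unfolding ab[symmetric] by (simp add: xco_def yco_def field_simps)
    ultimately show ?thesis
      by (simp add: vec_eq_iff forall_2 A_def v_def matrix_vector_mult_def sum_2)
  qed
  ultimately show ?thesis using pq unfolding congruence_def by blast
qed

section \<open>Generic configurations and the number of congruence classes\<close>

text \<open>The variables of the polynomial formulas below: \<open>Coord j i k\<close> is coordinate \<open>k\<close> of vertex \<open>i\<close> in the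
  \<open>j\<close>-th of several configurations, and \<open>Entry\<close> and \<open>Shift\<close> are the entries of a matrix and a
  translation vector. The configuration with number \<open>0\<close> is the parameter, the others are quantified.\<close>

datatype var = Coord nat nat "2" | Entry "2" "2" | Shift "2"

text \<open>The value \<open>0\<close> of the remaining variables is immaterial: the formulas quantify over them.\<close>

definition embed :: "nat \<Rightarrow> (nat \<Rightarrow> complex ^ 2) \<Rightarrow> var \<Rightarrow> complex" where
  "embed n p a = (case a of Coord j i k \<Rightarrow> if j = 0 \<and> i \<in> {1..n} then p i $ k else 0 | _ \<Rightarrow> 0)"

lemma poly_funs_embed:
  assumes "f \<in> poly_funs UNIV"
  shows "(\<lambda>p. f (embed n p)) \<in> polynomial_functions n"
  using assms
proof induction
  case (var a)
  show ?case
  proof (cases "\<exists>i k. i \<in> {1..n} \<and> a = Coord 0 i k")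
    case True
    then obtain i k where "i \<in> {1..n}" "a = Coord 0 i k" by blast
    then show ?thesis using polynomial_functions.coordinate[of i n k] by (simp add: embed_def)
  next
    case False
    then have "(\<lambda>p. embed n p a) = (\<lambda>p. 0)" by (cases a) (auto simp: embed_def fun_eq_iff)
    then show ?thesis using polynomial_functions.const[of 0 n] by simp
  qed
qed (auto intro: polynomial_functions.intros)

lemma polynomial_functions_from_poly_funs:
  assumes "f \<in> polynomial_functions n"
  shows "\<exists>g\<in>poly_funs UNIV. \<forall>p. f p = g (embed n p)"
  using assms
proof induction
  case (const c)
  show ?case by (rule bexI[of _ "\<lambda>v. c"]) (auto intro: poly_funs.const)
next
  case (coordinate i k)
  then show ?case
    by (intro bexI[of _ "\<lambda>v. v (Coord 0 i k)"]) (auto simp: embed_def intro: poly_funs.var)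
next
  case (add f g)
  then obtain f' g' where "f' \<in> poly_funs UNIV" "g' \<in> poly_funs UNIV"
    "\<forall>p. f p = f' (embed n p)" "\<forall>p. g p = g' (embed n p)" by blast
  then show ?case by (intro bexI[of _ "\<lambda>v. f' v + g' v"]) (auto intro: poly_funs.add)
next
  case (mult f g)
  then obtain f' g' where "f' \<in> poly_funs UNIV" "g' \<in> poly_funs UNIV"
    "\<forall>p. f p = f' (embed n p)" "\<forall>p. g p = g' (embed n p)" by blast
  then show ?case by (intro bexI[of _ "\<lambda>v. f' v * g' v"]) (auto intro: poly_funs.mult)
qed

lemma line_closed_embed: "line_closed (embed n ` configurations n)"
  unfolding line_closed_def
proof (intro ballI allI)
  fix a b and t :: complex
  assume "a \<in> embed n ` configurations n" "b \<in> embed n ` configurations n"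
  then obtain p q where pq: "a = embed n p" "b = embed n q" by blast
  define s where "s = (\<lambda>i\<in>{1..n}. p i + t *s (q i - p i))"
  have "a c + t * (b c - a c) = embed n s c" for c
    by (cases c) (auto simp: pq embed_def s_def right_diff_distrib)
  then have "(\<lambda>c. a c + t * (b c - a c)) = embed n s" by (simp add: fun_eq_iff)
  moreover have "s \<in> configurations n" by (simp add: s_def configurations_def)
  ultimately show "(\<lambda>c. a c + t * (b c - a c)) \<in> embed n ` configurations n" by simp
qed

text \<open>Truth on a non-empty principal open set, in the form in which it can be combined with predicates on
  assignments.\<close>

definition generically :: "nat \<Rightarrow> ((nat \<Rightarrow> complex ^ 2) \<Rightarrow> bool) \<Rightarrow> bool" where
  "generically n P \<longleftrightarrow> (\<exists>g\<in>poly_funs UNIV. (\<exists>p\<in>configurations n. g (embed n p) \<noteq> 0) \<and>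
     (\<forall>p\<in>configurations n. g (embed n p) \<noteq> 0 \<longrightarrow> P p))"

lemma genericallyI:
  assumes "g \<in> poly_funs UNIV" "p \<in> configurations n" "g (embed n p) \<noteq> 0"
    and "\<And>p. p \<in> configurations n \<Longrightarrow> g (embed n p) \<noteq> 0 \<Longrightarrow> P p"
  shows "generically n P"
  using assms unfolding generically_def by blast

lemma generically_conj:
  assumes "generically n P" "generically n Q"
  shows "generically n (\<lambda>p. P p \<and> Q p)"
proof -
  obtain g p where g: "g \<in> poly_funs UNIV" "p \<in> configurations n" "g (embed n p) \<noteq> 0"
    "\<And>p. p \<in> configurations n \<Longrightarrow> g (embed n p) \<noteq> 0 \<Longrightarrow> P p"
    using assms(1) unfolding generically_def by blast
  obtain h q where h: "h \<in> poly_funs UNIV" "q \<in> configurations n" "h (embed n q) \<noteq> 0"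
    "\<And>p. p \<in> configurations n \<Longrightarrow> h (embed n p) \<noteq> 0 \<Longrightarrow> Q p"
    using assms(2) unfolding generically_def by blast
  have "\<exists>v\<in>embed n ` configurations n. g v * h v \<noteq> 0"
    by (rule poly_funs_common_nonzero[OF g(1) h(1) line_closed_embed
          imageI[of p _ "embed n", OF g(2)] g(3) imageI[of q _ "embed n", OF h(2)] h(3)])
  then obtain s where "s \<in> configurations n" "g (embed n s) * h (embed n s) \<noteq> 0" by blast
  then show ?thesis
    using g(4) h(4) by (intro genericallyI[OF poly_funs.mult[OF g(1) h(1)]]) auto
qed

lemma generically_mono:
  assumes "generically n P" "\<And>p. p \<in> configurations n \<Longrightarrow> P p \<Longrightarrow> Q p"
  shows "generically n Q"
  using assms unfolding generically_def by blast

lemma generically_ex: "generically n P \<Longrightarrow> \<exists>p\<in>configurations n. P p"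
  unfolding generically_def by blast

lemma generically_iff_zariski_open:
  "generically n P \<longleftrightarrow> (\<exists>U. zariski_open n U \<and> U \<noteq> {} \<and> (\<forall>p\<in>U. P p))"
proof
  assume "generically n P"
  then obtain g p where g: "g \<in> poly_funs UNIV" "p \<in> configurations n" "g (embed n p) \<noteq> 0"
    "\<And>p. p \<in> configurations n \<Longrightarrow> g (embed n p) \<noteq> 0 \<Longrightarrow> P p"
    unfolding generically_def by blast
  let ?U = "{p \<in> configurations n. \<exists>f\<in>{\<lambda>p. g (embed n p)}. f p \<noteq> 0}"
  have "zariski_open n ?U"
    unfolding zariski_open_def using poly_funs_embed[OF g(1)]
    by (rule_tac exI[of _ "{\<lambda>p. g (embed n p)}"]) simp
  moreover have "?U \<noteq> {}" using g(2,3) by auto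
  moreover have "\<forall>p\<in>?U. P p" using g(4) by simp
  ultimately show "\<exists>U. zariski_open n U \<and> U \<noteq> {} \<and> (\<forall>p\<in>U. P p)"
    by (rule_tac exI[of _ ?U]) (simp only: simp_thms)
next
  assume "\<exists>U. zariski_open n U \<and> U \<noteq> {} \<and> (\<forall>p\<in>U. P p)"
  then obtain U where U: "zariski_open n U" "U \<noteq> {}" "\<forall>p\<in>U. P p" by blast
  obtain F where F: "F \<subseteq> polynomial_functions n" "U = {p \<in> configurations n. \<exists>f\<in>F. f p \<noteq> 0}"
    using U(1) unfolding zariski_open_def by blast
  obtain p f where p: "p \<in> configurations n" "f \<in> F" "f p \<noteq> 0" using U(2) F(2) by blast
  obtain g where g: "g \<in> poly_funs UNIV" "\<forall>p. f p = g (embed n p)"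
    using polynomial_functions_from_poly_funs[of f n] F(1) p(2) by blast
  show "generically n P"
  proof (rule genericallyI[OF g(1) p(1)])
    show "g (embed n p) \<noteq> 0" using g(2) p(3) by simp
    fix q assume q: "q \<in> configurations n" "g (embed n q) \<noteq> 0"
    then have "f q \<noteq> 0" using g(2) by simp
    then have "q \<in> U" unfolding F(2) using q(1) p(2) by blast
    then show "P q" using U(3) by blast
  qed
qed

lemma constructible_generically:
  assumes "constructible P"
  shows "generically n (\<lambda>p. P (embed n p)) \<or> generically n (\<lambda>p. \<not> P (embed n p))"
proof -
  have "(\<lambda>i\<in>{1..n}. 0) \<in> (configurations n :: (nat \<Rightarrow> complex ^ 2) set)"
    by (simp add: configurations_def)
  then have "embed n ` configurations n \<noteq> {}" by blast
  from constructible_generic[OF assms line_closed_embed this]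
  obtain g where g: "g \<in> poly_funs UNIV" and g': "(\<exists>v\<in>embed n ` configurations n. g v \<noteq> 0) \<and>
    ((\<forall>v\<in>embed n ` configurations n. g v \<noteq> 0 \<longrightarrow> P v) \<or>
      (\<forall>v\<in>embed n ` configurations n. g v \<noteq> 0 \<longrightarrow> \<not> P v))" by (rule bexE)
  obtain p where p: "p \<in> configurations n" "g (embed n p) \<noteq> 0" using g'[THEN conjunct1] by blast
  from g'[THEN conjunct2] show ?thesis
  proof
    assume *: "\<forall>v\<in>embed n ` configurations n. g v \<noteq> 0 \<longrightarrow> P v"
    have "generically n (\<lambda>p. P (embed n p))"
      by (rule genericallyI[OF g p]) (simp add: *)
    then show ?thesis ..
  next
    assume *: "\<forall>v\<in>embed n ` configurations n. g v \<noteq> 0 \<longrightarrow> \<not> P v"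
    have "generically n (\<lambda>p. \<not> P (embed n p))"
      by (rule genericallyI[OF g p]) (simp add: *)
    then show ?thesis ..
  qed
qed

text \<open>The quotient contains at least \<open>m\<close> classes, stated through representatives so that it is a
  first-order formula in the coordinates. Infinite quotients are included.\<close>

definition many_classes :: "nat \<Rightarrow> nat set set \<Rightarrow> nat \<Rightarrow> (nat \<Rightarrow> complex ^ 2) \<Rightarrow> bool" where
  "many_classes n E m p \<longleftrightarrow> (\<exists>q. (\<forall>j\<in>{1..m}. q j \<in> fibre n E p) \<and>
     (\<forall>j\<in>{1..m}. \<forall>l\<in>{1..m}. j < l \<longrightarrow> (q j, q l) \<notin> congruence n))"

lemma many_classes_iff:
  "many_classes n E m p \<longleftrightarrow> (\<exists>T. T \<subseteq> fibre n E p // congruence n \<and> finite T \<and> card T = m)"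
proof
  assume "many_classes n E m p"
  then obtain q where q: "\<And>j. j \<in> {1..m} \<Longrightarrow> q j \<in> fibre n E p"
    "\<And>j l. j \<in> {1..m} \<Longrightarrow> l \<in> {1..m} \<Longrightarrow> j < l \<Longrightarrow> (q j, q l) \<notin> congruence n"
    unfolding many_classes_def by blast
  let ?c = "\<lambda>j. congruence n `` {q j}"
  have conf: "q j \<in> configurations n" if "j \<in> {1..m}" for j using q(1)[OF that] by (simp add: fibre_def)
  have "?c j \<noteq> ?c l" if "j \<in> {1..m}" "l \<in> {1..m}" "j < l" for j l
    using q(2)[OF that] eq_equiv_class_iff[OF equiv_congruence conf[OF that(1)] conf[OF that(2)]] by blast
  then have "inj_on ?c {1..m}" by (intro linorder_inj_onI) auto
  then have "card (?c ` {1..m}) = m" by (simp add: card_image)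
  moreover have "?c ` {1..m} \<subseteq> fibre n E p // congruence n" using q(1) by (auto intro: quotientI)
  ultimately show "\<exists>T. T \<subseteq> fibre n E p // congruence n \<and> finite T \<and> card T = m"
    by (intro exI[of _ "?c ` {1..m}"]) simp
next
  assume "\<exists>T. T \<subseteq> fibre n E p // congruence n \<and> finite T \<and> card T = m"
  then obtain T where T: "T \<subseteq> fibre n E p // congruence n" "finite T" "card T = m" by blast
  obtain h where h: "bij_betw h {1..m} T"
    using finite_same_card_bij[of "{1..m}" T] T by auto
  have "\<forall>j\<in>{1..m}. \<exists>x. x \<in> fibre n E p \<and> h j = congruence n `` {x}"
    using h T(1) by (auto simp: bij_betw_def elim!: quotientE dest!: subsetD)
  then obtain q where q: "\<And>j. j \<in> {1..m} \<Longrightarrow> q j \<in> fibre n E p \<and> h j = congruence n `` {q j}"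
    by metis
  have "(q j, q l) \<notin> congruence n" if "j \<in> {1..m}" "l \<in> {1..m}" "j < l" for j l
  proof
    assume "(q j, q l) \<in> congruence n"
    then have "h j = h l" using equiv_class_eq[OF equiv_congruence] q that by metis
    then show False using h that by (auto simp: bij_betw_def dest: inj_onD)
  qed
  then show "many_classes n E m p" using q unfolding many_classes_def by blast
qed

lemma number_of_classes:
  assumes "many_classes n E m p" "\<not> many_classes n E (Suc m) p"
  shows "finite (fibre n E p // congruence n) \<and> card (fibre n E p // congruence n) = m"
proof -
  let ?X = "fibre n E p // congruence n"
  obtain T where T: "T \<subseteq> ?X" "finite T" "card T = m" using assms(1) many_classes_iff by blast
  have no: "\<not> (\<exists>T. T \<subseteq> ?X \<and> finite T \<and> card T = Suc m)" using assms(2) many_classes_iff by blast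
  have fin: "finite ?X" using no infinite_arbitrarily_large by blast
  have "\<not> Suc m \<le> card ?X" using no obtain_subset_with_card_n[of "Suc m" ?X] by metis
  moreover have "m \<le> card ?X" using T card_mono[OF fin T(1)] by simp
  ultimately show ?thesis using fin by simp
qed

definition conf_of :: "nat \<Rightarrow> nat \<Rightarrow> (var \<Rightarrow> complex) \<Rightarrow> nat \<Rightarrow> complex ^ 2" where
  "conf_of n j v = (\<lambda>i\<in>{1..n}. \<chi> k. v (Coord j i k))"

lemma conf_of_configurations: "conf_of n j v \<in> configurations n"
  by (simp add: conf_of_def configurations_def)

lemma conf_of_embed:
  assumes "p \<in> configurations n"
  shows "conf_of n 0 (embed n p) = p"
proof
  fix i
  show "conf_of n 0 (embed n p) i = p i"
  proof (cases "i \<in> {1..n}")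
    case True
    then show ?thesis by (simp add: conf_of_def embed_def vec_eq_iff)
  next
    case False
    then have "conf_of n 0 (embed n p) i = undefined" unfolding conf_of_def by (simp only: restrict_apply if_False)
    then show ?thesis using PiE_arb[OF assms[unfolded configurations_def] False] by (simp only:)
  qed
qed

lemma poly_funs_squared_length:
  assumes "e \<subseteq> {1..n}" "card e = 2"
  shows "(\<lambda>v. squared_length (conf_of n j v) e) \<in> poly_funs UNIV"
proof -
  have "(\<lambda>v. squared_length (conf_of n j v) e) = (\<lambda>v.
      (v (Coord j (Max e) 1) + \<i> * v (Coord j (Max e) 2) - (v (Coord j (Min e) 1) + \<i> * v (Coord j (Min e) 2))) *
      (v (Coord j (Max e) 1) - \<i> * v (Coord j (Max e) 2) - (v (Coord j (Min e) 1) - \<i> * v (Coord j (Min e) 2))))"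
    using edge_endpoints[OF assms]
    by (simp add: squared_length_def edge_diff_def xco_def yco_def conf_of_def)
  also have "\<dots> \<in> poly_funs UNIV"
    by (intro poly_funs.mult poly_funs.add poly_funs_diff poly_funs.var poly_funs.const UNIV_I)
  finally show ?thesis .
qed

text \<open>The entries of the matrix and of the translation are eliminated by quantifier elimination.\<close>

lemma constructible_congruence:
  "constructible (\<lambda>v. (conf_of n j v, conf_of n l v) \<in> congruence n)"
proof -
  let ?A = "range (\<lambda>(a, b). Entry a b) \<union> range Shift"
  let ?body = "\<lambda>w. (\<forall>(a, b)\<in>(UNIV :: (2 \<times> 2) set).
        (\<Sum>c\<in>UNIV. w (Entry c a) * w (Entry c b)) = of_bool (a = b) \<and>
        (\<Sum>c\<in>UNIV. w (Entry a c) * w (Entry b c)) = of_bool (a = b)) \<and>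
      (\<forall>(i, k)\<in>{1..n} \<times> (UNIV :: 2 set).
        w (Coord j i k) = (\<Sum>b\<in>UNIV. w (Entry k b) * w (Coord l i b)) + w (Shift k))"
  have "constructible ?body"
    unfolding case_prod_unfold
    by (intro constructible.conj constructible_ball constructible_eq poly_funs.add poly_funs_sum
        poly_funs.mult poly_funs.var poly_funs.const UNIV_I finite_cartesian_product) simp_all
  moreover have "finite ?A" by simp
  ultimately have "constructible (\<lambda>v. \<exists>w. (\<forall>a. a \<notin> ?A \<longrightarrow> w a = v a) \<and> ?body w)"
    by (rule constructible_ex_finite[rotated])
  moreover have "(\<exists>w. (\<forall>a. a \<notin> ?A \<longrightarrow> w a = v a) \<and> ?body w) \<longleftrightarrow>
      (conf_of n j v, conf_of n l v) \<in> congruence n" for v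
  proof
    assume "\<exists>w. (\<forall>a. a \<notin> ?A \<longrightarrow> w a = v a) \<and> ?body w"
    then obtain w where w: "\<And>a. a \<notin> ?A \<Longrightarrow> w a = v a" and body: "?body w" by blast
    have wv: "w (Coord j i k) = v (Coord j i k)" for j i k by (rule w) auto
    define M :: "complex ^ 2 ^ 2" where "M = (\<chi> a b. w (Entry a b))"
    have "orthogonal_matrix M"
      using body by (simp add: orthogonal_matrix_def M_def vec_eq_iff matrix_matrix_mult_def
          transpose_def mat_def of_bool_def)
    moreover have "conf_of n j v i = M *v conf_of n l v i + (\<chi> k. w (Shift k))" if "i \<in> {1..n}" for i
      using body that by (simp add: conf_of_def M_def vec_eq_iff matrix_vector_mult_def wv)
    ultimately show "(conf_of n j v, conf_of n l v) \<in> congruence n"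
      unfolding congruence_def using conf_of_configurations by blast
  next
    assume "(conf_of n j v, conf_of n l v) \<in> congruence n"
    then obtain M :: "complex ^ 2 ^ 2" and x where M: "orthogonal_matrix M"
      "\<And>i. i \<in> {1..n} \<Longrightarrow> conf_of n j v i = M *v conf_of n l v i + x"
      unfolding congruence_def by blast
    define w where "w a = (case a of Coord j i k \<Rightarrow> v a | Entry b c \<Rightarrow> M $ b $ c | Shift k \<Rightarrow> x $ k)" for a
    have "w a = v a" if "a \<notin> ?A" for a
      using that by (cases a) (auto simp: w_def)
    moreover have "?body w"
    proof (intro conjI ballI)
      fix ab :: "2 \<times> 2"
      show "case ab of (a, b) \<Rightarrow> (\<Sum>c\<in>UNIV. w (Entry c a) * w (Entry c b)) = of_bool (a = b) \<and>
        (\<Sum>c\<in>UNIV. w (Entry a c) * w (Entry b c)) = of_bool (a = b)"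
        using M(1) by (cases ab) (simp add: orthogonal_matrix_def w_def vec_eq_iff matrix_matrix_mult_def
          transpose_def mat_def of_bool_def)
    next
      fix ik :: "nat \<times> 2" assume "ik \<in> {1..n} \<times> UNIV"
      then show "case ik of (i, k) \<Rightarrow>
          w (Coord j i k) = (\<Sum>b\<in>UNIV. w (Entry k b) * w (Coord l i b)) + w (Shift k)"
        using M(2) by (cases ik) (simp add: conf_of_def w_def vec_eq_iff matrix_vector_mult_def)
    qed
    ultimately show "\<exists>w. (\<forall>a. a \<notin> ?A \<longrightarrow> w a = v a) \<and> ?body w" by (intro exI[of _ w]) blast
  qed
  ultimately show ?thesis by (simp only:)
qed

text \<open>Quantifier elimination again, now for the coordinates of the \<open>m\<close> representatives.\<close>

lemma constructible_many_classes:
  assumes E: "finite E" "\<And>e. e \<in> E \<Longrightarrow> e \<subseteq> {1..n} \<and> card e = 2"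
  shows "\<exists>P. constructible P \<and> (\<forall>p\<in>configurations n. P (embed n p) \<longleftrightarrow> many_classes n E m p)"
proof -
  let ?A = "(\<lambda>(j, i, k). Coord j i k) ` ({1..m} \<times> {1..n} \<times> UNIV)"
  let ?body = "\<lambda>w. (\<forall>(j, e)\<in>{1..m} \<times> E.
        squared_length (conf_of n j w) e = squared_length (conf_of n 0 w) e) \<and>
      (\<forall>(j, l)\<in>{(j, l) \<in> {1..m} \<times> {1..m}. j < l}. (conf_of n j w, conf_of n l w) \<notin> congruence n)"
  let ?P = "\<lambda>v. \<exists>w. (\<forall>a. a \<notin> ?A \<longrightarrow> w a = v a) \<and> ?body w"
  have "finite {(j, l) \<in> {1..m} \<times> {1..m}. j < l}"
    by (rule finite_subset[of _ "{1..m} \<times> {1..m}"]) auto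
  moreover have "snd je \<subseteq> {1..n}" "card (snd je) = 2" if "je \<in> {1..m} \<times> E" for je
    using E(2) that by (metis mem_Times_iff)+
  ultimately have "constructible ?body"
    unfolding case_prod_unfold using E(1)
    by (intro constructible.conj constructible_ball constructible_eq constructible.neg
        constructible_congruence poly_funs_squared_length finite_cartesian_product) simp_all
  moreover have "finite ?A" by simp
  ultimately have "constructible ?P" by (rule constructible_ex_finite[rotated])
  moreover have "?P (embed n p) \<longleftrightarrow> many_classes n E m p" if p: "p \<in> configurations n" for p
  proof
    assume "?P (embed n p)"
    then obtain w where w: "\<And>a. a \<notin> ?A \<Longrightarrow> w a = embed n p a" and body: "?body w" by blast
    have "w (Coord 0 i k) = embed n p (Coord 0 i k)" for i k by (rule w) auto
    then have "conf_of n 0 w = conf_of n 0 (embed n p)" by (simp add: conf_of_def)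
    then have w0: "conf_of n 0 w = p" using conf_of_embed[OF p] by simp
    have "conf_of n j w \<in> fibre n E p" if "j \<in> {1..m}" for j
      using body that w0 conf_of_configurations by (auto simp: fibre_iff)
    moreover have "(conf_of n j w, conf_of n l w) \<notin> congruence n"
      if "j \<in> {1..m}" "l \<in> {1..m}" "j < l" for j l
      using bspec[OF body[THEN conjunct2], of "(j, l)"] that by simp
    ultimately show "many_classes n E m p" unfolding many_classes_def
      by (intro exI[of _ "\<lambda>j. conf_of n j w"] conjI ballI impI)
  next
    assume "many_classes n E m p"
    then obtain q where q: "\<And>j. j \<in> {1..m} \<Longrightarrow> q j \<in> fibre n E p"
      "\<And>j l. j \<in> {1..m} \<Longrightarrow> l \<in> {1..m} \<Longrightarrow> j < l \<Longrightarrow> (q j, q l) \<notin> congruence n"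
      unfolding many_classes_def by blast
    define w where "w a = (case a of Coord j i k \<Rightarrow>
        if j \<in> {1..m} \<and> i \<in> {1..n} then q j i $ k else embed n p a | _ \<Rightarrow> embed n p a)" for a
    have outside: "\<forall>a. a \<notin> ?A \<longrightarrow> w a = embed n p a"
    proof (intro allI impI)
      fix a assume "a \<notin> ?A"
      then show "w a = embed n p a" by (cases a) (auto simp: w_def image_iff)
    qed
    have wq: "conf_of n j w = q j" if j: "j \<in> {1..m}" for j
    proof
      fix i
      have conf: "q j \<in> configurations n" using q(1)[OF j] by (simp add: fibre_def)
      show "conf_of n j w i = q j i"
      proof (cases "i \<in> {1..n}")
        case True
        then show ?thesis using j by (simp add: conf_of_def w_def vec_eq_iff)
      next
        case False
        then have "conf_of n j w i = undefined" unfolding conf_of_def by (simp only: restrict_apply if_False)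
        then show ?thesis using PiE_arb[OF conf[unfolded configurations_def] False] by (simp only:)
      qed
    qed
    have w0: "conf_of n 0 w = p"
    proof -
      have "conf_of n 0 w = conf_of n 0 (embed n p)" by (simp add: conf_of_def w_def)
      then show ?thesis using conf_of_embed[OF p] by simp
    qed
    have inside: "?body w"
    proof (intro conjI ballI)
      fix je assume "je \<in> {1..m} \<times> E"
      then show "case je of (j, e) \<Rightarrow> squared_length (conf_of n j w) e = squared_length (conf_of n 0 w) e"
        using q(1) wq w0 by (auto simp: fibre_iff)
    next
      fix jl assume "jl \<in> {(j, l) \<in> {1..m} \<times> {1..m}. j < l}"
      then show "case jl of (j, l) \<Rightarrow> (conf_of n j w, conf_of n l w) \<notin> congruence n"
        using q(2) wq by auto
    qed
    show "?P (embed n p)" by (rule exI[of _ w], rule conjI[OF outside inside])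
  qed
  ultimately show ?thesis by (intro exI[of _ ?P] conjI ballI)
qed

section \<open>The realisation number and the bound\<close>

text \<open>Finitely many strict inequalities between continuous functions persist under small changes.\<close>

lemma rapidly_decreasing_eventually:
  assumes E: "finite E" "min_wrt r E \<in> E" and l: "rapidly_decreasing r E \<delta> l"
    and lim: "\<And>e. e \<in> E \<Longrightarrow> ((\<lambda>t. c t e) \<longlongrightarrow> l e) F"
  shows "eventually (\<lambda>t. rapidly_decreasing r E \<delta> (c t)) F"
proof -
  let ?e0 = "min_wrt r E"
  have nz: "l e \<noteq> 0" if "e \<in> E" for e using l that by (simp add: rapidly_decreasing_def)
  have ratio: "((\<lambda>t. norm (c t e / c t ?e0)) \<longlongrightarrow> norm (l e / l ?e0)) F" if "e \<in> E" for e
    using nz[OF E(2)] by (intro tendsto_norm tendsto_divide lim that E(2))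
  have "eventually (\<lambda>t. \<forall>f\<in>E. (f, e) \<in> r \<and> f \<noteq> e \<longrightarrow>
      norm (c t e / c t ?e0) < \<delta> * (norm (c t f / c t ?e0))\<^sup>2) F" if e: "e \<in> E" for e
  proof (rule eventually_ball_finite[OF E(1)], rule ballI)
    fix f assume f: "f \<in> E"
    show "eventually (\<lambda>t. (f, e) \<in> r \<and> f \<noteq> e \<longrightarrow>
      norm (c t e / c t ?e0) < \<delta> * (norm (c t f / c t ?e0))\<^sup>2) F"
    proof (cases "(f, e) \<in> r \<and> f \<noteq> e")
      case True
      then have "0 < \<delta> * (norm (l f / l ?e0))\<^sup>2 - norm (l e / l ?e0)"
        using l e f unfolding rapidly_decreasing_def by auto
      moreover have "((\<lambda>t. \<delta> * (norm (c t f / c t ?e0))\<^sup>2 - norm (c t e / c t ?e0)) \<longlongrightarrow>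
          \<delta> * (norm (l f / l ?e0))\<^sup>2 - norm (l e / l ?e0)) F"
        by (intro tendsto_intros ratio e f)
      ultimately have "eventually (\<lambda>t. 0 < \<delta> * (norm (c t f / c t ?e0))\<^sup>2 - norm (c t e / c t ?e0)) F"
        by (rule order_tendstoD(1)[rotated])
      then show ?thesis by eventually_elim auto
    next
      case False
      then show ?thesis by (intro always_eventually) blast
    qed
  qed
  moreover have "eventually (\<lambda>t. c t e \<noteq> 0) F" if "e \<in> E" for e
    using tendsto_imp_eventually_ne[OF lim[OF that] nz[OF that]] .
  ultimately have "eventually (\<lambda>t. c t e \<noteq> 0 \<and> (\<forall>f\<in>E. (f, e) \<in> r \<and> f \<noteq> e \<longrightarrow>
      norm (c t e / c t ?e0) < \<delta> * (norm (c t f / c t ?e0))\<^sup>2)) F" if "e \<in> E" for e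
    using that by (intro eventually_conj)
  then show ?thesis
    unfolding rapidly_decreasing_def by (intro eventually_ball_finite[OF E(1)] ballI)
qed

text \<open>Rigidity of the graph makes it connected. One realisation basis \<open>B\<close> is fixed; together with the
  complementary basis it shows that the graph has as many edges as normalised realisations have degrees of
  freedom.\<close>

locale realisable_graph =
  fixes n :: nat and E :: "nat set set" and r :: "(nat set \<times> nat set) set" and B :: "nat set set"
  assumes graph: "simple_graph n E" and order: "linear_order_on E r"
    and basis: "realisation_basis E (graph_cycles E) r B"
    and connected: "\<And>i j. i \<in> {1..n} \<Longrightarrow> j \<in> {1..n} \<Longrightarrow> (i, j) \<in> (adjacency E)\<^sup>*"
begin

lemma edges: "e \<in> E \<Longrightarrow> e \<subseteq> {1..n}" "e \<in> E \<Longrightarrow> card e = 2"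
  using graph by (auto simp: simple_graph_def)

lemma finite_E: "finite E"
  using edges(1) by (intro finite_subset[of E "Pow {1..n}"]) auto

definition "e0 = min_wrt r E"

definition "B' = (E - B) \<union> {min_wrt r E}"

lemmas partition = realisation_basis_partition[OF order finite_E basis, folded B'_def e0_def]

lemma e0_in_E: "e0 \<in> E"
  using partition(3) .

text \<open>Small enough for the contraction and for reading off the basis from the drops.\<close>

definition \<delta> :: real where
  "\<delta> = 1 / (2 * real (card E) * 4 ^ (card E + 1))"

lemma \<delta>_bounds: "0 < \<delta>" "\<delta> \<le> 1/4" "2 * real (card E) * \<delta> \<le> 1 / 4 ^ (card E + 1)"
proof -
  have card: "real (card E) \<ge> 1" using partition(3) finite_E by (simp add: Suc_le_eq card_gt_0_iff) auto
  then show "0 < \<delta>" by (simp add: \<delta>_def)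
  have "(4::real) ^ 1 \<le> 4 ^ (card E + 1)" by (intro power_increasing) auto
  then have "1 * 4 \<le> 2 * real (card E) * 4 ^ (card E + 1)"
    using card by (intro mult_mono) auto
  then show "\<delta> \<le> 1/4" by (simp add: \<delta>_def field_simps)
  show "2 * real (card E) * \<delta> \<le> 1 / 4 ^ (card E + 1)" using card by (simp add: \<delta>_def)
qed

lemma realisation_of_basis:
  assumes "realisation_basis E (graph_cycles E) r C" "rapidly_decreasing r E \<delta> l"
  shows "\<exists>q\<in>configurations n. (\<forall>e\<in>E. squared_length q e = l e) \<and>
     sharp_drops r E (edge_diff (xco q)) = C \<and>
     sharp_drops r E (edge_diff (yco q)) = (E - C) \<union> {min_wrt r E}"
proof -
  obtain x y where xy: "\<forall>e\<in>E. edge_diff x e * edge_diff y e = l e"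
    "sharp_drops r E (edge_diff x) = C" "sharp_drops r E (edge_diff y) = (E - C) \<union> {min_wrt r E}"
    using solution_of_realisation_basis[OF order finite_E edges(2) assms(1) \<delta>_bounds assms(2)] by blast
  let ?q = "from_isotropic n x y"
  have diff: "edge_diff (xco ?q) e = edge_diff x e" "edge_diff (yco ?q) e = edge_diff y e"
    if "e \<in> E" for e using edge_diff_from_isotropic edges that by auto
  show ?thesis
  proof (intro bexI[of _ ?q] conjI ballI from_isotropic_configurations)
    show "squared_length ?q e = l e" if "e \<in> E" for e
      using xy(1) that by (simp add: squared_length_def diff)
    show "sharp_drops r E (edge_diff (xco ?q)) = C"
      using sharp_drops_cong[OF diff(1), where E = E] xy(2) by simp
    show "sharp_drops r E (edge_diff (yco ?q)) = (E - C) \<union> {min_wrt r E}"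
      using sharp_drops_cong[OF diff(2), where E = E] xy(3) by simp
  qed
qed

text \<open>The measurement map hits every rapidly decreasing value, hence a Euclidean open set, and no
  hypersurface \<open>G = 0\<close> contains such a set.\<close>

lemma configuration_with_rapidly_decreasing_lengths:
  assumes "\<exists>l. G l \<noteq> 0" "G \<in> poly_funs E"
  shows "\<exists>p\<in>configurations n. rapidly_decreasing r E \<delta> (squared_length p) \<and> G (squared_length p) \<noteq> 0"
proof -
  obtain l0 where l0: "rapidly_decreasing r E \<delta> l0"
    using rapidly_decreasing_exists[OF order finite_E partition(1), of \<delta>] \<delta>_bounds by auto
  obtain m where m: "G m \<noteq> 0" using assms(1) ..
  have near: "eventually (\<lambda>t. rapidly_decreasing r E \<delta> (\<lambda>e. l0 e + t * (m e - l0 e))) (at 0)"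
  proof (rule rapidly_decreasing_eventually[OF finite_E e0_in_E[unfolded e0_def] l0])
    fix e
    have "((\<lambda>t. l0 e + t * (m e - l0 e)) \<longlongrightarrow> l0 e + 0 * (m e - l0 e)) (at 0)"
      by (intro tendsto_intros)
    then show "((\<lambda>t. l0 e + t * (m e - l0 e)) \<longlongrightarrow> l0 e) (at 0)" by simp
  qed
  have "line_closed (UNIV :: (nat set \<Rightarrow> complex) set)" by (simp add: line_closed_def)
  then have "\<exists>l\<in>UNIV. G l \<noteq> 0 \<and> rapidly_decreasing r E \<delta> l"
    by (rule poly_funs_nonzero_near[where Q = "rapidly_decreasing r E \<delta>" and a = m and b = l0,
          OF assms(2) _ UNIV_I m UNIV_I near])
  then obtain l where "G l \<noteq> 0 \<and> rapidly_decreasing r E \<delta> l" by (rule bexE)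
  then have l: "G l \<noteq> 0" "rapidly_decreasing r E \<delta> l" by (rule conjunct1, rule conjunct2)
  from realisation_of_basis[OF basis l(2)] obtain p where p1: "p \<in> configurations n"
    and p2: "(\<forall>e\<in>E. squared_length p e = l e) \<and> sharp_drops r E (edge_diff (xco p)) = B \<and>
      sharp_drops r E (edge_diff (yco p)) = (E - B) \<union> {min_wrt r E}" by (rule bexE)
  note p = p1 p2[THEN conjunct1, rule_format]
  have "G (squared_length p) = G l" by (rule poly_funs_cong[OF assms(2) p(2)])
  moreover have "rapidly_decreasing r E \<delta> (squared_length p)"
    using l(2) p(2) e0_in_E unfolding rapidly_decreasing_def e0_def by simp
  ultimately show ?thesis
    by (rule_tac bexI[of _ p, OF _ p(1)]) (simp only: l(1) simp_thms)
qed

text \<open>A realisation with \<open>x\<close>-difference \<open>1\<close> along the least edge is described by its \<open>x\<close>-differences along the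
  other edges of \<open>B\<close> and its \<open>y\<close>-differences along \<open>B'\<close>. These are as many numbers as there are edges, and
  the edge lengths are polynomials in them, so generic fibres are finite of bounded size.\<close>

lemma finitely_many_normalised_solutions:
  "\<exists>G\<in>poly_funs E. \<exists>N. (\<exists>l. G l \<noteq> 0) \<and> (\<forall>l. G l \<noteq> 0 \<longrightarrow> (\<exists>W. finite W \<and> card W \<le> N \<and>
     (\<forall>x y. edge_diff x e0 = 1 \<and> (\<forall>e\<in>E. edge_diff x e * edge_diff y e = l e) \<longrightarrow>
        (\<lambda>e\<in>E. if e \<in> B \<and> e \<noteq> e0 then edge_diff x e else edge_diff y e) \<in> W)))"
proof -
  obtain S \<beta> where "nbc_expansion r E B S \<beta>"
    using nbc_basis_expansion[OF order finite_E edges(2) partition(8)] by blast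
  then have S: "\<And>x e. e \<in> E \<Longrightarrow> edge_diff x e = (\<Sum>b\<in>B. S e b * edge_diff x b)"
    unfolding nbc_expansion_def by blast
  obtain S' \<beta>' where "nbc_expansion r E B' S' \<beta>'"
    using nbc_basis_expansion[OF order finite_E edges(2) partition(9)] by blast
  then have S': "\<And>x e. e \<in> E \<Longrightarrow> edge_diff x e = (\<Sum>b\<in>B'. S' e b * edge_diff x b)"
    unfolding nbc_expansion_def by blast
  define h where "h e v = (\<Sum>b\<in>B. S e b * (if b = e0 then 1 else v b)) * (\<Sum>b\<in>B'. S' e b * v b)"
    for e and v :: "nat set \<Rightarrow> complex"
  have "h e \<in> poly_funs E" for e
  proof -
    have "(\<lambda>v. if b = e0 then 1 else v b) \<in> poly_funs E" if "b \<in> B" for b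
      using that partition(4) by (cases "b = e0") (auto intro: poly_funs.intros)
    moreover have "(\<lambda>v. v b) \<in> poly_funs E" if "b \<in> B'" for b
      using that partition(5) by (auto intro: poly_funs.intros)
    ultimately show ?thesis
      unfolding h_def by (intro poly_funs.mult poly_funs_sum poly_funs.const)
  qed
  from generically_finite_fibres[where h = h, OF finite_E finite_E order.refl this]
  obtain G where G: "G \<in> poly_funs E" and "\<exists>N. (\<exists>l. G l \<noteq> 0) \<and>
    (\<forall>l. G l \<noteq> 0 \<longrightarrow> finite {restrict v E | v. \<forall>e\<in>E. h e v = l e} \<and>
       card {restrict v E | v. \<forall>e\<in>E. h e v = l e} \<le> N)" by (rule bexE)
  then obtain N where N: "(\<exists>l. G l \<noteq> 0) \<and>
    (\<forall>l. G l \<noteq> 0 \<longrightarrow> finite {restrict v E | v. \<forall>e\<in>E. h e v = l e} \<and>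
       card {restrict v E | v. \<forall>e\<in>E. h e v = l e} \<le> N)" by (elim exE)
  have solution: "(\<lambda>e\<in>E. if e \<in> B \<and> e \<noteq> e0 then edge_diff x e else edge_diff y e)
      \<in> {restrict v E | v. \<forall>e\<in>E. h e v = l e}"
    if x0: "edge_diff x e0 = 1" and xy: "\<forall>e\<in>E. edge_diff x e * edge_diff y e = l e" for x y l
  proof -
    define v where "v e = (if e \<in> B \<and> e \<noteq> e0 then edge_diff x e else edge_diff y e)" for e
    have "h e v = l e" if e: "e \<in> E" for e
    proof -
      have "(\<Sum>b\<in>B. S e b * (if b = e0 then 1 else v b)) = edge_diff x e"
        unfolding S[OF e, of x] using x0 by (intro sum.cong) (auto simp: v_def)
      moreover have "(\<Sum>b\<in>B'. S' e b * v b) = edge_diff y e"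
        unfolding S'[OF e, of y] using partition(6) by (intro sum.cong) (auto simp: v_def)
      ultimately show ?thesis using xy e by (simp add: h_def)
    qed
    then show ?thesis unfolding v_def[symmetric] by blast
  qed
  show ?thesis
  proof (rule bexI[where x = G], rule exI[where x = N], intro conjI allI impI)
    show "\<exists>l. G l \<noteq> 0" using N by (rule conjunct1)
    show "G \<in> poly_funs E" by (rule G)
    fix l assume l: "G l \<noteq> 0"
    let ?W = "{restrict v E | v. \<forall>e\<in>E. h e v = l e}"
    have W: "finite ?W" "card ?W \<le> N" using N[THEN conjunct2, rule_format, OF l] by (rule conjunct1, rule conjunct2)
    show "\<exists>W. finite W \<and> card W \<le> N \<and>
     (\<forall>x y. edge_diff x e0 = 1 \<and> (\<forall>e\<in>E. edge_diff x e * edge_diff y e = l e) \<longrightarrow>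
        (\<lambda>e\<in>E. if e \<in> B \<and> e \<noteq> e0 then edge_diff x e else edge_diff y e) \<in> W)"
      by (rule exI[where x = ?W], intro conjI allI impI W, rule solution; elim conjE; assumption)
  qed
qed

text \<open>Scaling the isotropic coordinates by \<open>s\<close> and its inverse is a rotation. It normalises the \<open>x\<close>-difference
  along the least edge; the remaining differences follow from the recorded ones because the lengths are
  given and not zero.\<close>

lemma congruent_if_same_normalisation:
  assumes q: "q \<in> fibre n E p" "q' \<in> fibre n E p" and p: "\<And>e. e \<in> E \<Longrightarrow> squared_length p e \<noteq> 0"
    and s: "s = edge_diff (xco q) e0" "s' = edge_diff (xco q') e0"
    and same: "\<And>e. e \<in> E \<Longrightarrow>
      (if e \<in> B \<and> e \<noteq> e0 then edge_diff (xco q) e / s else edge_diff (yco q) e * s) =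
      (if e \<in> B \<and> e \<noteq> e0 then edge_diff (xco q') e / s' else edge_diff (yco q') e * s')"
  shows "(q, q') \<in> congruence n"
proof -
  have conf: "q \<in> configurations n" "q' \<in> configurations n" using q by (auto simp: fibre_iff)
  have len: "edge_diff (xco q) e * edge_diff (yco q) e = squared_length p e"
    "edge_diff (xco q') e * edge_diff (yco q') e = squared_length p e" if "e \<in> E" for e
    using q that by (auto simp: fibre_iff squared_length_def)
  have nz: "edge_diff (xco q) e \<noteq> 0" "edge_diff (yco q) e \<noteq> 0"
    "edge_diff (xco q') e \<noteq> 0" "edge_diff (yco q') e \<noteq> 0" if "e \<in> E" for e
    using len[OF that] p[OF that] by auto
  have s_nz: "s \<noteq> 0" "s' \<noteq> 0" using nz[OF e0_in_E] s by auto
  have both: "edge_diff (xco q) e = s / s' * edge_diff (xco q') e \<and>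
      edge_diff (yco q) e = s' / s * edge_diff (yco q') e" if e: "e \<in> E" for e
  proof (cases "e \<in> B \<and> e \<noteq> e0")
    case True
    then have x: "edge_diff (xco q) e = s / s' * edge_diff (xco q') e"
      using same[OF e] s_nz by (simp add: field_simps)
    have "s / s' * edge_diff (xco q') e * edge_diff (yco q) e =
        edge_diff (xco q') e * edge_diff (yco q') e" using len[OF e] x by simp
    then have "edge_diff (yco q) e = s' / s * edge_diff (yco q') e"
      using nz[OF e] s_nz by (simp add: field_simps)
    then show ?thesis using x by simp
  next
    case False
    then have y: "edge_diff (yco q) e = s' / s * edge_diff (yco q') e"
      using same[OF e] s_nz by (auto simp: field_simps)
    have "edge_diff (xco q) e * (s' / s * edge_diff (yco q') e) =
        edge_diff (xco q') e * edge_diff (yco q') e" using len[OF e] y by simp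
    then have "edge_diff (xco q) e = s / s' * edge_diff (xco q') e"
      using nz[OF e] s_nz by (simp add: field_simps)
    then show ?thesis using y by simp
  qed
  show ?thesis
  proof (rule congruence_of_proportional[OF conf connected])
    show "e \<subseteq> {1..n} \<and> card e = 2" if "e \<in> E" for e using edges that by blast
    show "s / s' * (s' / s) = 1" using s_nz by simp
  qed (use both in auto)
qed

lemma bounded_number_of_classes: "\<exists>m. generically n (\<lambda>p. \<not> many_classes n E m p)"
proof -
  from finitely_many_normalised_solutions obtain G where G: "G \<in> poly_funs E" and
    "\<exists>N. (\<exists>l. G l \<noteq> 0) \<and> (\<forall>l. G l \<noteq> 0 \<longrightarrow> (\<exists>W. finite W \<and> card W \<le> N \<and>
     (\<forall>x y. edge_diff x e0 = 1 \<and> (\<forall>e\<in>E. edge_diff x e * edge_diff y e = l e) \<longrightarrow>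
        (\<lambda>e\<in>E. if e \<in> B \<and> e \<noteq> e0 then edge_diff x e else edge_diff y e) \<in> W)))" by (rule bexE)
  then obtain N where N: "(\<exists>l. G l \<noteq> 0) \<and> (\<forall>l. G l \<noteq> 0 \<longrightarrow> (\<exists>W. finite W \<and> card W \<le> N \<and>
     (\<forall>x y. edge_diff x e0 = 1 \<and> (\<forall>e\<in>E. edge_diff x e * edge_diff y e = l e) \<longrightarrow>
        (\<lambda>e\<in>E. if e \<in> B \<and> e \<noteq> e0 then edge_diff x e else edge_diff y e) \<in> W)))" by (elim exE)
  obtain p0 where p0: "p0 \<in> configurations n" "rapidly_decreasing r E \<delta> (squared_length p0)"
    "G (squared_length p0) \<noteq> 0"
    using configuration_with_rapidly_decreasing_lengths[OF conjunct1[OF N] G] by blast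
  define g where "g v = G (\<lambda>e. squared_length (conf_of n 0 v) e) *
      (\<Prod>e\<in>E. squared_length (conf_of n 0 v) e)" for v
  have "g \<in> poly_funs UNIV"
    unfolding g_def by (intro poly_funs.mult poly_funs_prod poly_funs_compose[OF G]
        poly_funs_squared_length edges)
  moreover have g: "g (embed n p) = G (squared_length p) * (\<Prod>e\<in>E. squared_length p e)"
    if "p \<in> configurations n" for p
    using conf_of_embed[OF that] by (simp add: g_def)
  have "g (embed n p0) \<noteq> 0"
    using p0 finite_E by (simp add: g rapidly_decreasing_def)
  moreover have "\<not> many_classes n E (Suc N) p" if p: "p \<in> configurations n" "g (embed n p) \<noteq> 0" for p
  proof
    assume "many_classes n E (Suc N) p"
    then obtain q where q: "\<And>j. j \<in> {1..Suc N} \<Longrightarrow> q j \<in> fibre n E p"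
      "\<And>j l. j \<in> {1..Suc N} \<Longrightarrow> l \<in> {1..Suc N} \<Longrightarrow> j < l \<Longrightarrow> (q j, q l) \<notin> congruence n"
      unfolding many_classes_def by blast
    have Gp: "G (squared_length p) \<noteq> 0" and nz: "\<And>e. e \<in> E \<Longrightarrow> squared_length p e \<noteq> 0"
      using p g finite_E by auto
    obtain W where W: "finite W" "card W \<le> N" and sol: "\<forall>x y. edge_diff x e0 = 1 \<and>
       (\<forall>e\<in>E. edge_diff x e * edge_diff y e = squared_length p e) \<longrightarrow>
        (\<lambda>e\<in>E. if e \<in> B \<and> e \<noteq> e0 then edge_diff x e else edge_diff y e) \<in> W"
      using N[THEN conjunct2, rule_format, OF Gp] by (elim exE conjE) (rule that)
    define s where "s j = edge_diff (xco (q j)) e0" for j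
    define z where "z j = (\<lambda>e\<in>E. if e \<in> B \<and> e \<noteq> e0 then edge_diff (xco (q j)) e / s j
        else edge_diff (yco (q j)) e * s j)" for j
    have "z j \<in> W" if j: "j \<in> {1..Suc N}" for j
    proof -
      have len: "edge_diff (xco (q j)) e * edge_diff (yco (q j)) e = squared_length p e" if "e \<in> E" for e
        using q(1)[OF j] that by (auto simp: fibre_iff squared_length_def)
      have s_nz: "s j \<noteq> 0" using len[OF e0_in_E] nz[OF e0_in_E] by (auto simp: s_def)
      let ?x = "\<lambda>i. inverse (s j) * xco (q j) i" and ?y = "\<lambda>i. s j * yco (q j) i"
      have x0: "edge_diff ?x e0 = 1" using s_nz by (simp add: edge_diff_scaled s_def)
      have xy: "\<forall>e\<in>E. edge_diff ?x e * edge_diff ?y e = squared_length p e"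
      proof -
        have "inverse (s j) * a * (s j * b) = a * b" for a b using s_nz by (simp add: field_simps)
        then show ?thesis using len by (simp only: edge_diff_scaled) blast
      qed
      have "(\<lambda>e\<in>E. if e \<in> B \<and> e \<noteq> e0 then edge_diff ?x e else edge_diff ?y e) \<in> W"
        by (rule mp[OF sol[THEN spec[of _ ?x], THEN spec[of _ ?y]] conjI[OF x0 xy]])
      moreover have "(\<lambda>e\<in>E. if e \<in> B \<and> e \<noteq> e0 then edge_diff ?x e else edge_diff ?y e) = z j"
        unfolding z_def edge_diff_scaled by (simp only: divide_inverse mult.commute)
      ultimately show ?thesis by simp
    qed
    then have "z ` {1..Suc N} \<subseteq> W" by blast
    then have "card (z ` {1..Suc N}) \<le> N" using W by (meson card_mono le_trans)
    moreover have "z j \<noteq> z l" if jl: "j \<in> {1..Suc N}" "l \<in> {1..Suc N}" "j < l" for j l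
    proof
      assume eq: "z j = z l"
      have "(q j, q l) \<in> congruence n"
      proof (rule congruent_if_same_normalisation[OF q(1)[OF jl(1)] q(1)[OF jl(2)] nz s_def s_def])
        fix e assume "e \<in> E"
        then show "(if e \<in> B \<and> e \<noteq> e0 then edge_diff (xco (q j)) e / s j else edge_diff (yco (q j)) e * s j) =
          (if e \<in> B \<and> e \<noteq> e0 then edge_diff (xco (q l)) e / s l else edge_diff (yco (q l)) e * s l)"
          using fun_cong[OF eq, of e] unfolding z_def by (simp only: restrict_apply if_True)
      qed
      then show False using q(2)[OF jl] by blast
    qed
    then have "inj_on z {1..Suc N}" by (intro linorder_inj_onI) auto
    then have "card (z ` {1..Suc N}) = Suc N" by (simp add: card_image)
    ultimately show False by simp
  qed
  ultimately have "generically n (\<lambda>p. \<not> many_classes n E (Suc N) p)"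
    using p0(1) by (intro genericallyI)
  then show ?thesis by (rule exI)
qed

text \<open>Having at least \<open>m\<close> classes is generically true or generically false for each \<open>m\<close>. It is true for
  \<open>m = 0\<close> and false for large \<open>m\<close>; the number sought is the last \<open>m\<close> for which it is true.\<close>

lemma generic_number_of_classes:
  "\<exists>c. generically n (\<lambda>p. finite (fibre n E p // congruence n) \<and>
     card (fibre n E p // congruence n) = c)"
proof -
  let ?T = "\<lambda>m. generically n (many_classes n E m)"
  have "?T 0"
  proof -
    have "generically n (\<lambda>p. True) \<or> generically n (\<lambda>p. \<not> True)"
      using constructible_generically[OF constructible_const[of True]] .
    then have "generically n (\<lambda>p. True)" using generically_ex[of n "\<lambda>p. \<not> True"] by blast
    then show ?thesis by (rule generically_mono) (simp add: many_classes_def)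
  qed
  have dichotomy: "?T m \<or> generically n (\<lambda>p. \<not> many_classes n E m p)" for m
  proof -
    obtain P where P: "constructible P" "\<forall>p\<in>configurations n. P (embed n p) \<longleftrightarrow> many_classes n E m p"
      using constructible_many_classes[OF finite_E, of n m] edges by blast
    from constructible_generically[OF P(1), of n] show ?thesis
    proof
      assume "generically n (\<lambda>p. P (embed n p))"
      then have "?T m" by (rule generically_mono) (use P(2) in blast)
      then show ?thesis ..
    next
      assume "generically n (\<lambda>p. \<not> P (embed n p))"
      then have "generically n (\<lambda>p. \<not> many_classes n E m p)"
        by (rule generically_mono) (use P(2) in blast)
      then show ?thesis ..
    qed
  qed
  obtain m where "generically n (\<lambda>p. \<not> many_classes n E m p)" using bounded_number_of_classes by blast
  then have "\<not> ?T m" using generically_ex[OF generically_conj[of n "many_classes n E m"]] by blast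
  then have "\<exists>k. ?T k \<and> \<not> ?T (Suc k)" using \<open>?T 0\<close> by (induction m) auto
  then obtain c where c: "?T c" "\<not> ?T (Suc c)" by blast
  then have "generically n (\<lambda>p. \<not> many_classes n E (Suc c) p)" using dichotomy by blast
  with c(1) have "generically n (\<lambda>p. many_classes n E c p \<and> \<not> many_classes n E (Suc c) p)"
    by (rule generically_conj)
  then have "generically n (\<lambda>p. finite (fibre n E p // congruence n) \<and>
     card (fibre n E p // congruence n) = c)"
    by (rule generically_mono) (use number_of_classes in blast)
  then show ?thesis by (rule exI)
qed

text \<open>The number in the definition exists, and it is unique because two non-empty Zariski open sets
  intersect.\<close>

lemma realisation_number_generic:
  "generically n (\<lambda>p. finite (fibre n E p // congruence n) \<and>
     card (fibre n E p // congruence n) = realisation_number TYPE(2) n E)"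
proof -
  let ?Q = "\<lambda>c. generically n (\<lambda>p. finite (fibre n E p // congruence n) \<and>
     card (fibre n E p // congruence n) = c)"
  obtain c where c: "?Q c" using generic_number_of_classes by (rule exE)
  have "c' = c" if "?Q c'" for c'
    using generically_ex[OF generically_conj[OF that c]] by auto
  then have "?Q (THE c. ?Q c)" using c by (rule_tac theI) 
  then show ?thesis unfolding realisation_number_def generically_iff_zariski_open .
qed

text \<open>A rotation scales all \<open>x\<close>-differences by one factor and keeps their drops. A reflection exchanges the
  roles of \<open>x\<close> and \<open>y\<close>.\<close>

lemma at_most_two_bases_per_class:
  assumes "(q, q') \<in> congruence n"
    and "sharp_drops r E (edge_diff (xco q)) = C"
    and "sharp_drops r E (edge_diff (xco q')) = C'"
    and "sharp_drops r E (edge_diff (yco q')) = D'"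
  shows "C = C' \<or> C = D'"
proof -
  obtain s t where st: "s * t = 1" and alt:
    "(\<forall>e. e \<subseteq> {1..n} \<and> card e = 2 \<longrightarrow> edge_diff (xco q) e = s * edge_diff (xco q') e \<and>
        edge_diff (yco q) e = t * edge_diff (yco q') e) \<or>
     (\<forall>e. e \<subseteq> {1..n} \<and> card e = 2 \<longrightarrow> edge_diff (xco q) e = s * edge_diff (yco q') e \<and>
        edge_diff (yco q) e = t * edge_diff (xco q') e)"
    using congruence_isotropic[OF assms(1)] by blast
  have "s \<noteq> 0" using st by auto
  from alt show ?thesis
  proof
    assume *: "\<forall>e. e \<subseteq> {1..n} \<and> card e = 2 \<longrightarrow> edge_diff (xco q) e = s * edge_diff (xco q') e \<and>
        edge_diff (yco q) e = t * edge_diff (yco q') e"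
    have "sharp_drops r E (edge_diff (xco q)) = sharp_drops r E (\<lambda>e. s * edge_diff (xco q') e)"
      by (rule sharp_drops_cong, rule *[rule_format, THEN conjunct1]) (use edges in blast)
    then show ?thesis using sharp_drops_scale[OF \<open>s \<noteq> 0\<close>, of r E] assms(2,3) by simp
  next
    assume *: "\<forall>e. e \<subseteq> {1..n} \<and> card e = 2 \<longrightarrow> edge_diff (xco q) e = s * edge_diff (yco q') e \<and>
        edge_diff (yco q) e = t * edge_diff (xco q') e"
    have "sharp_drops r E (edge_diff (xco q)) = sharp_drops r E (\<lambda>e. s * edge_diff (yco q') e)"
      by (rule sharp_drops_cong, rule *[rule_format, THEN conjunct1]) (use edges in blast)
    then show ?thesis using sharp_drops_scale[OF \<open>s \<noteq> 0\<close>, of r E] assms(2,4) by simp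
  qed
qed

text \<open>Choose a generic configuration whose edge lengths decrease rapidly. Every realisation basis gives a
  configuration in its fibre. A class that contains the configuration of \<open>C'\<close> can contain besides it only
  the one of the complementary basis of \<open>C'\<close>, which costs the factor \<open>2\<close>.\<close>

theorem realisation_bases_bound:
  "card {C. realisation_basis E (graph_cycles E) r C} \<le> 2 * realisation_number TYPE(2) n E"
proof -
  let ?Bases = "{C. realisation_basis E (graph_cycles E) r C}"
  obtain g p1 where g: "g \<in> poly_funs UNIV" "p1 \<in> configurations n" "g (embed n p1) \<noteq> 0"
    and count: "\<And>p. p \<in> configurations n \<Longrightarrow> g (embed n p) \<noteq> 0 \<Longrightarrow>
      finite (fibre n E p // congruence n) \<and>
      card (fibre n E p // congruence n) = realisation_number TYPE(2) n E"
    using realisation_number_generic unfolding generically_def by blast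
  obtain p0 where p0: "p0 \<in> configurations n" "rapidly_decreasing r E \<delta> (squared_length p0)"
    using configuration_with_rapidly_decreasing_lengths[of "\<lambda>_. 1"] poly_funs.const by auto
  define Q where "Q v = rapidly_decreasing r E \<delta> (squared_length (conf_of n 0 v))" for v
  have "\<exists>v\<in>embed n ` configurations n. g v \<noteq> 0 \<and> Q v"
  proof (rule poly_funs_nonzero_near[OF g(1) line_closed_embed imageI[OF g(2)] g(3) imageI[OF p0(1)]])
    let ?v = "\<lambda>t i. embed n p0 i + t * (embed n p1 i - embed n p0 i)"
    show "\<forall>\<^sub>F t in at 0. Q (?v t)"
      unfolding Q_def
    proof (rule rapidly_decreasing_eventually[OF finite_E e0_in_E[unfolded e0_def] p0(2)])
      fix e assume e: "e \<in> E"
      obtain c where c: "\<forall>t. squared_length (conf_of n 0 (?v t)) e = poly c t"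
        using poly_funs_on_line[OF poly_funs_squared_length[OF edges[OF e], of 0]] by blast
      have "(poly c \<longlongrightarrow> poly c 0) (at 0)" using poly_isCont isCont_def by blast
      moreover have "poly c 0 = squared_length p0 e"
        using c[rule_format, of 0] conf_of_embed[OF p0(1)] by simp
      ultimately show "((\<lambda>t. squared_length (conf_of n 0 (?v t)) e) \<longlongrightarrow> squared_length p0 e) (at 0)"
        using c by simp
    qed
  qed
  then obtain p where p: "p \<in> configurations n" "g (embed n p) \<noteq> 0"
    and rapid: "rapidly_decreasing r E \<delta> (squared_length p)"
    using conf_of_embed unfolding Q_def by auto
  let ?X = "fibre n E p // congruence n"
  have "\<exists>q. q \<in> fibre n E p \<and> sharp_drops r E (edge_diff (xco q)) = C \<and>
     sharp_drops r E (edge_diff (yco q)) = (E - C) \<union> {min_wrt r E}" if "C \<in> ?Bases" for C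
    using realisation_of_basis[of C, OF _ rapid] that by (auto simp: fibre_iff)
  then have "\<forall>C\<in>?Bases. \<exists>q. q \<in> fibre n E p \<and> sharp_drops r E (edge_diff (xco q)) = C \<and>
     sharp_drops r E (edge_diff (yco q)) = (E - C) \<union> {min_wrt r E}" by (rule ballI)
  from bchoice[OF this] obtain q where q: "\<forall>C\<in>?Bases. q C \<in> fibre n E p \<and>
     sharp_drops r E (edge_diff (xco (q C))) = C \<and>
     sharp_drops r E (edge_diff (yco (q C))) = (E - C) \<union> {min_wrt r E}" by (rule exE)
  define \<kappa> where "\<kappa> C = congruence n `` {q C}" for C
  have "?Bases \<subseteq> Pow E" using realisation_basis_partition(4)[OF order finite_E] by blast
  then have fin: "finite ?Bases" using finite_E finite_subset by blast
  have "card {C\<in>?Bases. \<kappa> C = K} \<le> 2" if K: "K \<in> \<kappa> ` ?Bases" for K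
  proof -
    obtain C' where C': "C' \<in> ?Bases" "K = \<kappa> C'" using K by blast
    have "{C\<in>?Bases. \<kappa> C = K} \<subseteq> {C', (E - C') \<union> {min_wrt r E}}"
    proof
      fix C assume C: "C \<in> {C\<in>?Bases. \<kappa> C = K}"
      then have "q C \<in> configurations n" "q C' \<in> configurations n"
        using q C' by (auto simp: fibre_iff)
      then have "(q C, q C') \<in> congruence n"
        using C C'(2) eq_equiv_class_iff[OF equiv_congruence] unfolding \<kappa>_def by blast
      then have "C = C' \<or> C = (E - C') \<union> {min_wrt r E}"
        using q C C'(1) by (intro at_most_two_bases_per_class) auto
      then show "C \<in> {C', (E - C') \<union> {min_wrt r E}}" by simp
    qed
    then have "card {C\<in>?Bases. \<kappa> C = K} \<le> card {C', (E - C') \<union> {min_wrt r E}}"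
      by (intro card_mono) auto
    also have "\<dots> \<le> 2" by (simp add: card_insert_if)
    finally show ?thesis .
  qed
  then have "(\<Sum>K\<in>\<kappa> ` ?Bases. card {C\<in>?Bases. \<kappa> C = K}) \<le> (\<Sum>K\<in>\<kappa> ` ?Bases. 2)"
    by (rule sum_mono)
  moreover have "card ?Bases = (\<Sum>K\<in>\<kappa> ` ?Bases. card {C\<in>?Bases. \<kappa> C = K})"
    using sum.image_gen[OF fin, of "\<lambda>_. 1::nat" \<kappa>] by simp
  ultimately have "card ?Bases \<le> 2 * card (\<kappa> ` ?Bases)" by simp
  also have "card (\<kappa> ` ?Bases) \<le> card ?X"
  proof (rule card_mono)
    show "finite ?X" using count[OF p] by blast
    show "\<kappa> ` ?Bases \<subseteq> ?X" using q by (auto simp: \<kappa>_def intro!: quotientI)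
  qed
  also have "card ?X = realisation_number TYPE(2) n E" using count[OF p] by blast
  finally show ?thesis by simp
qed

end

theorem corollary5p14:
  fixes n :: nat and E :: "nat set set" and r :: "(nat set \<times> nat set) set"
  assumes "simple_graph n E"
    and "n \<ge> 3"
    and "minimally_d_rigid TYPE(2) n E"
    and "linear_order_on E r"
  shows "2 * realisation_number TYPE(2) n E \<ge> card {B. realisation_basis E (graph_cycles E) r B}"
proof (cases "\<exists>B. realisation_basis E (graph_cycles E) r B")
  case True
  then obtain B where B: "realisation_basis E (graph_cycles E) r B" by blast
  obtain p :: "nat \<Rightarrow> real ^ 2" where "rigid_framework n E p"
    using assms(3) unfolding minimally_d_rigid_def d_rigid_def by blast
  then have "realisable_graph n E r B"
    using assms(1,4) B by unfold_locales (auto intro: rigid_framework_connected)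
  then show ?thesis by (rule realisable_graph.realisation_bases_bound)
qed simp

end
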